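(* The decision problem Extension Globally Minimal Defensive Alliance is $\mathsf{NP}$-complete, even when restricted to bipartite input graphs of maximum degree at most $9$.
   Context: Graphs are finite, simple and undirected. For $G=(V,E)$, $X\subseteq V$ and $v\in V$, $\deg_X(v)$ is the number of neighbors of $v$ in $X$, and $\overline{X}=V\setminus X$. A set $A\subseteq V$ is a defensive alliance if $\deg_A(v)+1\ge \deg_{\overline{A}}(v)$ for every $v\in A$. A non-empty defensive alliance is globally minimal if no proper subset of it is a non-empty defensive alliance. Problem Extension Globally Minimal Defensive Alliance. Input: a graph $G=(V,E)$ and sets $U,N\subseteq V$. Question: is there a globally minimal defensive alliance $A\subseteq V\setminus N$ of $G$ with $U\subseteq A$? *)

theory Defs
  imports Main "HOL-Computational_Algebra.Polynomial"
begin

section \<open>Deterministic multi-tape Turing machines\<close>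

text \<open>
  States and tape symbols are initial segments of the natural numbers. State 0 is the start
  state, states 1 and 2 are the halting states (accepting and rejecting). Symbol 0 is the blank,
  symbols 1 and 2 stand for the bits False and True; a machine may have further symbols.
  Tapes are infinite in both directions. Tape 0 carries the input; tape 1 carries the
  certificate when the machine is used as a verifier, and the output when it computes a function.
\<close>

datatype dir = Left | Stay | Right

fun offset :: "dir \<Rightarrow> int" where
  "offset Left = -1"
| "offset Stay = 0"
| "offset Right = 1"

record tm =
  tapes :: nat
  symbols :: nat
  states :: nat
  delta :: "nat \<Rightarrow> nat list \<Rightarrow> nat \<times> (nat \<times> dir) list"

definition wf_tm :: "tm \<Rightarrow> bool" where
  "wf_tm M \<longleftrightarrow> 2 \<le> tapes M \<and> 3 \<le> symbols M \<and> 3 \<le> states M \<and>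
     (\<forall>q < states M. \<forall>as. length as = tapes M \<and> (\<forall>a \<in> set as. a < symbols M) \<longrightarrow>
        (case delta M q as of (q', acts) \<Rightarrow>
           q' < states M \<and> length acts = tapes M \<and> (\<forall>(b, d) \<in> set acts. b < symbols M)))"

type_synonym tape = "(int \<Rightarrow> nat) \<times> int"  \<comment> \<open>contents and head position\<close>
type_synonym config = "nat \<times> tape list"

abbreviation accepting :: nat where "accepting \<equiv> 1"
abbreviation rejecting :: nat where "rejecting \<equiv> 2"

definition word_tape :: "bool list \<Rightarrow> int \<Rightarrow> nat" where
  "word_tape w i =
     (if 0 \<le> i \<and> i < int (length w) then (if w ! nat i then 2 else 1) else 0)"

definition init :: "tm \<Rightarrow> bool list \<Rightarrow> bool list \<Rightarrow> config" where
  "init M x y =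
     (0, (word_tape x, 0) # (word_tape y, 0) # replicate (tapes M - 2) (word_tape [], 0))"

definition act :: "tape \<Rightarrow> nat \<times> dir \<Rightarrow> tape" where
  "act = (\<lambda>(t, h) (b, d). (t(h := b), h + offset d))"

text \<open>Halting configurations are fixed points, so the state after exactly \<open>T\<close> steps tells
  whether and how the machine halts within \<open>T\<close> steps.\<close>

definition step :: "tm \<Rightarrow> config \<Rightarrow> config" where
  "step M = (\<lambda>(q, ts).
     if q = accepting \<or> q = rejecting then (q, ts)
     else (case delta M q (map (\<lambda>(t, h). t h) ts) of (q', acts) \<Rightarrow> (q', map2 act ts acts)))"

definition run :: "tm \<Rightarrow> bool list \<Rightarrow> bool list \<Rightarrow> nat \<Rightarrow> config" where
  "run M x y T = (step M ^^ T) (init M x y)"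

section \<open>Polynomial time, NP and NP-completeness\<close>

definition poly_time_decidable :: "(bool list \<Rightarrow> bool list \<Rightarrow> bool) \<Rightarrow> bool" where
  "poly_time_decidable R \<longleftrightarrow> (\<exists>M (p :: nat poly). wf_tm M \<and>
     (\<forall>x y. fst (run M x y (poly p (length x + length y))) =
              (if R x y then accepting else rejecting)))"

definition poly_time_computable :: "(bool list \<Rightarrow> bool list) \<Rightarrow> bool" where
  "poly_time_computable f \<longleftrightarrow> (\<exists>M (p :: nat poly). wf_tm M \<and>
     (\<forall>x. case run M x [] (poly p (length x)) of (q, ts) \<Rightarrow>
            q = accepting \<and> fst (ts ! 1) = word_tape (f x)))"

definition NP :: "bool list set set" where
  "NP = {A. \<exists>R (p :: nat poly). poly_time_decidable R \<and>
              (\<forall>x. x \<in> A \<longleftrightarrow> (\<exists>y. length y \<le> poly p (length x) \<and> R x y))}"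

definition poly_reducible :: "bool list set \<Rightarrow> bool list set \<Rightarrow> bool" where
  "poly_reducible A B \<longleftrightarrow> (\<exists>f. poly_time_computable f \<and> (\<forall>x. x \<in> A \<longleftrightarrow> f x \<in> B))"

definition NP_complete :: "bool list set \<Rightarrow> bool" where
  "NP_complete B \<longleftrightarrow> B \<in> NP \<and> (\<forall>A \<in> NP. poly_reducible A B)"

section \<open>Graphs and defensive alliances\<close>

definition simple_graph :: "'a set \<Rightarrow> 'a set set \<Rightarrow> bool" where
  "simple_graph V E \<longleftrightarrow> finite V \<and> (\<forall>e \<in> E. e \<subseteq> V \<and> card e = 2)"

definition deg_in :: "'a set set \<Rightarrow> 'a set \<Rightarrow> 'a \<Rightarrow> nat" where
  "deg_in E X v = card {u \<in> X. {u, v} \<in> E}"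

text \<open>The 0 makes the maximum degree of the graph without vertices well defined.\<close>

definition max_degree :: "'a set \<Rightarrow> 'a set set \<Rightarrow> nat" where
  "max_degree V E = Max (insert 0 (deg_in E V ` V))"

definition bipartite :: "'a set \<Rightarrow> 'a set set \<Rightarrow> bool" where
  "bipartite V E \<longleftrightarrow> (\<exists>X Y. X \<union> Y = V \<and> X \<inter> Y = {} \<and>
     (\<forall>e \<in> E. \<exists>x \<in> X. \<exists>y \<in> Y. e = {x, y}))"

definition defensive_alliance :: "'a set \<Rightarrow> 'a set set \<Rightarrow> 'a set \<Rightarrow> bool" where
  "defensive_alliance V E A \<longleftrightarrow>
     A \<subseteq> V \<and> (\<forall>v \<in> A. deg_in E A v + 1 \<ge> deg_in E (V - A) v)"

definition globally_minimal_defensive_alliance :: "'a set \<Rightarrow> 'a set set \<Rightarrow> 'a set \<Rightarrow> bool" where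
  "globally_minimal_defensive_alliance V E A \<longleftrightarrow>
     A \<noteq> {} \<and> defensive_alliance V E A \<and>
     (\<forall>B. B \<subset> A \<longrightarrow> \<not> (B \<noteq> {} \<and> defensive_alliance V E B))"

definition ext_gmda :: "'a set \<Rightarrow> 'a set set \<Rightarrow> 'a set \<Rightarrow> 'a set \<Rightarrow> bool" where
  "ext_gmda V E U N \<longleftrightarrow>
     (\<exists>A. A \<subseteq> V - N \<and> globally_minimal_defensive_alliance V E A \<and> U \<subseteq> A)"

section \<open>The decision problem as a language\<close>

text \<open>
  An instance with vertex set \<open>{..<n}\<close> is encoded by the unary representation of \<open>n\<close>, the
  adjacency matrix (row by row) and the characteristic vectors of \<open>U\<close> and \<open>N\<close>.
\<close>

definition encode :: "nat \<Rightarrow> nat set set \<Rightarrow> nat set \<Rightarrow> nat set \<Rightarrow> bool list" where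
  "encode n E U N =
     replicate n True @ [False] @
     concat (map (\<lambda>i. map (\<lambda>j. {i, j} \<in> E) [0..<n]) [0..<n]) @
     map (\<lambda>i. i \<in> U) [0..<n] @ map (\<lambda>i. i \<in> N) [0..<n]"

definition instance_ok :: "nat \<Rightarrow> nat set set \<Rightarrow> nat set \<Rightarrow> nat set \<Rightarrow> bool" where
  "instance_ok n E U N \<longleftrightarrow> simple_graph {..<n} E \<and> U \<subseteq> {..<n} \<and> N \<subseteq> {..<n}"

lemma encode_inj:
  assumes ok: "instance_ok n E U N" "instance_ok n' E' U' N'"
    and eq: "encode n E U N = encode n' E' U' N'"
  shows "n = n' \<and> E = E' \<and> U = U' \<and> N = N'"
proof -
  have tr: "takeWhile id (replicate m True @ False # zs) = replicate m True" for m zs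
    by (induction m) simp_all
  have tw: "takeWhile id (encode m F S T) = replicate m True" for m F S T
    unfolding encode_def by (simp only: append.simps tr)
  have n: "n = n'"
    using tw[of n E U N] tw[of n' E' U' N'] eq by (metis length_replicate)
  let ?M = "\<lambda>F. map (\<lambda>i. map (\<lambda>j. {i, j} \<in> F) [0..<n]) [0..<n]"
  let ?b = "\<lambda>S. map (\<lambda>i. i \<in> S) [0..<n]"
  have len: "length (concat (?M F)) = n * n" for F
    by (simp add: length_concat o_def sum_list_triv)
  have "concat (?M E) @ ?b U @ ?b N = concat (?M E') @ ?b U' @ ?b N'"
    using eq unfolding encode_def n by simp
  then have c: "concat (?M E) = concat (?M E')" and U: "?b U = ?b U'" and N: "?b N = ?b N'"
    using len[of E] len[of E'] by (simp_all add: append_eq_append_conv)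
  have "?M E = ?M E'"
    by (rule concat_injective[OF c]) (auto simp: set_zip)
  then have "({i, j} \<in> E) = ({i, j} \<in> E')" if "i < n" "j < n" for i j
    using that by (auto simp: list_eq_iff_nth_eq)
  then have E: "E = E'"
    using ok unfolding instance_ok_def simple_graph_def n
    by (intro set_eqI) (metis card_2_iff insert_subset lessThan_iff)
  have "U = U'" "N = N'"
    using U N ok unfolding instance_ok_def n by (auto simp: list_eq_iff_nth_eq)
  with n E show ?thesis by simp
qed

text \<open>The parameter \<open>C\<close> restricts the class of input graphs.\<close>

definition ext_gmda_language :: "(nat set \<Rightarrow> nat set set \<Rightarrow> bool) \<Rightarrow> bool list set" where
  "ext_gmda_language C =
     {encode n E U N | n E U N. instance_ok n E U N \<and> C {..<n} E \<and> ext_gmda {..<n} E U N}"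

end

theory Submission imports Defs begin

text \<open>
  Both membership and hardness rest on a small class of functions: arithmetic with bounded sums over
  the positions of the input. Such functions are evaluated by programs over unary counters, a
  counter being a tape with a marker at cell 0 whose value is the head position, and these programs
  are compiled to Turing machines.

  For membership the certificate contains, besides the alliance \<open>A\<close> and a 2-colouring, for every
  \<open>v \<in> A\<close> an elimination sequence showing that \<open>A - {v}\<close> contains no non-empty alliance.

  For hardness, an accepting run of the verifier is described by clauses about the cells at a
  given distance from the head. Almost all of them are Horn clauses, so that every model contains
  the true run. The clauses are split by prefix variables (the clause is satisfied before position
  \<open>v\<close>) into cells with at most three literals. In the graph, a literal is a vertex with at most three
  neighbours, one of which is its negation; hence two opposite literals in \<open>A\<close> would form an alliance
  of size two. Each wire, a vertex in \<open>U\<close>, needs one of its two literals, and the wires of a variable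
  form a cycle of implications, so that all copies of the variable agree. The wires lie on a cycle
  of vertices that have no spare neighbour in \<open>A\<close>, so that removing any vertex from \<open>A\<close> makes the whole
  of \<open>A\<close> collapse.
\<close>

section \<open>Structured programs and their compilation to Turing machines\<close>

text \<open>Every pair of a clause and a variable gets a block, whether or not the variable occurs
  in the clause. Edges between blocks then follow from block numbers alone; the formula decides only
  whether the clause cell is joined to a literal of its own block. So adjacency is an arithmetic
  predicate over the input. A block has two pairs of opposite literals for its variable because of
  bipartiteness: opposite literals are adjacent, so with a single pair a clause cell could be joined
  to one sign only. The bound 9 is the degree of a clause cell: three spine vertices, three excluded
  vertices and at most three literals. Four neighbours in \<open>A\<close> are required, so one
  literal must join the three spine vertices. Cells are addressed relative to the heads because the
  heads of several tapes move independently: a move becomes a shift of the tape, and the premise of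
  a transition concerns one fixed position on every tape. Models may make further variables true
  besides those of the run, so acceptance is expressed by forbidding every other final
  state.\<close>

datatype com =
  Move nat dir
| Write nat nat
| Seq com com
| Cond nat nat com com
| Until nat nat com
| Halt bool

type_synonym store = "nat \<Rightarrow> tape"

definition scan :: "store \<Rightarrow> nat \<Rightarrow> nat" where
  "scan \<sigma> j = fst (\<sigma> j) (snd (\<sigma> j))"

text \<open>With a stack of pending subprograms as control state, a step only inspects the top
  entry. \<open>Halt\<close> keeps its stack, in agreement with halting configurations of machines
  being fixed points.\<close>

fun next_stack :: "com list \<Rightarrow> (nat \<Rightarrow> nat) \<Rightarrow> com list" where
  "next_stack [] a = []"
| "next_stack (Move j d # k) a = k"
| "next_stack (Write j s # k) a = k"
| "next_stack (Seq b c # k) a = b # c # k"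
| "next_stack (Cond j s b c # k) a = (if a j = s then b else c) # k"
| "next_stack (Until j s b # k) a = (if a j = s then k else b # Until j s b # k)"
| "next_stack (Halt v # k) a = Halt v # k"

fun effect :: "com list \<Rightarrow> (nat \<Rightarrow> nat) \<Rightarrow> nat \<Rightarrow> nat \<times> dir" where
  "effect (Move j d # k) a i = (a i, if i = j then d else Stay)"
| "effect (Write j s # k) a i = (if i = j then s else a i, Stay)"
| "effect k a i = (a i, Stay)"

definition com_step :: "com list \<times> store \<Rightarrow> com list \<times> store" where
  "com_step = (\<lambda>(k, \<sigma>). (next_stack k (scan \<sigma>), \<lambda>i. act (\<sigma> i) (effect k (scan \<sigma>) i)))"

fun wf_com :: "nat \<Rightarrow> com \<Rightarrow> bool" where
  "wf_com K (Move j d) = (j < K)"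
| "wf_com K (Write j s) = (j < K \<and> s < 3)"
| "wf_com K (Seq a b) = (wf_com K a \<and> wf_com K b)"
| "wf_com K (Cond j s a b) = (j < K \<and> wf_com K a \<and> wf_com K b)"
| "wf_com K (Until j s a) = (j < K \<and> wf_com K a)"
| "wf_com K (Halt v) = True"

lemma wf_com_mono: "wf_com K c \<Longrightarrow> K \<le> L \<Longrightarrow> wf_com L c"
  by (induction c) auto

section \<open>The finite control of a program\<close>

fun residuals :: "com \<Rightarrow> com list \<Rightarrow> com list set" where
  "residuals (Seq a b) k = {Seq a b # k} \<union> residuals a (b # k) \<union> residuals b k"
| "residuals (Cond j s a b) k = {Cond j s a b # k} \<union> residuals a k \<union> residuals b k"
| "residuals (Until j s a) k = {Until j s a # k} \<union> residuals a (Until j s a # k)"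
| "residuals c k = {c # k}"

lemma finite_residuals: "finite (residuals c k)"
  by (induction c k rule: residuals.induct) auto

lemma residuals_start: "c # k \<in> residuals c k"
  by (cases c) auto

text \<open>A loop body is executed with the loop itself as continuation, so unfolding a loop
  creates no new stacks; this is why finitely many stacks suffice.\<close>

lemma residuals_closed: "s \<in> residuals c k \<Longrightarrow> next_stack s a \<in> residuals c k \<union> {k}"
proof (induction c k rule: residuals.induct)
  case (3 j s' b k)
  then show ?case
    using residuals_start[of b "Until j s' b # k"] by (cases "a j = s'") auto
qed (use residuals_start in auto)

lemma residuals_wf:
  "s \<in> residuals c k \<Longrightarrow> wf_com K c \<Longrightarrow> \<forall>b \<in> set k. wf_com K b \<Longrightarrow> \<forall>b \<in> set s. wf_com K b"
  by (induction c k rule: residuals.induct) auto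

lemma act_same: "act t (fst t (snd t), Stay) = t"
  by (cases t) (simp add: act_def)

lemma next_stack_cong:
  assumes "\<forall>b \<in> set s. wf_com K b" "\<And>i. i < K \<Longrightarrow> a i = a' i"
  shows "next_stack s a = next_stack s a'"
  using assms by (cases "(s, a)" rule: next_stack.cases) auto

lemma effect_cong: "a i = a' i \<Longrightarrow> effect s a i = effect s a' i"
  by (cases "(s, a, i)" rule: effect.cases) auto

lemma effect_symbol:
  "\<forall>b \<in> set s. wf_com K b \<Longrightarrow> a i < 3 \<Longrightarrow> fst (effect s a i) < 3"
  by (cases "(s, a, i)" rule: effect.cases) auto

lemma com_step_halted: "com_step (Halt v # k, \<sigma>) = (Halt v # k, \<sigma>)"
  by (simp add: com_step_def scan_def act_same)

definition init_store :: "bool list \<Rightarrow> bool list \<Rightarrow> store" where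
  "init_store x y i = (word_tape (if i = 0 then x else if i = 1 then y else []), 0)"

lemma init_store_list:
  assumes "2 \<le> tapes M"
  shows "init M x y = (0, map (init_store x y) [0..<tapes M])"
proof -
  obtain n where n: "tapes M = Suc (Suc n)"
    using assms by (metis add_2_eq_Suc le_Suc_ex)
  have "map (init_store x y) [0..<Suc (Suc n)]
      = init_store x y 0 # init_store x y 1 # map (\<lambda>i. init_store x y (Suc (Suc i))) [0..<n]"
    by (simp add: map_upt_Suc del: upt_Suc)
  also have "map (\<lambda>i. init_store x y (Suc (Suc i))) [0..<n] = replicate n (word_tape [], 0)"
    by (rule nth_equalityI) (auto simp: init_store_def)
  finally show ?thesis unfolding init_def n
    by (simp add: init_store_def[of x y 0] init_store_def[of x y "Suc 0"] del: upt_Suc)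
qed

text \<open>The states of the machine are the residual stacks of the program.\<close>

lemma com_to_tm:
  assumes wf: "wf_com K c" and K: "2 \<le> K" and nh: "\<And>v. c \<noteq> Halt v"
  obtains M g where "wf_tm M" "tapes M = K" "g [Halt True] = accepting" "g [Halt False] = rejecting"
    "\<And>x y \<sigma>\<^sub>0 n. (\<And>i. i < K \<Longrightarrow> \<sigma>\<^sub>0 i = init_store x y i) \<Longrightarrow>
      run M x y n = (case (com_step ^^ n) ([c], \<sigma>\<^sub>0) of (s, \<sigma>) \<Rightarrow> (g s, map \<sigma> [0..<K]))"
proof -
  let ?T = "[Halt True]" and ?F = "[Halt False]"
  let ?Q = "residuals c [] \<union> {[], ?T, ?F}"
  have "finite (?Q - {[c], ?T, ?F})" using finite_residuals by auto
  then obtain xs where xs: "set xs = ?Q - {[c], ?T, ?F}" "distinct xs"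
    using finite_distinct_list by metis
  \<comment> \<open>The order gives the start stack and the two halting stacks the state numbers 0,
    1 and 2 prescribed for machines; \<open>nh\<close> keeps the three apart.\<close>
  define ss where "ss = [c] # ?T # ?F # xs"
  have ssQ: "set ss = ?Q" using xs residuals_start[of c "[]"] unfolding ss_def by auto
  have dist: "distinct ss" using xs nh unfolding ss_def by auto
  define g where "g s = (LEAST i. i < length ss \<and> ss ! i = s)" for s
  have g: "g (ss ! i) = i" if "i < length ss" for i
    unfolding g_def using that dist by (intro Least_equality) (auto simp: nth_eq_iff_index_eq)
  have gss: "g s < length ss" "ss ! g s = s" if "s \<in> ?Q" for s
    using that g unfolding ssQ[symmetric] by (metis in_set_conv_nth)+
  have cl: "next_stack s a \<in> ?Q" if "s \<in> ?Q" for s a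
    using that residuals_closed[of s c "[]"] by auto
  have wfs: "\<forall>b \<in> set s. wf_com K b" if "s \<in> ?Q" for s
    using that residuals_wf[of s c "[]" K] wf by auto
  have g0: "g [c] = 0" "g ?T = 1" "g ?F = 2"
    using g[of 0] g[of 1] g[of 2] by (auto simp: ss_def)
  define ext where "ext as = (\<lambda>i. if i < K then as ! i else 0)" for as :: "nat list"
  define M where "M = \<lparr>tapes = K, symbols = 3, states = length ss,
     delta = (\<lambda>q as. (g (next_stack (ss ! q) (ext as)), map (effect (ss ! q) (ext as)) [0..<K]))\<rparr>"
  have wfM: "wf_tm M"
    unfolding wf_tm_def
  proof (intro conjI allI impI)
    fix q as assume q: "q < states M" and as: "length as = tapes M \<and> (\<forall>a\<in>set as. a < symbols M)"
    have sq: "ss ! q \<in> ?Q" using q ssQ nth_mem[of q ss] by (auto simp: M_def)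
    have "fst (effect (ss ! q) (ext as) i) < 3" if "i < K" for i
      by (rule effect_symbol[OF wfs[OF sq]]) (use as that in \<open>auto simp: ext_def M_def\<close>)
    then show "case delta M q as of (q', acts) \<Rightarrow> q' < states M \<and> length acts = tapes M \<and>
        (\<forall>(b, d)\<in>set acts. b < symbols M)"
      using gss(1)[OF cl[OF sq], of "ext as"]
      by (auto simp: M_def simp del: Un_insert_right) (metis fst_conv)
  qed (use K in \<open>auto simp: M_def ss_def\<close>)
  have sim: "fst ((com_step ^^ n) ([c], \<sigma>\<^sub>0)) \<in> ?Q \<and>
     run M x y n = (case (com_step ^^ n) ([c], \<sigma>\<^sub>0) of (s, \<sigma>) \<Rightarrow> (g s, map \<sigma> [0..<K]))"
    if \<sigma>\<^sub>0: "\<And>i. i < K \<Longrightarrow> \<sigma>\<^sub>0 i = init_store x y i" for x y \<sigma>\<^sub>0 n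
  proof (induction n)
    case 0
    then show ?case using K g0 residuals_start[of c "[]"] init_store_list[of M x y] \<sigma>\<^sub>0
      by (auto simp: run_def M_def)
  next
    case (Suc n)
    obtain s \<sigma> where s: "(com_step ^^ n) ([c], \<sigma>\<^sub>0) = (s, \<sigma>)" by fastforce
    have sQ: "s \<in> ?Q" and r: "run M x y n = (g s, map \<sigma> [0..<K])" using Suc s by auto
    have c1: "(com_step ^^ Suc n) ([c], \<sigma>\<^sub>0) = com_step (s, \<sigma>)" using s by simp
    have "step M (g s, map \<sigma> [0..<K]) = (case com_step (s, \<sigma>) of (s, \<sigma>) \<Rightarrow> (g s, map \<sigma> [0..<K]))"
    proof (cases "g s = 1 \<or> g s = 2")
      case True
      then have "s = ?T \<or> s = ?F" using gss(2)[OF sQ] by (auto simp: ss_def)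
      then show ?thesis using True com_step_halted[of _ "[]" \<sigma>] by (auto simp: step_def)
    next
      case False
      define as where "as = map (\<lambda>(t, h). t h) (map \<sigma> [0..<K])"
      have as: "ext as i = scan \<sigma> i" if "i < K" for i
        using that by (simp add: ext_def as_def scan_def split_beta)
      have n: "next_stack s (ext as) = next_stack s (scan \<sigma>)"
        by (rule next_stack_cong[OF wfs[OF sQ] as])
      have e: "effect s (ext as) i = effect s (scan \<sigma>) i" if "i < K" for i
        by (rule effect_cong[of "ext as" i "scan \<sigma>", OF as[OF that]])
      have d: "delta M (g s) as = (g (next_stack s (scan \<sigma>)), map (effect s (ext as)) [0..<K])"
        using gss(2)[OF sQ] n by (simp add: M_def)
      have m: "map2 act (map \<sigma> [0..<K]) (map (effect s (ext as)) [0..<K])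
          = map (\<lambda>i. act (\<sigma> i) (effect s (scan \<sigma>) i)) [0..<K]"
        by (rule nth_equalityI) (auto simp: e)
      show ?thesis
        unfolding step_def com_step_def prod.case as_def[symmetric] d m using False by simp
    qed
    moreover have "fst (com_step (s, \<sigma>)) \<in> ?Q" using cl[OF sQ] by (simp add: com_step_def)
    ultimately show ?case unfolding c1 using r by (simp add: run_def)
  qed
  show thesis
  proof (rule that[of M g])
    show "run M x y n = (case (com_step ^^ n) ([c], \<sigma>\<^sub>0) of (s, \<sigma>) \<Rightarrow> (g s, map \<sigma> [0..<K]))"
      if "\<And>i. i < K \<Longrightarrow> \<sigma>\<^sub>0 i = init_store x y i" for x y \<sigma>\<^sub>0 n
      using sim[OF that] by blast
  qed (use wfM g0 in \<open>auto simp: M_def\<close>)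
qed

section \<open>Timed execution of programs\<close>

definition runs :: "com \<Rightarrow> store \<Rightarrow> nat \<Rightarrow> store \<Rightarrow> bool" where
  "runs c \<sigma> n \<sigma>' \<longleftrightarrow> (\<exists>m \<le> n. \<forall>k. (com_step ^^ m) (c # k, \<sigma>) = (k, \<sigma>'))"

lemma runs_mono: "runs c \<sigma> n \<sigma>' \<Longrightarrow> n \<le> n' \<Longrightarrow> runs c \<sigma> n' \<sigma>'"
  unfolding runs_def by (meson le_trans)

text \<open>The common core of the composition rules. It works because the step count in
  \<open>runs\<close> is fixed before the continuation, so \<open>k' @ k\<close> may be put under
  \<open>b\<close>.\<close>

lemma runs_first:
  assumes "\<And>k. com_step (c # k, \<sigma>) = (b # k' @ k, \<sigma>)" "runs b \<sigma> n \<sigma>'"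
    and "\<exists>m \<le> n'. \<forall>k. (com_step ^^ m) (k' @ k, \<sigma>') = (k, \<sigma>'')"
  shows "runs c \<sigma> (Suc (n + n')) \<sigma>''"
proof -
  obtain m where m: "m \<le> n" "\<And>k. (com_step ^^ m) (b # k, \<sigma>) = (k, \<sigma>')"
    using assms(2) unfolding runs_def by auto
  obtain l where l: "l \<le> n'" "\<And>k. (com_step ^^ l) (k' @ k, \<sigma>') = (k, \<sigma>'')"
    using assms(3) by auto
  have "(com_step ^^ (Suc (l + m))) (c # k, \<sigma>) = (k, \<sigma>'')" for k
    using assms(1) m(2) l(2) by (simp add: funpow_Suc_right funpow_add del: funpow.simps(2))
  then show ?thesis unfolding runs_def using m(1) l(1)
    by (intro exI[of _ "Suc (l + m)"]) auto
qed

lemma act_stay: "(\<lambda>i. act (\<sigma> i) (scan \<sigma> i, Stay)) = \<sigma>"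
  by (simp add: scan_def act_same)

lemma runs_Seq: "runs a \<sigma> n \<sigma>' \<Longrightarrow> runs b \<sigma>' n' \<sigma>'' \<Longrightarrow> runs (Seq a b) \<sigma> (Suc (n + n')) \<sigma>''"
  by (rule runs_first[of _ _ a "[b]"]) (auto simp: com_step_def act_stay runs_def)

lemma runs_Cond:
  "runs (if scan \<sigma> j = s then a else b) \<sigma> n \<sigma>' \<Longrightarrow> runs (Cond j s a b) \<sigma> (Suc n) \<sigma>'"
  using runs_first[of "Cond j s a b" \<sigma> "if scan \<sigma> j = s then a else b" "[]" n \<sigma>' 0 \<sigma>']
  by (auto simp: com_step_def act_stay)

lemma runs_Cond_eq: "scan \<sigma> j = s \<Longrightarrow> runs a \<sigma> n \<sigma>' \<Longrightarrow> runs (Cond j s a b) \<sigma> (Suc n) \<sigma>'"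
  by (rule runs_Cond) simp

lemma runs_Cond_neq: "scan \<sigma> j \<noteq> s \<Longrightarrow> runs b \<sigma> n \<sigma>' \<Longrightarrow> runs (Cond j s a b) \<sigma> (Suc n) \<sigma>'"
  by (rule runs_Cond) simp

lemma runs_Until_stop: "scan \<sigma> j = s \<Longrightarrow> runs (Until j s b) \<sigma> 1 \<sigma>"
  unfolding runs_def by (intro exI[of _ 1]) (auto simp: com_step_def act_stay)

lemma runs_Until_step:
  "scan \<sigma> j \<noteq> s \<Longrightarrow> runs b \<sigma> n \<sigma>' \<Longrightarrow> runs (Until j s b) \<sigma>' n' \<sigma>'' \<Longrightarrow>
   runs (Until j s b) \<sigma> (Suc (n + n')) \<sigma>''"
  by (rule runs_first[of _ _ b "[Until j s b]"]) (auto simp: com_step_def act_stay runs_def)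

lemma runs_Until:
  assumes "\<And>i. i < m \<Longrightarrow> scan (\<sigma> i) j \<noteq> s" "scan (\<sigma> m) j = s"
    and "\<And>i. i < m \<Longrightarrow> runs b (\<sigma> i) n (\<sigma> (Suc i))"
  shows "runs (Until j s b) (\<sigma> 0) (m * Suc n + 1) (\<sigma> m)"
  using assms
proof (induction m arbitrary: \<sigma>)
  case 0
  then show ?case using runs_Until_stop by simp
next
  case (Suc m)
  have "runs (Until j s b) (\<sigma> (Suc 0)) (m * Suc n + 1) (\<sigma> (Suc m))"
    using Suc.IH[of "\<lambda>i. \<sigma> (Suc i)"] Suc.prems by auto
  from runs_Until_step[OF Suc.prems(1)[of 0] Suc.prems(3)[of 0] this]
  show ?case by (auto elim: runs_mono)
qed

lemma runs_Move: "runs (Move j d) \<sigma> 1 (\<sigma>(j := (fst (\<sigma> j), snd (\<sigma> j) + offset d)))"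
  unfolding runs_def
  by (intro exI[of _ 1]) (auto simp: com_step_def act_def scan_def fun_eq_iff split_beta)

lemma runs_Write: "runs (Write j s) \<sigma> 1 (\<sigma>(j := ((fst (\<sigma> j))(snd (\<sigma> j) := s), snd (\<sigma> j))))"
  unfolding runs_def
  by (intro exI[of _ 1]) (auto simp: com_step_def act_def scan_def fun_eq_iff split_beta)

section \<open>Functions computed by counter programs\<close>

lemma poly_nat_mono: "x \<le> y \<Longrightarrow> poly p x \<le> poly p y" for p :: "nat poly"
  by (induction p) (auto intro: add_mono mult_mono)

definition poly_bounded :: "(nat \<Rightarrow> nat) \<Rightarrow> bool" where
  "poly_bounded g \<longleftrightarrow> (\<exists>p :: nat poly. \<forall>n. g n \<le> poly p n)"

lemma poly_bounded_const: "poly_bounded (\<lambda>n. c)"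
  unfolding poly_bounded_def by (intro exI[of _ "[:c:]"]) auto

lemma poly_bounded_id: "poly_bounded (\<lambda>n. n)"
  unfolding poly_bounded_def by (intro exI[of _ "[:0, 1:]"]) auto

lemma poly_bounded_add: "poly_bounded a \<Longrightarrow> poly_bounded b \<Longrightarrow> poly_bounded (\<lambda>n. a n + b n)"
  unfolding poly_bounded_def by (metis add_mono poly_add)

lemma poly_bounded_mult: "poly_bounded a \<Longrightarrow> poly_bounded b \<Longrightarrow> poly_bounded (\<lambda>n. a n * b n)"
  unfolding poly_bounded_def by (metis mult_le_mono poly_mult)

lemma poly_bounded_Suc: "poly_bounded a \<Longrightarrow> poly_bounded (\<lambda>n. Suc (a n))"
  using poly_bounded_add[of a "\<lambda>_. 1"] poly_bounded_const by simp

lemma poly_bounded_poly: "poly_bounded a \<Longrightarrow> poly_bounded (\<lambda>n. poly p (a n))"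
  unfolding poly_bounded_def by (metis poly_nat_mono poly_pcompose)

lemmas poly_bounded_intros = poly_bounded_const poly_bounded_id poly_bounded_add
  poly_bounded_mult poly_bounded_Suc poly_bounded_poly

section \<open>Unary counters and basic counter programs\<close>

definition counter :: "nat \<Rightarrow> tape" where
  "counter n = ((\<lambda>_. 0)(0 := 1), int n)"

definition counters :: "(nat \<Rightarrow> tape) \<Rightarrow> (nat \<Rightarrow> nat) \<Rightarrow> store" where
  "counters t r i = (if i < 2 then t i else counter (r (i - 2)))"

text \<open>Register \<open>i\<close> lives on tape \<open>i + 2\<close>. Counting is moving the
  head, and the marker 1 is under the head exactly at value 0, so \<open>Loop\<close> runs until the
  register is empty.\<close>

definition "Inc i = Move (Suc (Suc i)) Right"
definition "Dec i = Move (Suc (Suc i)) Left"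
definition "Loop i c = Until (Suc (Suc i)) 1 c"
definition "Skip = Move 0 Stay"
definition "Drain i j = Loop i (Seq (Dec i) (Inc j))"
definition "Drain2 i j l = Loop i (Seq (Dec i) (Seq (Inc j) (Inc l)))"

lemma wf_coms:
  "wf_com K (Inc i) \<longleftrightarrow> Suc (Suc i) < K" "wf_com K (Dec i) \<longleftrightarrow> Suc (Suc i) < K"
  "wf_com K (Loop i c) \<longleftrightarrow> Suc (Suc i) < K \<and> wf_com K c" "wf_com K Skip \<longleftrightarrow> 0 < K"
  by (auto simp: Inc_def Dec_def Loop_def Skip_def)

lemma wf_Drain: "wf_com K (Drain i j) \<longleftrightarrow> Suc (Suc i) < K \<and> Suc (Suc j) < K"
  "wf_com K (Drain2 i j l) \<longleftrightarrow> Suc (Suc i) < K \<and> Suc (Suc j) < K \<and> Suc (Suc l) < K"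
  by (auto simp: Drain_def Drain2_def wf_coms)

lemma scan_counters: "scan (counters t r) (Suc (Suc i)) = (if r i = 0 then 1 else 0)"
  by (auto simp: scan_def counters_def counter_def)

lemma scan_counters_tape: "j < 2 \<Longrightarrow> scan (counters t r) j = fst (t j) (snd (t j))"
  by (auto simp: scan_def counters_def)

lemma runs_Skip: "runs Skip \<sigma> 1 \<sigma>"
  using runs_Move[of 0 Stay \<sigma>] by (simp add: Skip_def)

lemma runs_eq: "runs c \<sigma> n \<sigma>' \<Longrightarrow> \<sigma>' = \<sigma>'' \<Longrightarrow> n \<le> n' \<Longrightarrow> runs c \<sigma> n' \<sigma>''"
  using runs_mono by auto

lemma runs_Inc: "runs (Inc i) (counters t r) 1 (counters t (r(i := Suc (r i))))"
  unfolding Inc_def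
  by (rule runs_eq[OF runs_Move]) (auto simp: counters_def counter_def fun_eq_iff)

lemma runs_Dec: "r i \<noteq> 0 \<Longrightarrow> runs (Dec i) (counters t r) 1 (counters t (r(i := r i - 1)))"
  unfolding Dec_def
  by (rule runs_eq[OF runs_Move]) (auto simp: counters_def counter_def fun_eq_iff)

lemma runs_Move_tape:
  "j < 2 \<Longrightarrow> runs (Move j d) (counters t r) 1 (counters (t(j := (fst (t j), snd (t j) + offset d))) r)"
  by (rule runs_eq[OF runs_Move]) (auto simp: counters_def counter_def fun_eq_iff)

lemma runs_Write_tape:
  "j < 2 \<Longrightarrow> runs (Write j s) (counters t r) 1
     (counters (t(j := ((fst (t j))(snd (t j) := s), snd (t j)))) r)"
  by (rule runs_eq[OF runs_Write]) (auto simp: counters_def counter_def fun_eq_iff)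

lemma runs_Loop:
  assumes "\<And>l. l < m \<Longrightarrow> r l i \<noteq> 0" "r m i = 0"
    and "\<And>l. l < m \<Longrightarrow> runs b (counters (t l) (r l)) n (counters (t (Suc l)) (r (Suc l)))"
  shows "runs (Loop i b) (counters (t 0) (r 0)) (m * Suc n + 1) (counters (t m) (r m))"
  unfolding Loop_def
  by (rule runs_Until[of m "\<lambda>l. counters (t l) (r l)"])
    (use assms in \<open>auto simp: scan_counters\<close>)

lemma runs_counters_eq:
  "runs c \<sigma> n (counters t r) \<Longrightarrow> (\<And>i. r i = r' i) \<Longrightarrow> n \<le> n' \<Longrightarrow> runs c \<sigma> n' (counters t r')"
  using runs_mono ext[of r r'] by auto

lemma runs_Skip_counters:
  "runs Skip (counters t r) 1 (counters t r)"
  by (rule runs_Skip)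

lemma runs_Drain:
  assumes "i \<noteq> j"
  shows "runs (Drain i j) (counters t r) (4 * r i + 1) (counters t (r(i := 0, j := r j + r i)))"
proof -
  let ?r = "\<lambda>l. r(i := r i - l, j := r j + l)"
  have "runs (Seq (Dec i) (Inc j)) (counters t (?r l)) 3 (counters t (?r (Suc l)))" if "l < r i" for l
    by (rule runs_counters_eq[OF runs_Seq[OF runs_Dec runs_Inc]])
      (use that assms in auto)
  from runs_Loop[of "r i" ?r i _ "\<lambda>_. t" 3, OF _ _ this] assms
  show ?thesis unfolding Drain_def by (auto elim!: runs_counters_eq)
qed

lemma runs_Drain2:
  assumes "i \<noteq> j" "i \<noteq> k" "j \<noteq> k"
  shows "runs (Drain2 i j k) (counters t r) (6 * r i + 1)
    (counters t (r(i := 0, j := r j + r i, k := r k + r i)))"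
proof -
  let ?r = "\<lambda>l. r(i := r i - l, j := r j + l, k := r k + l)"
  have "runs (Seq (Dec i) (Seq (Inc j) (Inc k))) (counters t (?r l)) 5 (counters t (?r (Suc l)))"
    if "l < r i" for l
    by (rule runs_counters_eq[OF runs_Seq[OF runs_Dec runs_Seq[OF runs_Inc runs_Inc]]])
      (use that assms in auto)
  from runs_Loop[of "r i" ?r i _ "\<lambda>_. t" 5, OF _ _ this] assms
  show ?thesis unfolding Drain2_def by (auto elim!: runs_counters_eq)
qed

lemma runs_Clear: "runs (Loop i (Dec i)) (counters t r) (2 * r i + 1) (counters t (r(i := 0)))"
proof -
  let ?r = "\<lambda>l. r(i := r i - l)"
  have "runs (Dec i) (counters t (?r l)) 1 (counters t (?r (Suc l)))" if "l < r i" for l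
    by (rule runs_counters_eq[OF runs_Dec])
      (use that in auto)
  from runs_Loop[of "r i" ?r i _ "\<lambda>_. t" 1, OF _ _ this]
  show ?thesis by (auto elim!: runs_counters_eq)
qed

section \<open>Functions evaluated by counter programs in polynomial time\<close>

type_synonym fn = "(nat \<Rightarrow> bool list) \<Rightarrow> (nat \<Rightarrow> nat) \<Rightarrow> nat"

text \<open>Only the part from the head position to the right matters. Thus tape 1 still reads as
  the empty word while an output is being written on it, with the head just behind the
  output.\<close>

definition reads :: "(nat \<Rightarrow> tape) \<Rightarrow> (nat \<Rightarrow> bool list) \<Rightarrow> bool" where
  "reads t w \<longleftrightarrow> (\<forall>j<2. \<forall>l. fst (t j) (snd (t j) + int l) = word_tape (w j) (int l))"

definition in_bound :: "(nat \<Rightarrow> bool list) \<Rightarrow> (nat \<Rightarrow> nat) \<Rightarrow> nat \<Rightarrow> bool" where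
  "in_bound w e B \<longleftrightarrow> (\<forall>j<2. length (w j) \<le> B) \<and> (\<forall>i. e i \<le> B)"

text \<open>Register \<open>\<rho> i\<close> holds variable \<open>i\<close>, and \<open>d\<close>
  is the first free register. Everything else, including the heads of the tapes 0 and 1, is
  restored, so evaluations can be nested.\<close>

definition computes :: "fn \<Rightarrow> (nat \<Rightarrow> nat) \<Rightarrow> nat \<Rightarrow> com \<Rightarrow> (nat \<Rightarrow> nat) \<Rightarrow> bool" where
  "computes f \<rho> d c g \<longleftrightarrow> (\<forall>w t r B. reads t w \<and> in_bound w (\<lambda>i. r (\<rho> i)) B \<and> (\<forall>i\<ge>d. r i = 0) \<longrightarrow>
     runs c (counters t r) (g B) (counters t (r(d := f w (\<lambda>i. r (\<rho> i))))))"

text \<open>Values are bounded separately from running times because the value of a subterm controls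
  the length of a loop around another one.\<close>

definition definable :: "fn \<Rightarrow> bool" where
  "definable f \<longleftrightarrow> (\<exists>g. poly_bounded g \<and> (\<forall>w e B. in_bound w e B \<longrightarrow> f w e \<le> g B)) \<and>
     (\<forall>\<rho> d. (\<forall>i. \<rho> i < d) \<longrightarrow> (\<exists>c K g. wf_com K c \<and> poly_bounded g \<and> computes f \<rho> d c g))"

lemma definable_bound:
  assumes "definable f"
  obtains p where "\<And>w e B. in_bound w e B \<Longrightarrow> f w e \<le> poly p B"
  using assms unfolding definable_def poly_bounded_def by (metis le_trans)

lemma definable_computes:
  assumes "definable f" "\<And>i. \<rho> i < d"
  obtains c K p where "wf_com K c" "computes f \<rho> d c (poly p)"
proof -
  obtain c K g p where "wf_com K c" "computes f \<rho> d c g" "\<And>n. g n \<le> poly p n"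
    using assms unfolding definable_def poly_bounded_def by metis
  then show thesis using that[of K c p] unfolding computes_def by (meson runs_mono)
qed

lemma computesI:
  "(\<And>w t r B. reads t w \<Longrightarrow> in_bound w (\<lambda>i. r (\<rho> i)) B \<Longrightarrow> (\<And>i. i \<ge> d \<Longrightarrow> r i = 0) \<Longrightarrow>
     runs c (counters t r) (g B) (counters t (r(d := f w (\<lambda>i. r (\<rho> i)))))) \<Longrightarrow> computes f \<rho> d c g"
  unfolding computes_def by blast

lemma computesD:
  "computes f \<rho> d c g \<Longrightarrow> reads t w \<Longrightarrow> in_bound w (\<lambda>i. r (\<rho> i)) B \<Longrightarrow> (\<And>i. i \<ge> d \<Longrightarrow> r i = 0) \<Longrightarrow>
     runs c (counters t r) (g B) (counters t (r(d := f w (\<lambda>i. r (\<rho> i)))))"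
  unfolding computes_def by blast

lemma definable_const: "definable (\<lambda>w e. n)"
  unfolding definable_def
proof (intro conjI allI impI)
  fix \<rho> :: "nat \<Rightarrow> nat" and d
  show "\<exists>c K g. wf_com K c \<and> poly_bounded g \<and> computes (\<lambda>w e. n) \<rho> d c g"
  proof (induction n)
    case 0
    have "computes (\<lambda>w e. 0) \<rho> d Skip (\<lambda>_. 1)"
      by (rule computesI, rule runs_counters_eq[OF runs_Skip_counters])
        auto
    then show ?case using poly_bounded_const wf_coms(4)[of 1] by (metis zero_less_one)
  next
    case (Suc n)
    then obtain c K g where c: "wf_com K c" "poly_bounded g" "computes (\<lambda>w e. n) \<rho> d c g" by auto
    let ?L = "K + d + 3"
    have "computes (\<lambda>w e. Suc n) \<rho> d (Seq c (Inc d)) (\<lambda>n. Suc (g n + 1))"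
      by (rule computesI, rule runs_counters_eq[OF runs_Seq[OF computesD[OF c(3)] runs_Inc]])
         auto
    moreover have "wf_com ?L (Seq c (Inc d))" using wf_com_mono[OF c(1), of ?L] by (auto simp: wf_coms)
    moreover have "poly_bounded (\<lambda>n. Suc (g n + 1))" by (intro poly_bounded_intros c(2))
    ultimately show ?case by blast
  qed
qed (use poly_bounded_const in auto)

text \<open>Draining a register destroys it. The value is therefore copied to the result and to a
  scratch register, which is then drained back.\<close>

lemma definable_var: "definable (\<lambda>w e. e 0)"
  unfolding definable_def
proof (intro conjI allI impI)
  show "\<exists>g. poly_bounded g \<and> (\<forall>w e B. in_bound w e B \<longrightarrow> e 0 \<le> g B)"
    using poly_bounded_id by (auto simp: in_bound_def)
next
  fix \<rho> :: "nat \<Rightarrow> nat" and d assume \<rho>: "\<forall>i. \<rho> i < d"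
  let ?a = "\<rho> 0"
  let ?c = "Seq (Drain2 ?a d (Suc d)) (Drain (Suc d) ?a)"
  have d: "?a < d" using \<rho> by auto
  have "computes (\<lambda>w e. e 0) \<rho> d ?c (\<lambda>n. Suc ((6 * n + 1) + (4 * n + 1)))"
  proof (rule computesI, rule runs_counters_eq[OF runs_Seq[OF runs_Drain2 runs_Drain]], goal_cases)
    case (5 w t r B)
    then show ?case using d
      by auto
  next
    case (6 w t r B)
    then have "r (\<rho> 0) \<le> B" by (auto simp: in_bound_def)
    with 6 d show ?case by auto
  qed (use d in auto)
  moreover have "wf_com (d + 4) ?c" using d by (auto simp: wf_Drain)
  moreover have "poly_bounded (\<lambda>n. Suc ((6 * n + 1) + (4 * n + 1)))" by (intro poly_bounded_intros)
  ultimately show "\<exists>c K g. wf_com K c \<and> poly_bounded g \<and> computes (\<lambda>w e. e 0) \<rho> d c g" by blast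
qed

text \<open>Variables are de Bruijn indices: under a binder the bound variable is \<open>e 0\<close>
  and the outer environment is \<open>shift e\<close>.\<close>

definition shift :: "(nat \<Rightarrow> nat) \<Rightarrow> nat \<Rightarrow> nat" where
  "shift e = (\<lambda>i. e (Suc i))"

lemma shift_case: "shift (case_nat k e) = e"
  by (simp add: shift_def)

lemma definable_shift:
  assumes "definable f"
  shows "definable (\<lambda>w e. f w (shift e))"
  unfolding definable_def
proof (intro conjI allI impI)
  obtain p where "\<And>w e B. in_bound w e B \<Longrightarrow> f w e \<le> poly p B"
    using definable_bound[OF assms] by blast
  then show "\<exists>g. poly_bounded g \<and> (\<forall>w e B. in_bound w e B \<longrightarrow> f w (shift e) \<le> g B)"
    using poly_bounded_poly[OF poly_bounded_id, of p] by (auto simp: in_bound_def shift_def)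
next
  fix \<rho> :: "nat \<Rightarrow> nat" and d assume \<rho>: "\<forall>i. \<rho> i < d"
  then have "shift \<rho> i < d" for i by (simp add: shift_def)
  then obtain c K p where c: "wf_com K c" "computes f (shift \<rho>) d c (poly p)"
    by (rule definable_computes[OF assms])
  have "computes (\<lambda>w e. f w (shift e)) \<rho> d c (poly p)"
    by (rule computesI) (use computesD[OF c(2)] in \<open>auto simp: shift_def in_bound_def\<close>)
  then show "\<exists>c K g. wf_com K c \<and> poly_bounded g \<and> computes (\<lambda>w e. f w (shift e)) \<rho> d c g"
    using c(1) poly_bounded_poly[OF poly_bounded_id, of p] by blast
qed

lemma definable_binop:
  assumes "definable f" "definable g"
    and h: "\<And>a b. h a b \<le> a + b" and wfb: "\<And>d. wf_com (d + 4) (b d)"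
    and b: "\<And>t r d. runs (b d) (counters t r) (k * Suc (r (Suc d)))
       (counters t (r(d := h (r d) (r (Suc d)), Suc d := 0)))"
  shows "definable (\<lambda>w e. h (f w e) (g w e))"
proof -
  obtain p where p: "\<And>w e B. in_bound w e B \<Longrightarrow> f w e \<le> poly p B"
    using definable_bound[OF assms(1)] by blast
  obtain q where q: "\<And>w e B. in_bound w e B \<Longrightarrow> g w e \<le> poly q B"
    using definable_bound[OF assms(2)] by blast
  show ?thesis unfolding definable_def
  proof (intro conjI allI impI)
    have "h (f w e) (g w e) \<le> poly p B + poly q B" if "in_bound w e B" for w e B
      using h[of "f w e" "g w e"] p[OF that] q[OF that] by linarith
    moreover have "poly_bounded (\<lambda>B. poly p B + poly q B)" by (intro poly_bounded_intros)
    ultimately show "\<exists>G. poly_bounded G \<and> (\<forall>w e B. in_bound w e B \<longrightarrow> h (f w e) (g w e) \<le> G B)"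
      by blast
  next
    fix \<rho> :: "nat \<Rightarrow> nat" and d assume \<rho>: "\<forall>i. \<rho> i < d"
    then have \<rho>': "\<rho> i < Suc d" for i by (simp add: less_SucI)
    obtain c K P where c: "wf_com K c" "computes f \<rho> d c (poly P)"
      by (rule definable_computes[OF assms(1) \<rho>[rule_format]])
    obtain c' K' P' where c': "wf_com K' c'" "computes g \<rho> (Suc d) c' (poly P')"
      by (rule definable_computes[OF assms(2) \<rho>'])
    let ?c = "Seq c (Seq c' (b d))"
    let ?G = "\<lambda>B. Suc (poly P B + Suc (poly P' B + k * Suc (poly q B)))"
    have "computes (\<lambda>w e. h (f w e) (g w e)) \<rho> d ?c ?G"
    proof (rule computesI)
      fix w t r B
      assume t: "reads t w" and B: "in_bound w (\<lambda>i. r (\<rho> i)) B" and z: "\<And>i. d \<le> i \<Longrightarrow> r i = 0"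
      let ?e = "\<lambda>i. r (\<rho> i)"
      let ?r1 = "r(d := f w ?e)"
      have "\<rho> i \<noteq> d" for i using \<rho> by (metis less_irrefl)
      then have e: "(\<lambda>i. ?r1 (\<rho> i)) = ?e" by simp
      let ?r2 = "?r1(Suc d := g w ?e)"
      have 1: "runs c (counters t r) (poly P B) (counters t ?r1)"
        using computesD[OF c(2) t, of r B] B z by blast
      have 2: "runs c' (counters t ?r1) (poly P' B) (counters t ?r2)"
        using computesD[OF c'(2) t, of ?r1 B] B z unfolding e by auto
      have 3: "runs (b d) (counters t ?r2) (k * Suc (poly q B)) (counters t (r(d := h (f w ?e) (g w ?e))))"
        by (rule runs_counters_eq[OF b]) (use z q[OF B] in auto)
      show "runs ?c (counters t r) (?G B) (counters t (r(d := h (f w ?e) (g w ?e))))"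
        by (rule runs_Seq[OF 1 runs_Seq[OF 2 3]])
    qed
    moreover have "wf_com (K + K' + d + 4) ?c"
      using wf_com_mono[OF c(1), of "K + K' + d + 4"] wf_com_mono[OF c'(1), of "K + K' + d + 4"]
        wf_com_mono[OF wfb, of d "K + K' + d + 4"] by simp
    moreover have "poly_bounded ?G" by (intro poly_bounded_intros)
    ultimately show "\<exists>c K G. wf_com K c \<and> poly_bounded G \<and>
        computes (\<lambda>w e. h (f w e) (g w e)) \<rho> d c G" by blast
  qed
qed

lemma definable_add:
  assumes "definable f" "definable g"
  shows "definable (\<lambda>w e. f w e + g w e)"
proof (rule definable_binop[OF assms, where b = "\<lambda>d. Drain (Suc d) d" and k = 4])
  show "runs (Drain (Suc d) d) (counters t r) (4 * Suc (r (Suc d)))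
     (counters t (r(d := r d + r (Suc d), Suc d := 0)))" for d t r
    by (rule runs_counters_eq[OF runs_Drain]) auto
qed (auto simp: wf_Drain)

lemma definable_diff:
  assumes "definable f" "definable g"
  shows "definable (\<lambda>w e. f w e - g w e)"
proof (rule definable_binop[OF assms, where k = 5 and
    b = "\<lambda>d. Loop (Suc d) (Seq (Dec (Suc d)) (Cond (Suc (Suc d)) 1 Skip (Dec d)))"])
  fix d t and r :: "nat \<Rightarrow> nat"
  let ?r = "\<lambda>l. r(d := r d - l, Suc d := r (Suc d) - l)"
  let ?b = "Seq (Dec (Suc d)) (Cond (Suc (Suc d)) 1 Skip (Dec d))"
  have "runs ?b (counters t (?r l)) 4 (counters t (?r (Suc l)))" if "l < r (Suc d)" for l
  proof -
    let ?r' = "(?r l)(Suc d := r (Suc d) - Suc l)"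
    have 1: "runs (Dec (Suc d)) (counters t (?r l)) 1 (counters t ?r')"
      by (rule runs_counters_eq[OF runs_Dec]) (use that in auto)
    \<comment> \<open>Tape \<open>Suc (Suc d)\<close> carries register \<open>d\<close>; skipping
      the decrement at value 0 yields truncated subtraction.\<close>
    have 2: "runs (Cond (Suc (Suc d)) 1 Skip (Dec d)) (counters t ?r') 2 (counters t (?r (Suc l)))"
    proof (cases "r d - l = 0")
      case True
      have "runs Skip (counters t ?r') 1 (counters t (?r (Suc l)))"
        by (rule runs_counters_eq[OF runs_Skip_counters]) (use True in auto)
      from runs_Cond[of "counters t ?r'" "Suc (Suc d)" 1 Skip "Dec d"] this True show ?thesis
        by (auto simp: scan_counters numeral_2_eq_2)
    next
      case False
      have "runs (Dec d) (counters t ?r') 1 (counters t (?r (Suc l)))"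
        by (rule runs_counters_eq[OF runs_Dec]) (use False in auto)
      from runs_Cond[of "counters t ?r'" "Suc (Suc d)" 1 Skip "Dec d"] this False show ?thesis
        by (auto simp: scan_counters numeral_2_eq_2)
    qed
    show ?thesis using runs_Seq[OF 1 2] by (simp add: eval_nat_numeral)
  qed
  from runs_Loop[of "r (Suc d)" ?r "Suc d" _ "\<lambda>_. t" 4, OF _ _ this]
  show "runs (Loop (Suc d) ?b) (counters t r) (5 * Suc (r (Suc d)))
     (counters t (r(d := r d - r (Suc d), Suc d := 0)))"
    by (auto elim!: runs_counters_eq)
qed (auto simp: wf_coms)

text \<open>The only closure rule with iteration; products, cardinalities, bounded quantifiers and
  substitution are derived from it. From \<open>d\<close> on the registers hold the sum, the number
  of remaining rounds, the index and the current summand.\<close>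

lemma definable_sum:
  assumes "definable u" "definable (\<lambda>w e. f w (shift e) (e 0))"
  shows "definable (\<lambda>w e. \<Sum>k<u w e. f w e k)"
proof -
  let ?F = "\<lambda>w e. f w (shift e) (e 0)"
  obtain p where p: "\<And>w e B. in_bound w e B \<Longrightarrow> u w e \<le> poly p B"
    using definable_bound[OF assms(1)] by blast
  obtain q where q: "\<And>w e B. in_bound w e B \<Longrightarrow> ?F w e \<le> poly q B"
    using definable_bound[OF assms(2)] by blast
  \<comment> \<open>The index is bounded by the value bound of \<open>u\<close>, not by
    \<open>B\<close>, so the summand is evaluated under the sum of both bounds.\<close>
  have ext: "in_bound w (case_nat k e) (B + poly p B)" if "in_bound w e B" "k < u w e" for w e B k
  proof -
    have "k \<le> poly p B" using that p[OF that(1)] by linarith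
    then show ?thesis using that(1) unfolding in_bound_def by (auto split: nat.splits intro: trans_le_add1 trans_le_add2)
  qed
  have fq: "f w e k \<le> poly q (B + poly p B)" if "in_bound w e B" "k < u w e" for w e B k
    using q[OF ext[OF that]] by (simp add: shift_case)
  show ?thesis unfolding definable_def
  proof (intro conjI allI impI)
    have "(\<Sum>k<u w e. f w e k) \<le> poly p B * poly q (B + poly p B)" if B: "in_bound w e B" for w e B
    proof -
      have "(\<Sum>k<u w e. f w e k) \<le> (\<Sum>k<u w e. poly q (B + poly p B))"
        by (rule sum_mono) (use fq[OF B] in auto)
      also have "\<dots> = u w e * poly q (B + poly p B)" by simp
      also have "\<dots> \<le> poly p B * poly q (B + poly p B)" using p[OF B] by simp
      finally show ?thesis .
    qed
    moreover have "poly_bounded (\<lambda>B. poly p B * poly q (B + poly p B))" by (intro poly_bounded_intros)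
    ultimately show "\<exists>g. poly_bounded g \<and> (\<forall>w e B. in_bound w e B \<longrightarrow> (\<Sum>k<u w e. f w e k) \<le> g B)" by blast
  next
    fix \<rho> :: "nat \<Rightarrow> nat" and d assume \<rho>: "\<forall>i. \<rho> i < d"
    then have \<rho>': "\<rho> i < Suc d" for i by (simp add: less_SucI)
    let ?i = "Suc (Suc d)" let ?v = "Suc ?i"
    obtain c K P where c: "wf_com K c" "computes u \<rho> (Suc d) c (poly P)"
      by (rule definable_computes[OF assms(1) \<rho>'])
    have \<rho>'': "case_nat ?i \<rho> l < ?v" for l using \<rho> by (auto split: nat.splits simp: less_SucI)
    obtain c' K' P' where c': "wf_com K' c'" "computes ?F (case_nat ?i \<rho>) ?v c' (poly P')"
      by (rule definable_computes[of ?F "case_nat ?i \<rho>" ?v, OF assms(2) \<rho>''])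
    let ?b = "Seq c' (Seq (Drain ?v d) (Seq (Inc ?i) (Dec (Suc d))))"
    let ?c = "Seq c (Seq (Loop (Suc d) ?b) (Loop ?i (Dec ?i)))"
    let ?H = "\<lambda>B. Suc (poly P' (B + poly p B) + Suc (4 * poly q (B + poly p B) + 1 + Suc (1 + 1)))"
    let ?G = "\<lambda>B. Suc (poly P B + Suc (poly p B * Suc (?H B) + 1 + (2 * poly p B + 1)))"
    have "computes (\<lambda>w e. \<Sum>k<u w e. f w e k) \<rho> d ?c ?G"
    proof (rule computesI)
      fix w t r B
      assume t: "reads t w" and B: "in_bound w (\<lambda>i. r (\<rho> i)) B" and z: "\<And>i. d \<le> i \<Longrightarrow> r i = 0"
      define e where "e = (\<lambda>i. r (\<rho> i))"
      note B = B[folded e_def]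
      define U where "U = u w e"
      let ?R = "\<lambda>l. r(d := \<Sum>k<l. f w e k, Suc d := U - l, ?i := l)"
      have e: "(\<lambda>i. ?R l (case_nat ?i \<rho> i)) = case_nat l e" for l
        using \<rho> by (auto simp: fun_eq_iff e_def split: nat.splits)
          (metis Suc_lessD not_less_eq less_irrefl_nat)+
      have 1: "runs c (counters t r) (poly P B) (counters t (?R 0))"
        by (rule runs_counters_eq[OF computesD[OF c(2) t B[unfolded e_def]]])
          (use z in \<open>auto simp: U_def e_def\<close>)
      have "runs ?b (counters t (?R l)) (?H B) (counters t (?R (Suc l)))" if l: "l < U" for l
      proof -
        let ?r1 = "(?R l)(?v := f w e l)"
        have 1: "runs c' (counters t (?R l)) (poly P' (B + poly p B)) (counters t ?r1)"
          using computesD[OF c'(2) t, of "?R l" "B + poly p B"] z ext[OF B l[unfolded U_def]]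
          unfolding e by (auto simp: shift_case)
        let ?r2 = "(?R l)(d := \<Sum>k<Suc l. f w e k)"
        have 2: "runs (Drain ?v d) (counters t ?r1) (4 * poly q (B + poly p B) + 1) (counters t ?r2)"
          by (rule runs_counters_eq[OF runs_Drain]) (use z fq[OF B l[unfolded U_def]] in
             auto)
        have 3: "runs (Seq (Inc ?i) (Dec (Suc d))) (counters t ?r2) (Suc (1 + 1)) (counters t (?R (Suc l)))"
          by (rule runs_counters_eq[OF runs_Seq[OF runs_Inc runs_Dec]]) (use l in
             auto)
        show ?thesis by (rule runs_Seq[OF 1 runs_Seq[OF 2 3]])
      qed
      from runs_Loop[of U ?R "Suc d" _ "\<lambda>_. t", OF _ _ this]
      have 2: "runs (Loop (Suc d) ?b) (counters t (?R 0)) (poly p B * Suc (?H B) + 1) (counters t (?R U))"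
        using p[OF B] by (auto elim!: runs_mono simp: U_def intro!: mult_le_mono add_mono)
      have 3: "runs (Loop ?i (Dec ?i)) (counters t (?R U)) (2 * poly p B + 1)
          (counters t (r(d := \<Sum>k<U. f w e k)))"
        by (rule runs_counters_eq[OF runs_Clear]) (use z p[OF B] in
          \<open>auto simp: U_def\<close>)
      show "runs ?c (counters t r) (?G B) (counters t (r(d := \<Sum>k<u w (\<lambda>i. r (\<rho> i)). f w (\<lambda>i. r (\<rho> i)) k)))"
        using runs_Seq[OF 1 runs_Seq[OF 2 3]] unfolding U_def e_def .
    qed
    moreover have "wf_com (K + K' + d + 7) ?c"
      using wf_com_mono[OF c(1), of "K + K' + d + 7"] wf_com_mono[OF c'(1), of "K + K' + d + 7"]
      by (simp add: wf_coms wf_Drain)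
    moreover have "poly_bounded ?G" by (intro poly_bounded_intros)
    ultimately show "\<exists>c K G. wf_com K c \<and> poly_bounded G \<and>
        computes (\<lambda>w e. \<Sum>k<u w e. f w e k) \<rho> d c G" by blast
  qed
qed

text \<open>While the head walks right, the distance is moved to the next register, which later
  guides the head back. The symbol read is itself the result, hence up to two increments.\<close>

lemma definable_symbol:
  assumes "j < 2" "definable u"
  shows "definable (\<lambda>w e. word_tape (w j) (int (u w e)))"
proof -
  obtain p where p: "\<And>w e B. in_bound w e B \<Longrightarrow> u w e \<le> poly p B"
    using definable_bound[OF assms(2)] by blast
  show ?thesis unfolding definable_def
  proof (intro conjI allI impI)
    show "\<exists>g. poly_bounded g \<and> (\<forall>w e B. in_bound w e B \<longrightarrow> word_tape (w j) (int (u w e)) \<le> g B)"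
      using poly_bounded_const[of 2] by (intro exI[of _ "\<lambda>_. 2"]) (auto simp: word_tape_def)
  next
    fix \<rho> :: "nat \<Rightarrow> nat" and d assume \<rho>: "\<forall>i. \<rho> i < d"
    obtain c K P where c: "wf_com K c" "computes u \<rho> d c (poly P)"
      by (rule definable_computes[OF assms(2) \<rho>[rule_format]])
    let ?go = "Loop d (Seq (Dec d) (Seq (Inc (Suc d)) (Move j Right)))"
    let ?get = "Cond j 2 (Seq (Inc d) (Inc d)) (Cond j 1 (Inc d) Skip)"
    let ?back = "Loop (Suc d) (Seq (Dec (Suc d)) (Move j Left))"
    let ?c = "Seq c (Seq ?go (Seq ?get ?back))"
    let ?G = "\<lambda>B. Suc (poly P B + Suc ((poly p B * 6 + 1) + Suc (5 + (poly p B * 4 + 1))))"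
    have "computes (\<lambda>w e. word_tape (w j) (int (u w e))) \<rho> d ?c ?G"
    proof (rule computesI)
      fix w t r B
      assume t: "reads t w" and B: "in_bound w (\<lambda>i. r (\<rho> i)) B" and z: "\<And>i. d \<le> i \<Longrightarrow> r i = 0"
      define U where "U = u w (\<lambda>i. r (\<rho> i))"
      have U: "U \<le> poly p B" using p[OF B] by (simp add: U_def)
      define s where "s = word_tape (w j) (int U)"
      let ?t = "\<lambda>l. t(j := (fst (t j), snd (t j) + int l))"
      let ?R = "\<lambda>l. r(d := U - l, Suc d := l)"
      have 1: "runs c (counters t r) (poly P B) (counters (?t 0) (?R 0))"
        using computesD[OF c(2) t, of r B] B z
        by (auto elim!: runs_eq simp: U_def[symmetric] intro!: arg_cong2[where f = counters])
      have "runs (Seq (Dec d) (Seq (Inc (Suc d)) (Move j Right)))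
          (counters (?t l) (?R l)) 5 (counters (?t (Suc l)) (?R (Suc l)))" if "l < U" for l
        by (rule runs_eq[OF runs_Seq[OF runs_Dec runs_Seq[OF runs_Inc runs_Move_tape[OF assms(1)]]]])
          (use that in \<open>auto intro!: arg_cong2[where f = counters]\<close>)
      from runs_Loop[of U ?R d _ ?t, OF _ _ this]
      have 2: "runs ?go (counters (?t 0) (?R 0)) (poly p B * 6 + 1) (counters (?t U) (?R U))"
        using U by (auto elim!: runs_mono)
      let ?R' = "\<lambda>l. r(d := s, Suc d := U - l)"
      have sc: "scan (counters (?t U) (?R U)) j = s"
        using t assms(1) by (simp add: scan_counters_tape reads_def s_def)
      have s3: "s = 0 \<or> s = 1 \<or> s = 2" by (auto simp: s_def word_tape_def)
      have a: "runs (Seq (Inc d) (Inc d)) (counters (?t U) (?R U)) 3 (counters (?t U) (?R' 0))" if "s = 2"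
        by (rule runs_counters_eq[OF runs_Seq[OF runs_Inc runs_Inc]]) (use that in auto)
      have b: "runs (Inc d) (counters (?t U) (?R U)) 1 (counters (?t U) (?R' 0))" if "s = 1"
        by (rule runs_counters_eq[OF runs_Inc]) (use that in auto)
      have n: "runs Skip (counters (?t U) (?R U)) 1 (counters (?t U) (?R' 0))" if "s = 0"
        by (rule runs_counters_eq[OF runs_Skip_counters]) (use that in auto)
      have 3: "runs ?get (counters (?t U) (?R U)) 5 (counters (?t U) (?R' 0))"
      proof (cases "s = 2")
        case True
        show ?thesis
          by (rule runs_mono[OF runs_Cond_eq[OF _ a[OF True]]]) (use sc True in auto)
      next
        case False
        have "runs (Cond j 1 (Inc d) Skip) (counters (?t U) (?R U)) 2 (counters (?t U) (?R' 0))"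
        proof (cases "s = 1")
          case True
          show ?thesis by (rule runs_mono[OF runs_Cond_eq[OF _ b[OF True]]]) (use sc True in auto)
        next
          case False
          then have "s = 0" using s3 \<open>s \<noteq> 2\<close> by auto
          show ?thesis by (rule runs_mono[OF runs_Cond_neq[OF _ n[OF \<open>s = 0\<close>]]]) (use sc False in auto)
        qed
        then show ?thesis
          by (rule runs_mono[OF runs_Cond_neq, rotated]) (use sc False in auto)
      qed
      let ?t' = "\<lambda>l. ?t (U - l)"
      have "runs (Seq (Dec (Suc d)) (Move j Left))
          (counters (?t' l) (?R' l)) 3 (counters (?t' (Suc l)) (?R' (Suc l)))" if "l < U" for l
        by (rule runs_eq[OF runs_Seq[OF runs_Dec runs_Move_tape[OF assms(1)]]])
          (use that in \<open>auto intro!: arg_cong2[where f = counters]\<close>)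
      from runs_Loop[of U ?R' "Suc d" _ ?t', OF _ _ this]
      have 4: "runs ?back (counters (?t U) (?R' 0)) (poly p B * 4 + 1) (counters t (r(d := s)))"
        using U z by (auto elim!: runs_eq intro!: arg_cong2[where f = counters])
      show "runs ?c (counters t r) (?G B) (counters t (r(d := word_tape (w j) (int (u w (\<lambda>i. r (\<rho> i)))))))"
        using runs_Seq[OF 1 runs_Seq[OF 2 runs_Seq[OF 3 4]]] unfolding s_def U_def .
    qed
    moreover have "wf_com (K + d + 5) ?c"
      using wf_com_mono[OF c(1), of "K + d + 5"] assms(1) by (simp add: wf_coms)
    moreover have "poly_bounded ?G" by (intro poly_bounded_intros)
    ultimately show "\<exists>c K G. wf_com K c \<and> poly_bounded G \<and>
        computes (\<lambda>w e. word_tape (w j) (int (u w e))) \<rho> d c G" by blast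
  qed
qed

lemma definable_length:
  assumes "j < 2"
  shows "definable (\<lambda>w e. length (w j))"
  unfolding definable_def
proof (intro conjI allI impI)
  show "\<exists>g. poly_bounded g \<and> (\<forall>w e B. in_bound w e B \<longrightarrow> length (w j) \<le> g B)"
    using poly_bounded_id assms by (auto simp: in_bound_def)
next
  fix \<rho> :: "nat \<Rightarrow> nat" and d
  let ?go = "Until j 0 (Seq (Inc d) (Seq (Inc (Suc d)) (Move j Right)))"
  let ?back = "Loop (Suc d) (Seq (Dec (Suc d)) (Move j Left))"
  let ?c = "Seq ?go ?back"
  let ?G = "\<lambda>B. Suc ((B * 6 + 1) + (B * 4 + 1))"
  have "computes (\<lambda>w e. length (w j)) \<rho> d ?c ?G"
  proof (rule computesI)
    fix w t r B
    assume t: "reads t w" and B: "in_bound w (\<lambda>i. r (\<rho> i)) B" and z: "\<And>i. d \<le> i \<Longrightarrow> r i = 0"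
    define U where "U = length (w j)"
    have U: "U \<le> B" using B assms by (simp add: U_def in_bound_def)
    let ?t = "\<lambda>l. t(j := (fst (t j), snd (t j) + int l))"
    let ?R = "\<lambda>l. r(d := l, Suc d := l)"
    have "runs (Seq (Inc d) (Seq (Inc (Suc d)) (Move j Right)))
        (counters (?t l) (?R l)) 5 (counters (?t (Suc l)) (?R (Suc l)))" for l
      by (rule runs_eq[OF runs_Seq[OF runs_Inc runs_Seq[OF runs_Inc runs_Move_tape[OF assms(1)]]]])
        (auto intro!: arg_cong2[where f = counters])
    moreover have "(scan (counters (?t l) (?R l)) j = 0) = (l \<ge> U)" for l
      using t assms by (auto simp: scan_counters_tape reads_def U_def word_tape_def)
    ultimately have "runs ?go (counters (?t 0) (?R 0)) (U * 6 + 1) (counters (?t U) (?R U))"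
      using runs_Until[of U "\<lambda>l. counters (?t l) (?R l)" j 0 _ 5] by auto
    then have 1: "runs ?go (counters t r) (B * 6 + 1) (counters (?t U) (?R U))"
    proof -
      have "counters (?t 0) (?R 0) = counters t r"
        using z by (intro arg_cong2[where f = counters]) auto
      then show ?thesis using \<open>runs ?go _ _ _\<close> U by (auto elim!: runs_mono)
    qed
    let ?R' = "\<lambda>l. r(d := U, Suc d := U - l)"
    let ?t' = "\<lambda>l. ?t (U - l)"
    have "runs (Seq (Dec (Suc d)) (Move j Left))
        (counters (?t' l) (?R' l)) 3 (counters (?t' (Suc l)) (?R' (Suc l)))" if "l < U" for l
      by (rule runs_eq[OF runs_Seq[OF runs_Dec runs_Move_tape[OF assms(1)]]])
        (use that in \<open>auto intro!: arg_cong2[where f = counters]\<close>)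
    from runs_Loop[of U ?R' "Suc d" _ ?t', OF _ _ this]
    have 2: "runs ?back (counters (?t U) (?R U)) (B * 4 + 1) (counters t (r(d := U)))"
      using U z by (auto elim!: runs_eq intro!: arg_cong2[where f = counters])
    show "runs ?c (counters t r) (?G B) (counters t (r(d := length (w j))))"
      using runs_Seq[OF 1 2] unfolding U_def .
  qed
  moreover have "wf_com (d + 5) ?c" using assms(1) by (simp add: wf_coms)
  moreover have "poly_bounded ?G" by (intro poly_bounded_intros)
  ultimately show "\<exists>c K G. wf_com K c \<and> poly_bounded G \<and> computes (\<lambda>w e. length (w j)) \<rho> d c G"
    by blast
qed

section \<open>From counter programs to deciding and computing machines\<close>

definition mark_all :: "nat list \<Rightarrow> com" where
  "mark_all js = foldr (\<lambda>j c. Seq (Write j 1) c) js Skip"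

lemma runs_mark_all:
  "runs (mark_all js) \<sigma> (2 * length js + 1)
     (\<lambda>i. if i \<in> set js then ((fst (\<sigma> i))(snd (\<sigma> i) := 1), snd (\<sigma> i)) else \<sigma> i)"
proof (induction js arbitrary: \<sigma>)
  case Nil
  then show ?case using runs_Skip by (simp add: mark_all_def)
next
  case (Cons j js)
  have "mark_all (j # js) = Seq (Write j 1) (mark_all js)" by (simp add: mark_all_def)
  then show ?case
    using runs_eq[OF runs_Seq[OF runs_Write[of j 1 \<sigma>] Cons.IH]] by (auto simp: fun_eq_iff)
qed

lemma wf_mark_all: "0 < K \<Longrightarrow> \<forall>j \<in> set js. j < K \<Longrightarrow> wf_com K (mark_all js)"
  by (induction js) (auto simp: mark_all_def wf_coms)

definition inputs :: "bool list \<Rightarrow> bool list \<Rightarrow> nat \<Rightarrow> bool list" where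
  "inputs x y j = (if j = 0 then x else y)"

definition input_tapes :: "bool list \<Rightarrow> bool list \<Rightarrow> nat \<Rightarrow> tape" where
  "input_tapes x y j = (word_tape (inputs x y j), 0)"

text \<open>The common end of both kinds of machines: the counter markers are written,
  \<open>a\<close> is run, and one scanned symbol decides the verdict. \<open>R\<close> restricts
  the inputs, since a machine that computes a function starts with an empty tape 1.\<close>

lemma verdict_machine:
  assumes wf: "wf_com K a" and j: "j < K" and K: "2 \<le> K"
    and a: "\<And>x y. R x y \<Longrightarrow> runs a (counters (input_tapes x y) (\<lambda>_. 0))
                      (poly p (length x + length y)) (\<sigma> x y)"
  obtains M q where "wf_tm M" "\<And>x y. R x y \<Longrightarrow> run M x y (poly q (length x + length y)) =
      (if scan (\<sigma> x y) j = s then rejecting else accepting, map (\<sigma> x y) [0..<tapes M])"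
proof -
  let ?m = "mark_all [2..<K]"
  let ?c = "Seq (Seq ?m a) (Cond j s (Halt False) (Halt True))"
  have "wf_com K ?c" using wf j K by (auto intro!: wf_mark_all)
  then obtain M g where M: "wf_tm M" "tapes M = K" "g [Halt True] = accepting" "g [Halt False] = rejecting"
    "\<And>x y \<sigma>\<^sub>0 n. (\<And>i. i < K \<Longrightarrow> \<sigma>\<^sub>0 i = init_store x y i) \<Longrightarrow>
      run M x y n = (case (com_step ^^ n) ([?c], \<sigma>\<^sub>0) of (s, \<sigma>) \<Rightarrow> (g s, map \<sigma> [0..<K]))"
    by (rule com_to_tm[of K ?c]) (use K in auto)
  let ?q = "p + [:2 * K + 5:]"
  have "run M x y (poly ?q (length x + length y)) =
      (if scan (\<sigma> x y) j = s then rejecting else accepting, map (\<sigma> x y) [0..<tapes M])" if R: "R x y" for x y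
  proof -
    \<comment> \<open>The machine has no tapes from \<open>K\<close> on, so they may be chosen
      freely; as zero counters they complete the store of counters that \<open>a\<close> expects
      once the markers are written.\<close>
    define \<sigma>\<^sub>0 where "\<sigma>\<^sub>0 = (\<lambda>i. if i < K then init_store x y i else counter 0)"
    let ?P = "poly p (length x + length y)"
    let ?v = "scan (\<sigma> x y) j \<noteq> s"
    have "runs ?m \<sigma>\<^sub>0 (2 * K + 1) (counters (input_tapes x y) (\<lambda>_. 0))"
      by (rule runs_eq[OF runs_mark_all])
        (use K in \<open>auto simp: fun_eq_iff \<sigma>\<^sub>0_def init_store_def counters_def counter_def input_tapes_def inputs_def word_tape_def\<close>)
    from runs_Seq[OF this a[OF R]] obtain m where m: "m \<le> Suc (2 * K + 1 + ?P)"
      "\<And>k. (com_step ^^ m) (Seq ?m a # k, \<sigma>\<^sub>0) = (k, \<sigma> x y)" unfolding runs_def by blast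
    have first: "com_step ([?c], \<sigma>\<^sub>0) = ([Seq ?m a, Cond j s (Halt False) (Halt True)], \<sigma>\<^sub>0)"
      by (simp add: com_step_def act_stay)
    have last: "com_step ([Cond j s (Halt False) (Halt True)], \<sigma> x y) = ([Halt ?v], \<sigma> x y)"
      by (simp add: com_step_def act_stay)
    have stop: "(com_step ^^ n) ([Halt ?v], \<sigma> x y) = ([Halt ?v], \<sigma> x y)" for n
      by (induction n) (auto simp: com_step_halted)
    have "(com_step ^^ (n + (1 + (m + 1)))) ([?c], \<sigma>\<^sub>0) = ([Halt ?v], \<sigma> x y)" for n
      by (simp only: funpow_add One_nat_def funpow.simps o_apply id_apply first m(2) last stop)
    moreover obtain n where "poly ?q (length x + length y) = n + (1 + (m + 1))"
    proof -
      have "1 + (m + 1) \<le> poly ?q (length x + length y)" using m(1) by simp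
      then show thesis using that by (metis add.commute le_Suc_ex)
    qed
    ultimately have "(com_step ^^ poly ?q (length x + length y)) ([?c], \<sigma>\<^sub>0) = ([Halt ?v], \<sigma> x y)" by metis
    then show ?thesis using M(2,3,4) M(5)[of \<sigma>\<^sub>0 x y] by (cases ?v) (auto simp: \<sigma>\<^sub>0_def)
  qed
  then show thesis using that M(1) by blast
qed

definition decidable :: "((nat \<Rightarrow> bool list) \<Rightarrow> (nat \<Rightarrow> nat) \<Rightarrow> bool) \<Rightarrow> bool" where
  "decidable P \<longleftrightarrow> definable (\<lambda>w e. of_bool (P w e))"

lemma reads_input_tapes: "reads (input_tapes x y) (inputs x y)"
  by (simp add: reads_def input_tapes_def)

lemma decidable_poly_time:
  assumes "decidable P"
  shows "poly_time_decidable (\<lambda>x y. P (inputs x y) (\<lambda>_. 0))"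
proof -
  let ?f = "\<lambda>w e. of_bool (P w e) :: nat"
  obtain c K p where c: "wf_com K c" "computes ?f (\<lambda>_. 0) 1 c (poly p)"
    by (rule definable_computes[of ?f "\<lambda>_. 0" 1]) (use assms in \<open>auto simp: decidable_def\<close>)
  let ?\<sigma> = "\<lambda>x y. counters (input_tapes x y) ((\<lambda>_. 0)(1 := ?f (inputs x y) (\<lambda>_. 0)))"
  have "runs c (counters (input_tapes x y) (\<lambda>_. 0)) (poly p (length x + length y)) (?\<sigma> x y)" for x y
    using computesD[OF c(2) reads_input_tapes, of x y "\<lambda>_. 0" "length x + length y"]
    by (auto simp: in_bound_def inputs_def)
  note run = this
  have wf: "wf_com (K + 4) c" using wf_com_mono[OF c(1)] by simp
  \<comment> \<open>The truth value is in register 1, that is on tape 3, where the marker 1 under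
    the head means the value 0 and hence False.\<close>
  obtain M q where M: "wf_tm M" "\<And>x y. run M x y (poly q (length x + length y)) =
      (if scan (?\<sigma> x y) (Suc (Suc 1)) = 1 then rejecting else accepting, map (?\<sigma> x y) [0..<tapes M])"
    by (rule verdict_machine[OF wf _ _ run, of "Suc (Suc 1)" "\<lambda>_ _. True" 1]) auto
  have "fst (run M x y (poly q (length x + length y))) =
      (if P (inputs x y) (\<lambda>_. 0) then accepting else rejecting)" for x y
    unfolding M(2) scan_counters by simp
  then show ?thesis unfolding poly_time_decidable_def using M(1) by blast
qed

text \<open>Every output bit is evaluated on its own. Register 1 counts the bits still to be
  written, register 2 is the position and register 3 the bit, which is cleared after use.\<close>

lemma definable_computable:
  assumes "definable u" "decidable P"
  shows "poly_time_computable
    (\<lambda>x. map (\<lambda>k. P (inputs x []) (case_nat k (\<lambda>_. 0))) [0..<u (inputs x []) (\<lambda>_. 0)])"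
proof -
  let ?f = "\<lambda>w e. of_bool (P w e) :: nat"
  obtain p where p: "\<And>w e B. in_bound w e B \<Longrightarrow> u w e \<le> poly p B"
    using definable_bound[OF assms(1)] by blast
  obtain c K P1 where c: "wf_com K c" "computes u (\<lambda>_. 0) 1 c (poly P1)"
    by (rule definable_computes[of u "\<lambda>_. 0" 1]) (use assms in auto)
  obtain c' K' P2 where c': "wf_com K' c'" "computes ?f (case_nat 2 (\<lambda>_. 0)) 3 c' (poly P2)"
    by (rule definable_computes[of ?f "case_nat 2 (\<lambda>_. 0)" 3])
      (use assms in \<open>auto simp: decidable_def split: nat.splits\<close>)
  let ?w = "Cond (Suc (Suc 3)) 1 (Write 1 1) (Write 1 2)"
  let ?b = "Seq c' (Seq ?w (Seq (Move 1 Right) (Seq (Loop 3 (Dec 3)) (Seq (Inc 2) (Dec 1)))))"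
  let ?c = "Seq c (Loop 1 ?b)"
  let ?H = "\<lambda>B. Suc (poly P2 (B + poly p B) + Suc (2 + Suc (1 + Suc (3 + Suc (1 + 1)))))"
  let ?G = "\<lambda>B. Suc (poly P1 B + (poly p B * Suc (?H B) + 1))"
  define len where "len x = u (inputs x []) (\<lambda>_. 0)" for x
  define bit where "bit x k = P (inputs x []) (case_nat k (\<lambda>_. 0))" for x k
  define T where "T x l = (input_tapes x [])(1 := (word_tape (map (bit x) [0..<l]), int l))" for x l
  define Rg where "Rg x l = ((\<lambda>_. 0)(1 := len x - l, 2 := l) :: nat \<Rightarrow> nat)" for x l
  have main: "runs ?c (counters (input_tapes x []) (\<lambda>_. 0)) (?G (length x)) (counters (T x (len x)) (Rg x (len x)))" for x
  proof -
    let ?B = "length x"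
    have B: "in_bound (inputs x []) (\<lambda>_. 0) ?B" by (auto simp: in_bound_def inputs_def)
    have lp: "len x \<le> poly p ?B" using p[OF B] by (simp add: len_def)
    have "(\<lambda>_. 0)(1 := u (inputs x []) (\<lambda>_. 0)) = Rg x 0" by (auto simp: Rg_def len_def)
    moreover have "input_tapes x [] = T x 0" by (auto simp: T_def input_tapes_def inputs_def)
    ultimately have 1: "runs c (counters (input_tapes x []) (\<lambda>_. 0)) (poly P1 ?B) (counters (T x 0) (Rg x 0))"
      using computesD[OF c(2) reads_input_tapes, of x "[]" "\<lambda>_. 0" ?B] B by auto
    have "runs ?b (counters (T x l) (Rg x l)) (?H ?B) (counters (T x (Suc l)) (Rg x (Suc l)))" if l: "l < len x" for l
    proof -
      have rd: "reads (T x l) (inputs x [])"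
        by (auto simp: reads_def T_def input_tapes_def inputs_def word_tape_def)
      have e: "(\<lambda>i. Rg x l (case_nat 2 (\<lambda>_. 0) i)) = case_nat l (\<lambda>_. 0)"
        by (auto simp: Rg_def fun_eq_iff split: nat.splits)
      have "in_bound (inputs x []) (case_nat l (\<lambda>_. 0)) (?B + poly p ?B)"
        using l lp by (auto simp: in_bound_def inputs_def split: nat.splits)
      then have 1: "runs c' (counters (T x l) (Rg x l)) (poly P2 (?B + poly p ?B))
          (counters (T x l) ((Rg x l)(3 := of_bool (bit x l))))"
        using computesD[OF c'(2) rd, of "Rg x l" "?B + poly p ?B"] unfolding e by (auto simp: Rg_def bit_def)
      let ?r = "(Rg x l)(3 := of_bool (bit x l))"
      let ?T = "(T x l)(1 := ((fst (T x l 1))(snd (T x l 1) := if bit x l then 2 else 1), snd (T x l 1)))"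
      have 2: "runs ?w (counters (T x l) ?r) 2 (counters ?T ?r)"
        using runs_Cond[of "counters (T x l) ?r" "Suc (Suc 3)" 1 "Write 1 1" "Write 1 2" 1]
          runs_Write_tape[of 1 _ "T x l" ?r] unfolding scan_counters by (auto simp: numeral_2_eq_2)
      have w: "(word_tape (map (bit x) [0..<l]))(int l := if bit x l then 2 else 1)
          = word_tape (map (bit x) [0..<Suc l])"
        by (auto simp: word_tape_def fun_eq_iff nth_append)
      have 3: "runs (Move 1 Right) (counters ?T ?r) 1 (counters (T x (Suc l)) ?r)"
        by (rule runs_eq[OF runs_Move_tape]) (auto simp: T_def w simp del: upt_Suc intro!: arg_cong2[where f = counters])
      have 4: "runs (Loop 3 (Dec 3)) (counters (T x (Suc l)) ?r) 3 (counters (T x (Suc l)) (Rg x l))"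
        by (rule runs_counters_eq[OF runs_Clear]) (auto simp: Rg_def)
      have 5: "runs (Seq (Inc 2) (Dec 1)) (counters (T x (Suc l)) (Rg x l)) (Suc (1 + 1))
          (counters (T x (Suc l)) (Rg x (Suc l)))"
        by (rule runs_counters_eq[OF runs_Seq[OF runs_Inc runs_Dec]]) (use l in \<open>auto simp: Rg_def\<close>)
      show ?thesis by (rule runs_Seq[OF 1 runs_Seq[OF 2 runs_Seq[OF 3 runs_Seq[OF 4 5]]]])
    qed
    from runs_Loop[of "len x" "Rg x" 1 _ "T x", OF _ _ this]
    have 2: "runs (Loop 1 ?b) (counters (T x 0) (Rg x 0)) (poly p ?B * Suc (?H ?B) + 1)
        (counters (T x (len x)) (Rg x (len x)))"
      using lp by (auto elim!: runs_mono simp: Rg_def intro!: mult_le_mono add_mono)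
    show ?thesis by (rule runs_Seq[OF 1 2])
  qed
  have "poly_bounded ?G" by (intro poly_bounded_intros)
  then obtain q where "\<And>n. ?G n \<le> poly q n" unfolding poly_bounded_def by blast
  then have "runs ?c (counters (input_tapes x []) (\<lambda>_. 0)) (poly q (length x)) (counters (T x (len x)) (Rg x (len x)))" for x
    using main[of x] runs_mono by blast
  moreover have "wf_com (K + K' + 6) ?c"
    using wf_com_mono[OF c(1), of "K + K' + 6"] wf_com_mono[OF c'(1), of "K + K' + 6"] by (simp add: wf_coms)
  \<comment> \<open>The symbol 2 does not occur on a counter tape, so this test always leads to
    acceptance.\<close>
  ultimately obtain M q' where M: "wf_tm M" "\<And>x. run M x [] (poly q' (length x)) =
      (if scan (counters (T x (len x)) (Rg x (len x))) (Suc (Suc 0)) = 2 then rejecting else accepting,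
       map (counters (T x (len x)) (Rg x (len x))) [0..<tapes M])"
    using verdict_machine[of "K + K' + 6" ?c "Suc (Suc 0)" "\<lambda>x y. y = []" q
       "\<lambda>x y. counters (T x (len x)) (Rg x (len x))" 2] by auto
  have "case run M x [] (poly q' (length x)) of (s, ts) \<Rightarrow> s = accepting \<and>
      fst (ts ! 1) = word_tape (map (bit x) [0..<len x])" for x
    unfolding M(2) scan_counters using M(1)
    by (auto simp: wf_tm_def counters_def T_def)
  then show ?thesis unfolding poly_time_computable_def bit_def len_def using M(1) by blast
qed

section \<open>Closure properties of definable functions and predicates\<close>

lemma definable_mult:
  assumes "definable f" "definable g"
  shows "definable (\<lambda>w e. f w e * g w e)"
  using definable_sum[OF assms(1), of "\<lambda>w e k. g w e"] definable_shift[OF assms(2)] by simp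

lemma decidable_definable: "decidable P \<Longrightarrow> definable (\<lambda>w e. of_bool (P w e))"
  by (simp add: decidable_def)

lemma decidable_const: "decidable (\<lambda>w e. b)"
  unfolding decidable_def by (rule definable_const)

lemma decidable_not: "decidable P \<Longrightarrow> decidable (\<lambda>w e. \<not> P w e)"
  unfolding decidable_def
  by (rule back_subst[of definable, OF definable_diff[OF definable_const[of 1]]]) (auto simp: fun_eq_iff)

lemma decidable_conj: "decidable P \<Longrightarrow> decidable Q \<Longrightarrow> decidable (\<lambda>w e. P w e \<and> Q w e)"
  unfolding decidable_def of_bool_conj by (rule definable_mult)

lemma decidable_disj: "decidable P \<Longrightarrow> decidable Q \<Longrightarrow> decidable (\<lambda>w e. P w e \<or> Q w e)"
  using decidable_not[OF decidable_conj[OF decidable_not decidable_not], of P Q] by simp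

lemma decidable_imp: "decidable P \<Longrightarrow> decidable Q \<Longrightarrow> decidable (\<lambda>w e. P w e \<longrightarrow> Q w e)"
  unfolding imp_conv_disj by (intro decidable_disj decidable_not)

lemma decidable_less:
  assumes "definable f" "definable g"
  shows "decidable (\<lambda>w e. f w e < g w e)"
proof -
  have "definable (\<lambda>w e. 1 - (1 - (g w e - f w e)))"
    by (intro definable_diff definable_const assms)
  moreover have "1 - (1 - (b - a)) = (of_bool (a < b) :: nat)" for a b :: nat by (auto simp: of_bool_def)
  ultimately show ?thesis unfolding decidable_def by simp
qed

lemma decidable_le:
  "definable f \<Longrightarrow> definable g \<Longrightarrow> decidable (\<lambda>w e. f w e \<le> g w e)"
  using decidable_not[OF decidable_less, of g f] by (simp add: not_less)

lemma decidable_eq: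
  "definable f \<Longrightarrow> definable g \<Longrightarrow> decidable (\<lambda>w e. f w e = g w e)"
  using decidable_conj[OF decidable_le decidable_le, of f g g f] by (simp add: order_eq_iff)

lemma decidable_iff: "decidable P \<Longrightarrow> decidable Q \<Longrightarrow> decidable (\<lambda>w e. P w e = Q w e)"
  using decidable_eq[OF decidable_definable decidable_definable, of P Q] by (simp add: of_bool_eq_iff)

lemma definable_if:
  assumes "decidable P" "definable f" "definable g"
  shows "definable (\<lambda>w e. if P w e then f w e else g w e)"
proof -
  have "definable (\<lambda>w e. of_bool (P w e) * f w e + of_bool (\<not> P w e) * g w e)"
    by (intro definable_add definable_mult decidable_definable decidable_not assms)
  moreover have "of_bool b * x + of_bool (\<not> b) * y = (if b then x else y)" for b and x y :: nat by simp
  ultimately show ?thesis by simp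
qed

lemma decidable_if:
  assumes "decidable P" "decidable Q" "decidable R"
  shows "decidable (\<lambda>w e. if P w e then Q w e else R w e)"
proof -
  have "decidable (\<lambda>w e. (P w e \<longrightarrow> Q w e) \<and> (\<not> P w e \<longrightarrow> R w e))"
    by (intro decidable_conj decidable_imp decidable_not assms)
  then show ?thesis by (simp add: if_bool_eq_conj)
qed

lemma definable_card:
  assumes "definable u" "decidable (\<lambda>w e. P w (shift e) (e 0))"
  shows "definable (\<lambda>w e. card {k. k < u w e \<and> P w e k})"
proof -
  have "(\<Sum>k<n. of_bool (Q k)) = card {k. k < n \<and> Q k}" for n :: nat and Q
    by (simp add: sum.If_cases of_bool_def lessThan_def Collect_conj_eq)
  then show ?thesis
    using definable_sum[OF assms(1), of "\<lambda>w e k. of_bool (P w e k)"] assms(2) by (simp add: decidable_def)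
qed

lemma decidable_Ex:
  assumes "definable u" "decidable (\<lambda>w e. P w (shift e) (e 0))"
  shows "decidable (\<lambda>w e. \<exists>k<u w e. P w e k)"
proof -
  have "decidable (\<lambda>w e. 0 < card {k. k < u w e \<and> P w e k})"
    by (intro decidable_less definable_const definable_card assms)
  then show ?thesis by (simp add: card_gt_0_iff)
qed

lemma decidable_All:
  assumes "definable u" "decidable (\<lambda>w e. P w (shift e) (e 0))"
  shows "decidable (\<lambda>w e. \<forall>k<u w e. P w e k)"
proof -
  have "decidable (\<lambda>w e. \<not> (\<exists>k<u w e. \<not> P w e k))"
    by (intro decidable_not decidable_Ex assms)
  then show ?thesis by simp
qed

text \<open>Substitution of a computed value for a variable is a sum in which a single index
  contributes.\<close>

lemma definable_Let:
  assumes "definable u" "definable (\<lambda>w e. f w (shift e) (e 0))"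
  shows "definable (\<lambda>w e. f w e (u w e))"
proof -
  have "definable (\<lambda>w e. \<Sum>k<u w e + 1. of_bool (k = u w e) * f w e k)"
    by (intro definable_sum definable_mult decidable_definable decidable_eq definable_var
        definable_add definable_const assms definable_shift[OF assms(1)])
  moreover have "(\<Sum>k<n + 1. of_bool (k = n) * g k) = g n" for n :: nat and g :: "nat \<Rightarrow> nat"
    by (simp add: of_bool_def if_distrib[of "\<lambda>x. x * _"] cong: if_cong)
  ultimately show ?thesis by simp
qed

lemma decidable_Let:
  assumes "definable u" "decidable (\<lambda>w e. P w (shift e) (e 0))"
  shows "decidable (\<lambda>w e. P w e (u w e))"
  using definable_Let[OF assms(1), of "\<lambda>w e k. of_bool (P w e k)"] assms(2) by (simp add: decidable_def)

text \<open>The quotient counts the positive multiples of the divisor that do not exceed the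
  dividend; the condition \<open>0 < g w e\<close> makes division by 0 yield 0.\<close>

lemma definable_div:
  assumes "definable f" "definable g"
  shows "definable (\<lambda>w e. f w e div g w e)"
proof -
  have "definable (\<lambda>w e. card {k. k < f w e \<and> 0 < g w e \<and> (k + 1) * g w e \<le> f w e})"
    by (intro definable_card decidable_conj decidable_less decidable_le definable_mult definable_add
        definable_const definable_var assms definable_shift[OF assms(1)] definable_shift[OF assms(2)])
  moreover have "card {k. k < a \<and> 0 < b \<and> (k + 1) * b \<le> a} = a div b" for a b :: nat
  proof (cases "b = 0")
    case False
    have "k < a \<and> 0 < b \<and> (k + 1) * b \<le> a \<longleftrightarrow> k < a div b" for k
      using False div_le_dividend[of a b] less_eq_div_iff_mult_less_eq[of b "k + 1" a] by linarith
    then have "{k. k < a \<and> 0 < b \<and> (k + 1) * b \<le> a} = {..<a div b}" by auto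
    then show ?thesis by simp
  qed simp
  ultimately show ?thesis by simp
qed

lemma definable_mod:
  assumes "definable f" "definable g"
  shows "definable (\<lambda>w e. f w e mod g w e)"
  unfolding modulo_nat_def by (intro definable_diff definable_mult definable_div assms)

lemma definable_power: "definable f \<Longrightarrow> definable (\<lambda>w e. f w e ^ n)"
  by (induction n) (auto intro: definable_mult definable_const)

lemma definable_poly: "definable f \<Longrightarrow> definable (\<lambda>w e. poly p (f w e))"
  by (induction p) (auto intro!: definable_add definable_mult definable_const)

text \<open>\<open>F\<close> is arbitrary: on a fixed finite domain it is a nested case distinction.
  In this way the transition function of an arbitrary machine becomes accessible to
  arithmetic.\<close>

lemma definable_table:
  assumes "definable f"
  shows "definable (\<lambda>w e. if f w e < n then F (f w e) else 0)"
proof (induction n)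
  case (Suc n)
  have "definable (\<lambda>w e. if f w e = n then F n else if f w e < n then F (f w e) else 0)"
    by (intro definable_if decidable_eq definable_const assms Suc)
  then show ?case by (rule back_subst[of definable]) (auto simp: fun_eq_iff less_Suc_eq)
qed (simp add: definable_const)

lemma decidable_Bex_list:
  "(\<And>a. a \<in> set xs \<Longrightarrow> decidable (P a)) \<Longrightarrow> decidable (\<lambda>w e. \<exists>a \<in> set xs. P a w e)"
  by (induction xs) (auto intro: decidable_const decidable_disj)

lemma word_tape_bit: "word_tape x (int i) = 2 \<longleftrightarrow> i < length x \<and> x ! i"
  by (simp add: word_tape_def)

lemma decidable_bit:
  "j < 2 \<Longrightarrow> definable u \<Longrightarrow> decidable (\<lambda>w e. u w e < length (w j) \<and> w j ! u w e)"
  unfolding word_tape_bit[symmetric] by (intro decidable_eq definable_symbol definable_const)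

lemma definable_vars:
  "definable (\<lambda>w e. e 0)" "definable (\<lambda>w e. shift e 0)" "definable (\<lambda>w e. shift (shift e) 0)"
  "definable (\<lambda>w e. shift (shift (shift e)) 0)" "definable (\<lambda>w e. shift (shift (shift (shift e))) 0)"
  "definable (\<lambda>w e. shift (shift (shift (shift (shift e)))) 0)"
  by (rule definable_var | rule definable_shift)+

lemmas definable_intros = definable_vars definable_const definable_add definable_mult definable_diff
  definable_card definable_if
  decidable_not decidable_conj decidable_disj decidable_imp decidable_iff
  decidable_less decidable_le decidable_eq decidable_All decidable_Ex decidable_if decidable_const

section \<open>Membership in NP\<close>

lemma concat_map_upt:
  "concat (map (\<lambda>i. map (f i) [0..<n]) [0..<m]) = map (\<lambda>k. f (k div n) (k mod n)) [0..<m * n]"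
proof (induction m)
  case (Suc m)
  have "[0..<Suc m * n] = [0..<m * n] @ map (\<lambda>j. m * n + j) [0..<n]"
    using upt_add_eq_append[of 0 "m * n" n] by (simp add: map_add_upt add.commute)
  moreover have "map (\<lambda>k. f (k div n) (k mod n)) (map (\<lambda>j. m * n + j) [0..<n]) = map (f m) [0..<n]"
    by simp
  ultimately show ?case using Suc by (simp del: upt_Suc add: upt_Suc_append)
qed simp

definition encode_bit :: "nat \<Rightarrow> nat set set \<Rightarrow> nat set \<Rightarrow> nat set \<Rightarrow> nat \<Rightarrow> bool" where
  "encode_bit n E U N k =
     (if k < n then True else if k < n + 1 then False
      else if k < n + 1 + n * n then {(k - (n + 1)) div n, (k - (n + 1)) mod n} \<in> E
      else if k < n + 1 + n * n + n then k - (n + 1 + n * n) \<in> U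
      else k - (n + 1 + n * n + n) \<in> N)"

lemma map_upt_append:
  "map f [0..<a] @ map g [0..<b] = map (\<lambda>k. if k < a then f k else g (k - a)) [0..<a + b]"
  by (rule nth_equalityI) (auto simp: nth_append)

text \<open>This form gives random access: the verifier inspects single positions, and the reduction
  outputs them one at a time.\<close>

lemma encode_map: "encode n E U N = map (encode_bit n E U N) [0..<n + 1 + n * n + n + n]"
proof -
  have r: "replicate n True = map (\<lambda>_. True) [0..<n]" "[False] = map (\<lambda>_. False) [0..<1]"
    by (auto simp: map_replicate_const)
  show ?thesis
    unfolding encode_def r concat_map_upt append_assoc[symmetric] map_upt_append
    by (rule map_cong) (auto simp: encode_bit_def add_ac)
qed

definition bit_at :: "bool list \<Rightarrow> nat \<Rightarrow> bool" where
  "bit_at x k \<longleftrightarrow> k < length x \<and> x ! k"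

definition adj_at where "adj_at n x i j = bit_at x (n + 1 + (i * n + j))"
definition U_at where "U_at n x i = bit_at x (n + 1 + n * n + i)"
definition N_at where "N_at n x i = bit_at x (n + 1 + n * n + n + i)"

lemma matrix_index: "i < n \<Longrightarrow> j < m \<Longrightarrow> i * m + j < n * m" for i j n m :: nat
  using mult_le_mono1[of "i + 1" n m] by simp

lemma encode_at:
  assumes "i < n" "j < n"
  shows "adj_at n (encode n E U N) i j \<longleftrightarrow> {i, j} \<in> E"
    and "U_at n (encode n E U N) i \<longleftrightarrow> i \<in> U" and "N_at n (encode n E U N) i \<longleftrightarrow> i \<in> N"
  using assms matrix_index[OF assms]
  by (auto simp: adj_at_def U_at_def N_at_def bit_at_def encode_map encode_bit_def simp del: upt_Suc)

definition well_formed :: "nat \<Rightarrow> bool list \<Rightarrow> bool" where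
  "well_formed n x \<longleftrightarrow> length x = n + 1 + n * n + n + n \<and> (\<forall>i<n. bit_at x i) \<and> \<not> bit_at x n \<and>
     (\<forall>i<n. \<forall>j<n. adj_at n x i j \<longleftrightarrow> adj_at n x j i) \<and> (\<forall>i<n. \<not> adj_at n x i i)"

lemma well_formed_encode:
  assumes "instance_ok n E U N"
  shows "well_formed n (encode n E U N)"
proof -
  have "{i, i} \<notin> E" for i
    using assms by (auto simp: instance_ok_def simple_graph_def)
  moreover have "{i, j} \<in> E \<longleftrightarrow> {j, i} \<in> E" for i j by (simp add: insert_commute)
  moreover have "length (encode n E U N) = n + 1 + n * n + n + n" by (simp add: encode_map)
  moreover have "\<forall>i<n. bit_at (encode n E U N) i" "\<not> bit_at (encode n E U N) n"
    by (auto simp: bit_at_def encode_map encode_bit_def simp del: upt_Suc)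
  ultimately show ?thesis unfolding well_formed_def by (auto simp: encode_at)
qed

text \<open>The verifier meets arbitrary words. Symmetry and the empty diagonal of the matrix are
  what is needed to recover a simple graph from one.\<close>

lemma encode_well_formed:
  assumes "well_formed n x"
  obtains E U N where "instance_ok n E U N" "x = encode n E U N"
proof
  let ?E = "{{i, j} | i j. i < n \<and> j < n \<and> adj_at n x i j}"
  let ?U = "{i. i < n \<and> U_at n x i}" and ?N = "{i. i < n \<and> N_at n x i}"
  have "card {i, j} = 2" if "i < n" "adj_at n x i j" for i j
    using assms that by (cases "i = j") (auto simp: well_formed_def)
  then show "instance_ok n ?E ?U ?N"
    by (auto simp: instance_ok_def simple_graph_def)
  have E: "{i, j} \<in> ?E \<longleftrightarrow> adj_at n x i j" if "i < n" "j < n" for i j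
    using that assms unfolding well_formed_def by (auto simp: doubleton_eq_iff)
  have len: "length x = n + 1 + n * n + n + n" using assms by (simp add: well_formed_def)
  show "x = encode n ?E ?U ?N"
  proof (rule nth_equalityI)
    fix k assume k: "k < length x"
    have nth: "encode n ?E ?U ?N ! k = encode_bit n ?E ?U ?N k"
      using k len unfolding encode_map by (simp del: upt_Suc)
    have x: "x ! k \<longleftrightarrow> bit_at x k" using k by (simp add: bit_at_def)
    consider "k < n" | "k = n" | "n < k" "k < n + 1 + n * n"
      | "n + 1 + n * n \<le> k" "k < n + 1 + n * n + n" | "n + 1 + n * n + n \<le> k" by linarith
    then show "x ! k = encode n ?E ?U ?N ! k"
    proof cases
      case 3
      let ?q = "k - (n + 1)"
      have q: "?q < n * n" using 3 by linarith
      then have n0: "0 < n" by (cases n) auto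
      have "?q div n < n" "?q mod n < n" using q n0 by (auto simp: less_mult_imp_div_less)
      from E[OF this] have "{?q div n, ?q mod n} \<in> ?E \<longleftrightarrow> bit_at x (n + 1 + ?q)"
        by (simp add: adj_at_def)
      then show ?thesis unfolding nth x encode_bit_def using 3 by simp
    next
      case 4
      then have "k - (n + 1 + n * n) < n" by linarith
      then show ?thesis unfolding nth x encode_bit_def using 4 by (simp add: U_at_def)
    next
      case 5
      then have "k - (n + 1 + n * n + n) < n" using k len by linarith
      then show ?thesis unfolding nth x encode_bit_def using 5 by (simp add: N_at_def)
    next
      case 1
      then show ?thesis using assms unfolding nth x encode_bit_def by (simp add: well_formed_def)
    next
      case 2
      then show ?thesis using assms unfolding nth x encode_bit_def by (simp add: well_formed_def)
    qed
  qed (simp add: len encode_map)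
qed

section \<open>Elimination sequences as certificates of minimality\<close>

definition stage_fails :: "nat \<Rightarrow> (nat \<Rightarrow> nat \<Rightarrow> bool) \<Rightarrow> (nat \<Rightarrow> bool) \<Rightarrow> nat \<Rightarrow> bool" where
  "stage_fails n adj S u \<longleftrightarrow>
     card {z. z < n \<and> (S z \<and> adj z u)} + 1 < card {z. z < n \<and> (\<not> S z \<and> adj z u)}"

text \<open>\<open>S v\<close> is a decreasing sequence of sets that starts with \<open>A - {v}\<close>, ends with the empty set
  and only drops vertices that violate the alliance condition: it witnesses that no non-empty
  defensive alliance is contained in \<open>A - {v}\<close>. The colouring \<open>c\<close> witnesses bipartiteness.\<close>

definition verifies ::
  "bool \<Rightarrow> nat \<Rightarrow> (nat \<Rightarrow> nat \<Rightarrow> bool) \<Rightarrow> (nat \<Rightarrow> bool) \<Rightarrow> (nat \<Rightarrow> bool) \<Rightarrow>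
   (nat \<Rightarrow> bool) \<Rightarrow> (nat \<Rightarrow> bool) \<Rightarrow> (nat \<Rightarrow> nat \<Rightarrow> nat \<Rightarrow> bool) \<Rightarrow> bool" where
  "verifies r n adj U N A c S \<longleftrightarrow>
     (r \<longrightarrow> (\<forall>i<n. \<forall>j<n. adj i j \<longrightarrow> \<not> (c i \<longleftrightarrow> c j)) \<and> (\<forall>v<n. card {u. u < n \<and> adj u v} \<le> 9)) \<and>
     (\<exists>i<n. A i) \<and> (\<forall>i<n. (A i \<longrightarrow> \<not> N i) \<and> (U i \<longrightarrow> A i)) \<and>
     (\<forall>v<n. A v \<longrightarrow> \<not> stage_fails n adj A v) \<and>
     (\<forall>v<n. A v \<longrightarrow> (\<forall>u<n. A u \<and> \<not> u = v \<longrightarrow> S v 0 u) \<and> (\<forall>u<n. \<not> S v n u) \<and>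
        (\<forall>t<n. \<forall>u<n. S v t u \<and> \<not> S v (t + 1) u \<longrightarrow> stage_fails n adj (S v t) u))"

lemma deg_in_card: "X \<subseteq> {..<n} \<Longrightarrow> deg_in E X v = card {z. z < n \<and> (z \<in> X \<and> {z, v} \<in> E)}"
  unfolding deg_in_def by (rule arg_cong[where f = card]) auto

lemma deg_in_mono: "finite Y \<Longrightarrow> X \<subseteq> Y \<Longrightarrow> deg_in E X v \<le> deg_in E Y v"
  unfolding deg_in_def by (rule card_mono) auto

lemma stage_fails_deg:
  "stage_fails n (\<lambda>i j. {i, j} \<in> E) S u \<longleftrightarrow>
     deg_in E {z. z < n \<and> S z} u + 1 < deg_in E ({..<n} - {z. z < n \<and> S z}) u"
  unfolding stage_fails_def
  by (subst (1 2) deg_in_card) (auto intro!: arg_cong2[where f = "(<)"] arg_cong[where f = card])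

primrec stage :: "nat set set \<Rightarrow> nat \<Rightarrow> nat set \<Rightarrow> nat \<Rightarrow> nat set" where
  "stage E n X 0 = X"
| "stage E n X (Suc t) =
     {u \<in> stage E n X t. deg_in E (stage E n X t) u + 1 \<ge> deg_in E ({..<n} - stage E n X t) u}"

lemma stage_subset: "stage E n X t \<subseteq> X"
  by (induction t) auto

text \<open>A round that removes nothing has reached an alliance, which is empty by assumption; any
  other round removes at least one vertex.\<close>

lemma card_stage:
  assumes "X \<subseteq> {..<n}" "\<And>B. B \<subseteq> X \<Longrightarrow> defensive_alliance {..<n} E B \<Longrightarrow> B = {}"
  shows "card (stage E n X t) \<le> card X - t"
proof (induction t)
  case (Suc t)
  let ?S = "stage E n X t"
  have "?S \<subseteq> {..<n}" using stage_subset[of E n X t] assms(1) by blast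
  then have fin: "finite ?S" using finite_subset finite_lessThan by metis
  have sub: "stage E n X (Suc t) \<subseteq> ?S" by auto
  show ?case
  proof (cases "stage E n X (Suc t) = ?S")
    case True
    then have "u \<in> ?S \<Longrightarrow> deg_in E ?S u + 1 \<ge> deg_in E ({..<n} - ?S) u" for u by auto
    then have "defensive_alliance {..<n} E ?S"
      using stage_subset[of E n X t] assms(1) by (auto simp: defensive_alliance_def)
    then have "?S = {}" by (rule assms(2)[OF stage_subset])
    then show ?thesis by simp
  next
    case False
    then have "card (stage E n X (Suc t)) < card ?S" using psubset_card_mono[OF fin] sub by blast
    then show ?thesis using Suc by linarith
  qed
qed simp

lemma bipartite_colouring:
  assumes "simple_graph {..<n} E"
  shows "bipartite {..<n} E \<longleftrightarrow> (\<exists>c. \<forall>i<n. \<forall>j<n. {i, j} \<in> E \<longrightarrow> \<not> (c i \<longleftrightarrow> c j))"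
proof
  assume "bipartite {..<n} E"
  then obtain X Y where "X \<union> Y = {..<n}" "X \<inter> Y = {}" "\<forall>e \<in> E. \<exists>x \<in> X. \<exists>y \<in> Y. e = {x, y}"
    unfolding bipartite_def by blast
  then have "\<forall>i<n. \<forall>j<n. {i, j} \<in> E \<longrightarrow> \<not> (i \<in> X \<longleftrightarrow> j \<in> X)"
    by (metis disjoint_iff doubleton_eq_iff)
  then show "\<exists>c. \<forall>i<n. \<forall>j<n. {i, j} \<in> E \<longrightarrow> \<not> (c i \<longleftrightarrow> c j)" by (rule exI[of _ "\<lambda>i. i \<in> X"])
next
  assume "\<exists>c. \<forall>i<n. \<forall>j<n. {i, j} \<in> E \<longrightarrow> \<not> (c i \<longleftrightarrow> c j)"
  then obtain c where c: "\<And>i j. i < n \<Longrightarrow> j < n \<Longrightarrow> {i, j} \<in> E \<Longrightarrow> \<not> (c i \<longleftrightarrow> c j)" by blast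
  have "\<exists>x \<in> {i. i < n \<and> c i}. \<exists>y \<in> {i. i < n \<and> \<not> c i}. e = {x, y}" if "e \<in> E" for e
  proof -
    have sub: "e \<subseteq> {..<n}" "card e = 2" using assms that by (auto simp: simple_graph_def)
    then obtain i j where e: "e = {i, j}" by (meson card_2_iff)
    then have ij: "i < n" "j < n" using sub by auto
    show ?thesis
    proof (cases "c i")
      case True
      then show ?thesis using c[of i j] that e ij by auto
    next
      case False
      then show ?thesis using c[of i j] that e ij by (auto intro!: bexI[of _ j] bexI[of _ i])
    qed
  qed
  then show "bipartite {..<n} E"
    unfolding bipartite_def by (intro exI[of _ "{i. i < n \<and> c i}"] exI[of _ "{i. i < n \<and> \<not> c i}"]) auto
qed

lemma max_degree_le:
  fixes n :: nat
  shows "max_degree {..<n} E \<le> k \<longleftrightarrow> (\<forall>v<n. card {u. u < n \<and> {u, v} \<in> E} \<le> k)"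
proof -
  have "finite (deg_in E {..<n} ` {..<n})" by (rule finite_imageI) simp
  then show ?thesis unfolding max_degree_def by (auto simp: deg_in_card[of "{..<n}" n E])
qed

lemma verifies_iff:
  assumes ok: "instance_ok n E Us Ns"
  shows "(\<exists>A c S. verifies r n (\<lambda>i j. {i, j} \<in> E) (\<lambda>i. i \<in> Us) (\<lambda>i. i \<in> Ns) A c S) \<longleftrightarrow>
     ext_gmda {..<n} E Us Ns \<and> (r \<longrightarrow> bipartite {..<n} E \<and> max_degree {..<n} E \<le> 9)"
    (is "?L \<longleftrightarrow> ?R")
proof
  assume ?L
  then obtain A c S where V: "verifies r n (\<lambda>i j. {i, j} \<in> E) (\<lambda>i. i \<in> Us) (\<lambda>i. i \<in> Ns) A c S" by blast
  note V = V[unfolded verifies_def]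
  note cl = V[THEN conjunct1] and V' = V[THEN conjunct2]
  note ne = V'[THEN conjunct1] and UN = V'[THEN conjunct2, THEN conjunct1]
    and da = V'[THEN conjunct2, THEN conjunct2, THEN conjunct1]
    and S = V'[THEN conjunct2, THEN conjunct2, THEN conjunct2, THEN spec, THEN mp, THEN mp]
  let ?A = "{z. z < n \<and> A z}"
  have DA: "defensive_alliance {..<n} E ?A"
    using da unfolding defensive_alliance_def stage_fails_deg by (auto simp: not_less)
  have min: False if B: "B \<subset> ?A" "B \<noteq> {}" "defensive_alliance {..<n} E B" for B
  proof -
    obtain v where v: "v < n" "A v" "v \<notin> B" using B(1) by blast
    note Sv = S[OF v(1,2)]
    \<comment> \<open>In a superset of \<open>B\<close> a vertex of \<open>B\<close> has at least as
      many neighbours inside and at most as many outside, so it never violates the condition. Hence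
      \<open>B\<close> survives every stage, although the last one is empty.\<close>
    have "B \<subseteq> {z. z < n \<and> S v t z}" if "t \<le> n" for t
      using that
    proof (induction t)
      case 0
      then show ?case using Sv v B(1) by auto
    next
      case (Suc t)
      let ?X = "{z. z < n \<and> S v t z}"
      have sub: "B \<subseteq> ?X" using Suc by auto
      show ?case
      proof
        fix u assume u: "u \<in> B"
        then have un: "u < n" "S v t u" using sub by auto
        have "\<not> stage_fails n (\<lambda>i j. {i, j} \<in> E) (S v t) u"
        proof -
          have "deg_in E ({..<n} - ?X) u \<le> deg_in E ({..<n} - B) u"
            by (rule deg_in_mono) (use sub in auto)
          also have "\<dots> \<le> deg_in E B u + 1" using B(3) u by (auto simp: defensive_alliance_def)
          also have "deg_in E B u \<le> deg_in E ?X u" by (rule deg_in_mono) (use sub in auto)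
          finally show ?thesis unfolding stage_fails_deg by simp
        qed
        moreover have "t < n" using Suc.prems by simp
        ultimately have "S v (t + 1) u" using Sv[THEN conjunct2, THEN conjunct2] un by blast
        then show "u \<in> {z. z < n \<and> S v (Suc t) z}" using un by auto
      qed
    qed
    from this[of n] show False using Sv B(2) by auto
  qed
  have "ext_gmda {..<n} E Us Ns"
    unfolding ext_gmda_def globally_minimal_defensive_alliance_def
    using DA min ne UN ok by (intro exI[of _ ?A]) (auto simp: instance_ok_def)
  then show ?R using cl ok bipartite_colouring[of n E] max_degree_le[of n E 9] by (auto simp: instance_ok_def)
next
  assume R: ?R
  then have "ext_gmda {..<n} E Us Ns" by (rule conjunct1)
  then obtain A where A: "A \<subseteq> {..<n} - Ns" "Us \<subseteq> A"
    and gm: "globally_minimal_defensive_alliance {..<n} E A"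
    unfolding ext_gmda_def by blast
  note gm = gm[unfolded globally_minimal_defensive_alliance_def]
  note ne = gm[THEN conjunct1] and da = gm[THEN conjunct2, THEN conjunct1]
    and min = gm[THEN conjunct2, THEN conjunct2, rule_format]
  obtain c where c: "r \<Longrightarrow> (\<forall>i<n. \<forall>j<n. {i, j} \<in> E \<longrightarrow> \<not> (c i \<longleftrightarrow> c j))"
    using R ok bipartite_colouring[of n E] by (auto simp: instance_ok_def)
  define S where "S v t u \<longleftrightarrow> u \<in> stage E n (A - {v}) t" for v t u
  have Sset: "{z. z < n \<and> S v t z} = stage E n (A - {v}) t" for v t
    using stage_subset[of E n "A - {v}" t] A(1) by (auto simp: S_def)
  \<comment> \<open>At least one vertex disappears per round until none is left, and there are at
    most \<open>n\<close> of them.\<close>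
  have end_stage: "stage E n (A - {v}) n = {}" if "v \<in> A" for v
  proof -
    have sub: "A - {v} \<subseteq> {..<n}" using A(1) by auto
    have "B = {}" if "B \<subseteq> A - {v}" "defensive_alliance {..<n} E B" for B
      using min[of B] that \<open>v \<in> A\<close> by blast
    from card_stage[OF sub this] have "card (stage E n (A - {v}) n) \<le> card (A - {v}) - n" by blast
    also have "\<dots> = 0" using card_mono[OF _ sub] by simp
    finally show ?thesis using stage_subset[of E n "A - {v}" n] sub finite_subset[of _ "{..<n}"] by auto
  qed
  have fails: "stage_fails n (\<lambda>i j. {i, j} \<in> E) (S v t) u" if "S v t u" "\<not> S v (t + 1) u" for v t u
    unfolding stage_fails_deg Sset using that by (auto simp: S_def)
  have An: "{z. z < n \<and> z \<in> A} = A" using A(1) by auto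
  have "\<not> stage_fails n (\<lambda>i j. {i, j} \<in> E) (\<lambda>i. i \<in> A) v" if "v \<in> A" for v
    using da that unfolding stage_fails_deg An by (simp add: defensive_alliance_def not_less)
  moreover have "r \<longrightarrow> (\<forall>i<n. \<forall>j<n. {i, j} \<in> E \<longrightarrow> \<not> (c i \<longleftrightarrow> c j)) \<and>
      (\<forall>v<n. card {u. u < n \<and> {u, v} \<in> E} \<le> 9)"
    using c R by (simp add: max_degree_le)
  moreover have "\<exists>i<n. i \<in> A" using ne A(1) by auto
  moreover have "\<forall>i<n. (i \<in> A \<longrightarrow> \<not> i \<in> Ns) \<and> (i \<in> Us \<longrightarrow> i \<in> A)" using A by auto
  moreover have "\<forall>u<n. u \<in> A \<and> \<not> u = v \<longrightarrow> S v 0 u" for v by (simp add: S_def)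
  moreover have "\<not> S v n u" if "v \<in> A" for v u using end_stage[OF that] by (simp add: S_def)
  ultimately have "verifies r n (\<lambda>i j. {i, j} \<in> E) (\<lambda>i. i \<in> Us) (\<lambda>i. i \<in> Ns) (\<lambda>i. i \<in> A) c S"
    unfolding verifies_def using fails by (intro conjI allI impI) auto
  then show ?L by blast
qed

section \<open>Layout and verification of the certificate\<close>

definition A_at :: "bool list \<Rightarrow> nat \<Rightarrow> bool" where "A_at y i = bit_at y i"
definition c_at :: "nat \<Rightarrow> bool list \<Rightarrow> nat \<Rightarrow> bool" where "c_at n y i = bit_at y (n + i)"
text \<open>Each vertex \<open>v\<close> has \<open>n + 1\<close> stages of \<open>n\<close> bits,
  since \<open>t\<close> runs from 0 to \<open>n\<close> inclusive.\<close>

definition S_at :: "nat \<Rightarrow> bool list \<Rightarrow> nat \<Rightarrow> nat \<Rightarrow> nat \<Rightarrow> bool" where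
  "S_at n y v t u = bit_at y (n + n + ((v * (n + 1) + t) * n + u))"

lemma stage_fails_cong:
  assumes "\<And>z. z < n \<Longrightarrow> S z = S' z" "\<And>z. z < n \<Longrightarrow> adj z u = adj' z u"
  shows "stage_fails n adj S u = stage_fails n adj' S' u"
proof -
  have "{z. z < n \<and> (S z \<and> adj z u)} = {z. z < n \<and> (S' z \<and> adj' z u)}"
    "{z. z < n \<and> (\<not> S z \<and> adj z u)} = {z. z < n \<and> (\<not> S' z \<and> adj' z u)}"
    using assms by auto
  then show ?thesis unfolding stage_fails_def by simp
qed

lemma verifies_cong:
  assumes "\<And>i j. i < n \<Longrightarrow> j < n \<Longrightarrow> adj i j = adj' i j" "\<And>i. i < n \<Longrightarrow> U i = U' i"
    "\<And>i. i < n \<Longrightarrow> N i = N' i" "\<And>i. i < n \<Longrightarrow> A i = A' i" "\<And>i. i < n \<Longrightarrow> c i = c' i"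
    "\<And>v t u. v < n \<Longrightarrow> t \<le> n \<Longrightarrow> u < n \<Longrightarrow> S v t u = S' v t u"
  shows "verifies r n adj U N A c S = verifies r n adj' U' N' A' c' S'"
proof -
  have 1: "stage_fails n adj A v = stage_fails n adj' A' v" if "v < n" for v
    by (rule stage_fails_cong) (use assms that in auto)
  have 2: "stage_fails n adj (S v t) u = stage_fails n adj' (S' v t) u" if "v < n" "t < n" "u < n" for v t u
    by (rule stage_fails_cong) (use assms that in auto)
  have 3: "{u. u < n \<and> adj u v} = {u. u < n \<and> adj' u v}" if "v < n" for v using assms(1) that by auto
  show ?thesis unfolding verifies_def by (simp add: assms 1 2 3 cong: conj_cong imp_cong)
qed

lemma certificate_exists:
  "\<exists>y. length y = n + n + n * (n + 1) * n \<and> (\<forall>i<n. A_at y i = A i \<and> c_at n y i = c i) \<and>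
     (\<forall>v<n. \<forall>t\<le>n. \<forall>u<n. S_at n y v t u = S v t u)"
proof -
  define y where "y = map A [0..<n] @ map c [0..<n] @
    map (\<lambda>k. S (k div n div (n + 1)) (k div n mod (n + 1)) (k mod n)) [0..<n * (n + 1) * n]"
  have "S_at n y v t u = S v t u" if "v < n" "t \<le> n" "u < n" for v t u
  proof -
    have "v * (n + 1) + t < n * (n + 1)" using matrix_index[of v n t "n + 1"] that by simp
    from matrix_index[OF this that(3)] that show ?thesis
      by (simp add: S_at_def bit_at_def y_def nth_append del: mult_Suc_right)
  qed
  moreover have "A_at y i = A i" "c_at n y i = c i" if "i < n" for i
    using that by (auto simp: A_at_def c_at_def bit_at_def y_def nth_append)
  ultimately show ?thesis by (intro exI[of _ y]) (auto simp: y_def)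
qed

text \<open>The number of vertices is not decoded but searched for below the length of the word;
  \<open>well_formed\<close> pins it down.\<close>

definition checks :: "bool \<Rightarrow> bool list \<Rightarrow> bool list \<Rightarrow> bool" where
  "checks r x y \<longleftrightarrow> (\<exists>n<length x. well_formed n x \<and>
     verifies r n (adj_at n x) (U_at n x) (N_at n x) (A_at y) (c_at n y) (S_at n y))"

lemma decidable_bit_at:
  "j < 2 \<Longrightarrow> definable u \<Longrightarrow> decidable (\<lambda>w e. bit_at (w j) (u w e))"
  unfolding bit_at_def by (rule decidable_bit)

lemma decidable_stage_fails:
  assumes n: "definable n" and u: "definable u"
    and adj: "decidable (\<lambda>w e. adj w (shift e) (e 0) (u w (shift e)))"
    and S: "decidable (\<lambda>w e. S w (shift e) (e 0))"
  shows "decidable (\<lambda>w e. stage_fails (n w e) (adj w e) (S w e) (u w e))"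
  unfolding stage_fails_def by (intro definable_intros assms)

lemma decidable_checks: "decidable (\<lambda>w e. checks r (w 0) (w 1))"
  unfolding checks_def well_formed_def verifies_def adj_at_def U_at_def N_at_def A_at_def c_at_def S_at_def
  by (intro definable_intros decidable_stage_fails decidable_bit_at definable_length)
    simp_all

text \<open>The flag \<open>r\<close> switches the test of the graph class on, so that one verifier
  serves the general and the restricted problem.\<close>

lemma ext_gmda_in_NP:
  assumes "\<And>n E. C {..<n} E \<longleftrightarrow> (r \<longrightarrow> bipartite {..<n} E \<and> max_degree {..<n} E \<le> 9)"
  shows "ext_gmda_language C \<in> NP"
proof -
  have "poly_time_decidable (checks r)"
    using decidable_poly_time[OF decidable_checks[of r]] by (simp add: inputs_def)
  \<comment> \<open>The polynomial is the certificate length with the number of vertices replaced by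
    its upper bound \<open>length x\<close>: two vectors for \<open>A\<close> and the colouring,
    plus all the stages.\<close>
  moreover have "x \<in> ext_gmda_language C \<longleftrightarrow>
      (\<exists>y. length y \<le> poly ([:0, 2:] + [:0, 1:] * [:1, 1:] * [:0, 1:]) (length x) \<and> checks r x y)" for x
  proof
    assume "x \<in> ext_gmda_language C"
    then obtain n E U N where x: "x = encode n E U N" and ok: "instance_ok n E U N"
      and "C {..<n} E" "ext_gmda {..<n} E U N"
      unfolding ext_gmda_language_def by blast
    then obtain A c S where v: "verifies r n (\<lambda>i j. {i, j} \<in> E) (\<lambda>i. i \<in> U) (\<lambda>i. i \<in> N) A c S"
      using verifies_iff[OF ok, of r] assms by blast
    obtain y where y: "length y = n + n + n * (n + 1) * n" "\<forall>i<n. A_at y i = A i \<and> c_at n y i = c i"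
      "\<forall>v<n. \<forall>t\<le>n. \<forall>u<n. S_at n y v t u = S v t u"
      using certificate_exists[of n A c S] by (elim exE conjE)
    have len: "n < length x" unfolding x encode_map by simp
    have "verifies r n (adj_at n x) (U_at n x) (N_at n x) (A_at y) (c_at n y) (S_at n y)"
      using v by (subst verifies_cong[where adj' = "\<lambda>i j. {i, j} \<in> E" and U' = "\<lambda>i. i \<in> U"
            and N' = "\<lambda>i. i \<in> N" and A' = A and c' = c and S' = S]) (auto simp: x encode_at y)
    then have "checks r x y" unfolding checks_def using len well_formed_encode[OF ok] x by blast
    moreover have "length y \<le> length x + length x + length x * (length x + 1) * length x"
      unfolding y(1) using len by (intro add_mono mult_le_mono) auto
    ultimately show "\<exists>y. length y \<le> poly ([:0, 2:] + [:0, 1:] * [:1, 1:] * [:0, 1:]) (length x) \<and> checks r x y"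
      by (intro exI[of _ y]) (simp add: algebra_simps)
  next
    assume "\<exists>y. length y \<le> poly ([:0, 2:] + [:0, 1:] * [:1, 1:] * [:0, 1:]) (length x) \<and> checks r x y"
    then obtain n y where wf: "well_formed n x"
      and v: "verifies r n (adj_at n x) (U_at n x) (N_at n x) (A_at y) (c_at n y) (S_at n y)"
      unfolding checks_def by blast
    from encode_well_formed[OF wf] obtain E U N where ok: "instance_ok n E U N" and x: "x = encode n E U N" .
    have "verifies r n (\<lambda>i j. {i, j} \<in> E) (\<lambda>i. i \<in> U) (\<lambda>i. i \<in> N) (A_at y) (c_at n y) (S_at n y)"
      using v by (subst (asm) verifies_cong[where adj' = "\<lambda>i j. {i, j} \<in> E" and U' = "\<lambda>i. i \<in> U"
            and N' = "\<lambda>i. i \<in> N" and A' = "A_at y" and c' = "c_at n y" and S' = "S_at n y"])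
        (auto simp: x encode_at)
    then show "x \<in> ext_gmda_language C"
      using verifies_iff[OF ok, of r] assms ok x unfolding ext_gmda_language_def by blast
  qed
  ultimately show ?thesis unfolding NP_def by blast
qed

section \<open>The gadget graph of a formula\<close>

definition vx :: "nat \<Rightarrow> nat \<Rightarrow> nat" where "vx b k = 21 * b + k"

lemma vx_eq: "k < 21 \<Longrightarrow> l < 21 \<Longrightarrow> vx b k = vx c l \<longleftrightarrow> b = c \<and> k = l"
  unfolding vx_def by presburger

lemma vx_div_mod: "k < 21 \<Longrightarrow> vx b k div 21 = b" "k < 21 \<Longrightarrow> vx b k mod 21 = k"
  by (simp_all add: vx_def)

lemma vx_cases: obtains b k where "x = vx b k" "k < 21"
  by (rule that[of "x div 21" "x mod 21"]) (simp_all add: vx_def)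

lemma vx_less: "k < 21 \<Longrightarrow> vx b k < 21 * B \<longleftrightarrow> b < B"
  unfolding vx_def by linarith

text \<open>An entry \<open>(k, l, s, g)\<close> stands for the edges between the vertices of kind \<open>k\<close> in block \<open>b\<close> and
  of kind \<open>l\<close> in block \<open>nxt s b\<close>, for all blocks \<open>b\<close> that satisfy \<open>guard g b\<close>. The kinds are:
  0 to 3 the wires (0, 1 of the copies of a variable, 2, 3 of a prefix variable), 4 and 5 further
  spine vertices, 6 the clause cell, 7 to 10 and 11 to 14 the literals of the variable copies and of
  the prefix variables, and 15 to 20 excluded vertices that raise the degree of the vertices 0 to 6.\<close>

definition edge_table :: "(nat \<times> nat \<times> nat \<times> nat) list" where
  "edge_table =
    [(0, 1, 0, 0), (1, 2, 0, 0), (2, 3, 0, 0), (3, 4, 0, 0), (4, 5, 0, 0), (5, 0, 1, 0),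
     (6, 0, 0, 0), (6, 2, 0, 0), (6, 4, 0, 0),
     (0, 8, 0, 0), (0, 9, 0, 0), (1, 10, 0, 0), (1, 7, 2, 0),
     (2, 12, 0, 0), (2, 13, 0, 0), (3, 14, 0, 0), (3, 11, 0, 0),
     (7, 8, 0, 0), (9, 10, 0, 0), (11, 12, 0, 0), (13, 14, 0, 0),
     (6, 11, 0, 0), (6, 14, 1, 0), (6, 7, 0, 1), (6, 10, 0, 2),
     (0, 18, 0, 0), (0, 19, 0, 0), (0, 20, 0, 0), (2, 18, 0, 0), (2, 19, 0, 0), (2, 20, 0, 0),
     (4, 18, 0, 0), (4, 19, 0, 0), (4, 20, 0, 0),
     (1, 15, 0, 0), (1, 16, 0, 0), (1, 17, 0, 0), (3, 15, 0, 0), (3, 16, 0, 0), (3, 17, 0, 0),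
     (5, 15, 0, 0), (5, 16, 0, 0), (5, 17, 0, 0), (6, 15, 0, 0), (6, 16, 0, 0), (6, 17, 0, 0)]"

text \<open>Block \<open>c * w + v\<close> belongs to clause \<open>c\<close> of \<open>m\<close>
  and variable \<open>v\<close> of \<open>w\<close>; \<open>pos\<close> and \<open>neg\<close> say
  which literal of the variable occurs in the clause. The last variable occurs nowhere, so the
  prefix variable at it speaks about the complete clause.\<close>

locale gadget_graph =
  fixes m w :: nat and pos neg :: "nat \<Rightarrow> bool"
  assumes m: "0 < m" and w: "1 < w"
    and excl: "\<And>b. \<not> (pos b \<and> neg b)"
    and dummy: "\<And>b. b mod w = w - 1 \<Longrightarrow> \<not> pos b \<and> \<not> neg b"
begin

definition "B = m * w"

text \<open>Shift 1 leads to the next block, shift 2 to the same variable in the next clause. Both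
  are cyclic on the blocks, which closes the spine and the implication cycle of each
  variable.\<close>

definition nxt :: "nat \<Rightarrow> nat \<Rightarrow> nat" where
  "nxt s b = (if s = 0 then b else if s = 1 then (b + 1) mod B else (b + w) mod B)"

definition prv :: "nat \<Rightarrow> nat \<Rightarrow> nat" where
  "prv s b = (if s = 0 then b else if s = 1 then (b + (B - 1)) mod B else (b + (B - w)) mod B)"

definition guard :: "nat \<Rightarrow> nat \<Rightarrow> bool" where
  "guard g b = (if g = 0 then True else if g = 1 then pos b else neg b)"

definition link :: "nat \<Rightarrow> nat \<Rightarrow> bool" where
  "link x y \<longleftrightarrow> (\<exists>(k, l, s, g) \<in> set edge_table.
     x mod 21 = k \<and> y mod 21 = l \<and> y div 21 = nxt s (x div 21) \<and> guard g (x div 21))"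

definition V :: "nat set" where "V = {..<21 * B}"

definition E :: "nat set set" where
  "E = {{x, y} | x y. x < 21 * B \<and> y < 21 * B \<and> link x y}"

text \<open>An explicit list turns degrees into lengths of filtered lists, which can be calculated
  kind by kind.\<close>

definition nbrs :: "nat \<Rightarrow> nat \<Rightarrow> nat list" where
  "nbrs b i = concat (map (\<lambda>(k, l, s, g).
     (if k = i \<and> guard g b then [vx (nxt s b) l] else []) @
     (if l = i \<and> guard g (prv s b) then [vx (prv s b) k] else [])) edge_table)"

lemma B_pos: "0 < B" "w \<le> B"
  using m w by (auto simp: B_def)

lemma nxt_less: "b < B \<Longrightarrow> nxt s b < B" and prv_less: "b < B \<Longrightarrow> prv s b < B"
  using B_pos by (auto simp: nxt_def prv_def)

lemma nxt_prv: "b < B \<Longrightarrow> nxt s (prv s b) = b"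
  using B_pos by (auto simp: nxt_def prv_def mod_simps)

lemma prv_nxt: "b < B \<Longrightarrow> prv s (nxt s b) = b"
proof -
  assume b: "b < B"
  have "((b + a) mod B + (B - a)) mod B = b" if "a \<le> B" for a
    using that b by (simp only: mod_add_left_eq) simp
  from this[of 1] this[of w] show ?thesis using B_pos by (auto simp: nxt_def prv_def)
qed

lemma E_iff: "{x, y} \<in> E \<longleftrightarrow> x < 21 * B \<and> y < 21 * B \<and> (link x y \<or> link y x)"
  unfolding E_def by (auto simp: doubleton_eq_iff)

lemma table_kinds: "(k, l, s, g) \<in> set edge_table \<Longrightarrow> k < 21 \<and> l < 21 \<and> k \<noteq> l"
  by (auto simp: edge_table_def)

lemma nbrs_iff:
  assumes "b < B" "i < 21"
  shows "{u, vx b i} \<in> E \<longleftrightarrow> u \<in> set (nbrs b i)"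
proof -
  obtain c j where u: "u = vx c j" "j < 21" by (rule vx_cases)
  have 1: "link (vx c j) (vx b i) \<longleftrightarrow> (\<exists>(k, l, s, g) \<in> set edge_table. j = k \<and> i = l \<and> c = prv s b \<and> guard g c)"
    if "c < B"
    unfolding link_def using that assms u nxt_prv prv_nxt
    by (auto simp: vx_div_mod intro!: bexI split: prod.splits)
  have 2: "link (vx b i) (vx c j) \<longleftrightarrow> (\<exists>(k, l, s, g) \<in> set edge_table. i = k \<and> j = l \<and> c = nxt s b \<and> guard g b)"
    unfolding link_def using assms u by (simp add: vx_div_mod)
  have "u \<in> set (nbrs b i) \<longleftrightarrow>
      (\<exists>(k, l, s, g) \<in> set edge_table. i = k \<and> guard g b \<and> u = vx (nxt s b) l) \<or>
      (\<exists>(k, l, s, g) \<in> set edge_table. i = l \<and> guard g (prv s b) \<and> u = vx (prv s b) k)"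
    unfolding nbrs_def by (fastforce split: if_splits)
  also have "\<dots> \<longleftrightarrow> (\<exists>(k, l, s, g) \<in> set edge_table. i = k \<and> j = l \<and> c = nxt s b \<and> guard g b) \<or>
      (\<exists>(k, l, s, g) \<in> set edge_table. j = k \<and> i = l \<and> c = prv s b \<and> guard g c)"
    using u table_kinds by (fastforce simp: vx_eq)
  finally have *: "u \<in> set (nbrs b i) \<longleftrightarrow> (\<exists>(k, l, s, g) \<in> set edge_table. i = k \<and> j = l \<and> c = nxt s b \<and> guard g b) \<or>
      (\<exists>(k, l, s, g) \<in> set edge_table. j = k \<and> i = l \<and> c = prv s b \<and> guard g c)" .
  show ?thesis
  proof (cases "c < B")
    case True
    then show ?thesis unfolding * unfolding E_iff u(1) 1[OF True] 2 using u(2) assms by (auto simp: vx_less)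
  next
    case False
    then have "u \<notin> set (nbrs b i)" unfolding * using nxt_less[OF assms(1)] prv_less[OF assms(1)] by auto
    then show ?thesis using False u by (auto simp: E_iff vx_less)
  qed
qed

lemma nxt_0: "nxt 0 b = b" "prv 0 b = b" and guard_0: "guard 0 b" "guard (Suc 0) b = pos b" "guard 2 b = neg b"
  by (auto simp: nxt_def prv_def guard_def)

lemma all_kinds: "(\<forall>k<21. P k) \<longleftrightarrow> P 0 \<and> P 1 \<and> P 2 \<and> P 3 \<and> P 4 \<and> P 5 \<and> P 6 \<and> P 7 \<and> P 8 \<and> P 9 \<and> P 10 \<and>
   P 11 \<and> P 12 \<and> P 13 \<and> P 14 \<and> P 15 \<and> P 16 \<and> P 17 \<and> P 18 \<and> P 19 \<and> P (20::nat)"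
  by (simp add: numeral_eq_Suc All_less_Suc) blast

lemmas nbrs_simps = nbrs_def edge_table_def nxt_0 guard_0

text \<open>The neighbours of a vertex have pairwise different kinds, so they are distinct even for
  \<open>m = 1\<close>, where \<open>nxt 2\<close> fixes every block. By \<open>excl\<close> the
  clause cell has at most nine neighbours instead of ten.\<close>

lemma nbrs_small: "i < 21 \<longrightarrow> distinct (nbrs b i) \<and> length (nbrs b i) \<le> 9"
  using excl[of b] by (intro spec[of "\<lambda>i. i < 21 \<longrightarrow> distinct (nbrs b i) \<and> length (nbrs b i) \<le> 9" i])
    (unfold all_kinds, simp add: nbrs_simps vx_eq)

lemma deg_in_nbrs:
  assumes "b < B" "i < 21"
  shows "deg_in E X (vx b i) = length (filter (\<lambda>u. u \<in> X) (nbrs b i))"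
proof -
  have "{u \<in> X. {u, vx b i} \<in> E} = set (filter (\<lambda>u. u \<in> X) (nbrs b i))"
    using nbrs_iff[OF assms] by auto
  moreover have "distinct (filter (\<lambda>u. u \<in> X) (nbrs b i))" using nbrs_small[of i b] assms(2) by simp
  ultimately show ?thesis unfolding deg_in_def by (metis distinct_card)
qed

section \<open>The alliance condition as counting thresholds\<close>

definition balanced :: "nat set \<Rightarrow> nat \<Rightarrow> nat \<Rightarrow> bool" where
  "balanced A b i \<longleftrightarrow> length (nbrs b i) \<le> 2 * length (filter (\<lambda>u. u \<in> A) (nbrs b i)) + 1"

text \<open>With \<open>d\<close> neighbours, \<open>k\<close> of them in \<open>A\<close>, the
  condition \<open>d - k \<le> k + 1\<close> becomes \<open>d \<le> 2 * k + 1\<close>.\<close>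

lemma alliance_iff:
  assumes "A \<subseteq> V"
  shows "defensive_alliance V E A \<longleftrightarrow> (\<forall>b<B. \<forall>i<21. vx b i \<in> A \<longrightarrow> balanced A b i)"
proof -
  have "deg_in E (V - A) (vx b i) \<le> deg_in E A (vx b i) + 1 \<longleftrightarrow> balanced A b i" if "b < B" "i < 21" for b i
  proof -
    have "u \<in> V" if "u \<in> set (nbrs b i)" for u
      using nbrs_iff[OF \<open>b < B\<close> \<open>i < 21\<close>, of u] that by (auto simp: E_iff V_def)
    then have "filter (\<lambda>u. u \<in> V - A) (nbrs b i) = filter (\<lambda>u. u \<notin> A) (nbrs b i)"
      by (intro filter_cong) auto
    then show ?thesis
      using sum_length_filter_compl[of "\<lambda>u. u \<in> A" "nbrs b i"]
      unfolding deg_in_nbrs[OF that] balanced_def by simp linarith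
  qed
  moreover have "\<exists>b<B. \<exists>i<21. v = vx b i" if "v \<in> A" for v
  proof (cases v rule: vx_cases)
    case (1 b k)
    then have "b < B" using that assms vx_less[of k b B] by (auto simp: V_def)
    with 1 show ?thesis by blast
  qed
  ultimately show ?thesis using assms unfolding defensive_alliance_def by metis
qed

definition has :: "nat set \<Rightarrow> nat \<Rightarrow> nat \<Rightarrow> nat" where "has A b k = of_bool (vx b k \<in> A)"

lemma length_filter_has:
  "length (filter (\<lambda>u. u \<in> A) []) = 0"
  "length (filter (\<lambda>u. u \<in> A) (vx b k # xs)) = has A b k + length (filter (\<lambda>u. u \<in> A) xs)"
  "length (filter (\<lambda>u. u \<in> A) (xs @ ys)) = length (filter (\<lambda>u. u \<in> A) xs) + length (filter (\<lambda>u. u \<in> A) ys)"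
  by (auto simp: has_def)

text \<open>The three excluded neighbours tune the thresholds: a wire (0 to 3) tolerates one missing
  neighbour among the others, namely one of its two literals, while 4 and 5 tolerate none. The
  clause cell needs one literal besides its three spine neighbours, whether its degree is 8 or
  9.\<close>

lemma balanced_spine:
  assumes "\<forall>b. \<forall>k. k < 21 \<and> 15 \<le> k \<longrightarrow> has A b k = 0"
  shows "balanced A b 0 \<longleftrightarrow> 4 \<le> has A b 1 + has A (prv 1 b) 5 + has A b 6 + has A b 8 + has A b 9"
    "balanced A b 1 \<longleftrightarrow> 3 \<le> has A b 0 + has A b 2 + has A b 10 + has A (nxt 2 b) 7"
    "balanced A b 2 \<longleftrightarrow> 4 \<le> has A b 1 + has A b 3 + has A b 6 + has A b 12 + has A b 13"
    "balanced A b 3 \<longleftrightarrow> 3 \<le> has A b 2 + has A b 4 + has A b 14 + has A b 11"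
    "balanced A b 4 \<longleftrightarrow> 3 \<le> has A b 3 + has A b 5 + has A b 6"
    "balanced A b 5 \<longleftrightarrow> 2 \<le> has A b 4 + has A (nxt 1 b) 0"
    "balanced A b 6 \<longleftrightarrow> 4 \<le> has A b 0 + has A b 2 + has A b 4 + has A b 11 + has A (nxt 1 b) 14 +
        (if pos b then has A b 7 else 0) + (if neg b then has A b 10 else 0)"
  using excl[of b]
  by (simp_all add: balanced_def nbrs_simps length_filter_has assms del: filter.simps filter_append)
    (presburger | (cases "pos b"; cases "neg b"; simp; presburger))+

text \<open>Literals have degree 2 or 3, so a single neighbour in \<open>A\<close> suffices, and the
  opposite literal may be this neighbour.\<close>

lemma balanced_literal:
  "balanced A b 7 \<longleftrightarrow> 1 \<le> has A (prv 2 b) 1 + has A b 8 + (if pos b then has A b 6 else 0)"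
  "balanced A b 8 \<longleftrightarrow> 1 \<le> has A b 0 + has A b 7"
  "balanced A b 9 \<longleftrightarrow> 1 \<le> has A b 0 + has A b 10"
  "balanced A b 10 \<longleftrightarrow> 1 \<le> has A b 1 + has A b 9 + (if neg b then has A b 6 else 0)"
  "balanced A b 11 \<longleftrightarrow> 1 \<le> has A b 3 + has A b 12 + has A b 6"
  "balanced A b 12 \<longleftrightarrow> 1 \<le> has A b 2 + has A b 11"
  "balanced A b 13 \<longleftrightarrow> 1 \<le> has A b 2 + has A b 14"
  "balanced A b 14 \<longleftrightarrow> 1 \<le> has A b 3 + has A b 13 + has A (prv 1 b) 6"
  by (simp_all add: balanced_def nbrs_simps length_filter_has del: filter.simps filter_append)
    (presburger | (cases "pos b"; cases "neg b"; simp; presburger))+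

section \<open>Induction along the spine and along the copies of a variable\<close>

lemma cyclic_induct:
  assumes "Q b" "b < B" "\<And>b. b < B \<Longrightarrow> Q b \<Longrightarrow> Q (nxt 1 b)" "c < B"
  shows "Q c"
proof -
  have "Q ((b + j) mod B)" for j
  proof (induction j)
    case (Suc j)
    from assms(3)[OF _ this] B_pos show ?case by (simp add: nxt_def mod_simps)
  qed (use assms in simp)
  from this[of "c + B - b"] assms(2,4) show ?thesis by simp
qed

lemma column_induct:
  assumes "Q b" "b < B" "\<And>b. b < B \<Longrightarrow> Q b \<Longrightarrow> Q (nxt 2 b)" "c < B" "c mod w = b mod w"
  shows "Q c"
proof -
  have "Q ((b + j * w) mod B)" for j
  proof (induction j)
    case (Suc j)
    from assms(3)[OF _ this] B_pos show ?case by (simp add: nxt_def mod_simps add_ac)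
  qed (use assms in simp)
  \<comment> \<open>Adding \<open>m\<close> prevents the subtraction from truncating; it amounts to
    one full turn, which is the summand \<open>B\<close> below.\<close>
  from this[of "c div w + m - b div w"]
  have "Q ((b + (c div w + m - b div w) * w) mod B)" .
  moreover have "b + (c div w + m - b div w) * w = c + B"
  proof -
    have "b div w \<le> m" using assms(2) by (simp add: B_def div_le_mono less_mult_imp_div_less less_imp_le mult.commute)
    then have "(c div w + m - b div w) * w = c div w * w + m * w - b div w * w"
      by (simp add: diff_mult_distrib add_mult_distrib)
    moreover have "b = b div w * w + b mod w" "c = c div w * w + b mod w"
      using assms(5) by (metis div_mult_mod_eq)+
    moreover have "b div w * w \<le> m * w" using \<open>b div w \<le> m\<close> by simp
    ultimately show ?thesis unfolding B_def by linarith
  qed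
  ultimately show ?thesis using assms(4) by simp
qed

lemma nxt_mod: "b < B \<Longrightarrow> nxt 2 b mod w = b mod w"
  by (simp add: nxt_def B_def mod_mult_right_eq mod_mod_cancel)

section \<open>Bipartiteness and maximum degree\<close>

definition side :: "nat \<Rightarrow> bool" where
  "side k \<longleftrightarrow> k \<in> {0, 2, 4, 7, 10, 11, 14, 15, 16, 17}"

lemma bipartite_E: "bipartite V E"
  unfolding bipartite_def
proof (intro exI conjI ballI)
  let ?X = "{x \<in> V. side (x mod 21)}" and ?Y = "{x \<in> V. \<not> side (x mod 21)}"
  show "?X \<union> ?Y = V" "?X \<inter> ?Y = {}" by auto
  fix e assume "e \<in> E"
  then obtain x y where e: "e = {x, y}" "x \<in> V" "y \<in> V" "link x y" by (auto simp: E_def V_def)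
  have "\<forall>(k, l, s, g) \<in> set edge_table. side k \<noteq> side l"
    by (simp add: edge_table_def side_def)
  then have "side (x mod 21) \<noteq> side (y mod 21)" using e(4) unfolding link_def by fastforce
  then show "\<exists>x \<in> ?X. \<exists>y \<in> ?Y. e = {x, y}"
    using e(1,2,3) by (cases "side (x mod 21)") (auto simp: doubleton_eq_iff)
qed

lemma max_degree_E: "max_degree V E \<le> 9"
proof -
  have "deg_in E V v \<le> 9" if "v \<in> V" for v
  proof (cases v rule: vx_cases)
    case (1 b k)
    have "deg_in E V v \<le> length (nbrs b k)"
      using that 1 unfolding 1(1) by (subst deg_in_nbrs) (auto simp: V_def vx_less)
    then show ?thesis using nbrs_small[of k b] 1(2) by simp
  qed
  then show ?thesis unfolding max_degree_def by (subst Max_le_iff) (auto simp: V_def)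
qed

lemma simple_graph_E: "simple_graph V E"
proof -
  have "x \<noteq> y" if "link x y" for x y
    using that table_kinds unfolding link_def by fastforce
  then show ?thesis by (auto simp: simple_graph_def V_def E_def)
qed

section \<open>From satisfying assignments to globally minimal alliances\<close>

definition U :: "nat set" where "U = {x \<in> V. x mod 21 < 7}"

text \<open>Excluding kind 11 at the first variable says that the empty prefix satisfies nothing;
  excluding kind 14 at the last variable says that the clause is satisfied in the end.\<close>

definition N :: "nat set" where
  "N = {x \<in> V. 15 \<le> x mod 21 \<or> (x mod 21 = 11 \<and> x div 21 mod w = 0) \<or>
     (x mod 21 = 14 \<and> x div 21 mod w = w - 1)}"

definition satisfied :: "(nat \<Rightarrow> bool) \<Rightarrow> nat \<Rightarrow> bool" where
  "satisfied \<alpha> b \<longleftrightarrow> pos b \<and> \<alpha> (b mod w) \<or> neg b \<and> \<not> \<alpha> (b mod w)"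

definition satisfies :: "(nat \<Rightarrow> bool) \<Rightarrow> bool" where
  "satisfies \<alpha> \<longleftrightarrow> (\<forall>c<m. \<exists>v<w. satisfied \<alpha> (c * w + v))"

lemma has_le: "has A b k \<le> 1"
  by (simp add: has_def)

lemma has_1: "has A b k = 1 \<longleftrightarrow> vx b k \<in> A" "has A b k = Suc 0 \<longleftrightarrow> vx b k \<in> A" "has A b k \<noteq> 0 \<longleftrightarrow> vx b k \<in> A"
  "0 < has A b k \<longleftrightarrow> vx b k \<in> A"
  "1 \<le> has A b k \<longleftrightarrow> vx b k \<in> A"
  by (auto simp: has_def)

lemma in_V: "k < 21 \<Longrightarrow> vx b k \<in> V \<longleftrightarrow> b < B"
  by (simp add: V_def vx_less)

lemma block_split: "b div w * w + b mod w = b" and block_mod: "v < w \<Longrightarrow> (c * w + v) mod w = v"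
  and block_div: "v < w \<Longrightarrow> (c * w + v) div w = c"
  using w by auto

lemma block_less: "c < m \<Longrightarrow> v < w \<Longrightarrow> c * w + v < B"
  unfolding B_def by (rule matrix_index)

lemma nxt_in_row:
  assumes "c < m" "v + 1 < w"
  shows "nxt 1 (c * w + v) = c * w + (v + 1)"
  using block_less[OF assms] by (simp add: nxt_def)

definition prefix :: "(nat \<Rightarrow> bool) \<Rightarrow> nat \<Rightarrow> bool" where
  "prefix \<alpha> b \<longleftrightarrow> (\<exists>v < b mod w. satisfied \<alpha> (b div w * w + v))"

definition member :: "(nat \<Rightarrow> bool) \<Rightarrow> nat \<Rightarrow> nat \<Rightarrow> bool" where
  "member \<alpha> b k \<longleftrightarrow> k < 7 \<or> (k \<in> {7, 9} \<and> \<alpha> (b mod w)) \<or> (k \<in> {8, 10} \<and> \<not> \<alpha> (b mod w)) \<or>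
     (k \<in> {11, 13} \<and> prefix \<alpha> b) \<or> (k \<in> {12, 14} \<and> \<not> prefix \<alpha> b)"

definition solution :: "(nat \<Rightarrow> bool) \<Rightarrow> nat set" where
  "solution \<alpha> = {x \<in> V. member \<alpha> (x div 21) (x mod 21)}"

lemma has_solution: "k < 21 \<Longrightarrow> b < B \<Longrightarrow> has (solution \<alpha>) b k = of_bool (member \<alpha> b k)"
  by (simp add: has_def solution_def in_V vx_div_mod)

lemma prefix_end:
  assumes "satisfies \<alpha>" "b < B" "b mod w = w - 1"
  shows "prefix \<alpha> b"
proof -
  have "b div w < m" using assms(2) by (simp add: B_def less_mult_imp_div_less)
  then obtain v where v: "v < w" "satisfied \<alpha> (b div w * w + v)"
    using assms(1) unfolding satisfies_def by blast
  then have "v \<noteq> w - 1"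
    using dummy[of "b div w * w + v"] block_mod[of v "b div w"] by (auto simp: satisfied_def)
  then show ?thesis using v assms(3) unfolding prefix_def by (intro exI[of _ v]) auto
qed

text \<open>The condition of the clause cell. At the last variable \<open>nxt 1\<close> leaves the
  clause, but there the prefix is already satisfied.\<close>

lemma prefix_step:
  assumes "satisfies \<alpha>" "b < B"
  shows "prefix \<alpha> b \<or> \<not> prefix \<alpha> (nxt 1 b) \<or> satisfied \<alpha> b"
proof (cases "b mod w = w - 1")
  case True
  then show ?thesis using prefix_end assms by blast
next
  case False
  define c v where "c = b div w" and "v = b mod w"
  have b: "b = c * w + v" using block_split by (simp add: c_def v_def)
  have v: "v < w" using w by (simp add: v_def)
  have v1: "v + 1 < w" using False v by (simp add: v_def)
  have "c < m" using assms(2) by (simp add: B_def less_mult_imp_div_less c_def)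
  from nxt_in_row[OF this v1] have n: "nxt 1 b = c * w + (v + 1)" unfolding b .
  show ?thesis
    unfolding n prefix_def block_mod[OF v1] block_div[OF v1] unfolding b block_mod[OF v] block_div[OF v]
    using less_Suc_eq by auto
qed

text \<open>Exactly one literal at each wire and exactly one of two opposite literals is present.
  Stated as sums, this meets the thresholds by linear arithmetic.\<close>

lemma solution_has:
  assumes "satisfies \<alpha>" "b < B"
  defines "A \<equiv> solution \<alpha>"
  shows "k < 7 \<Longrightarrow> has A b k = 1" "15 \<le> k \<Longrightarrow> k < 21 \<Longrightarrow> has A c k = 0"
    "has A b 8 + has A b 9 = 1" "has A b 10 + has A (nxt 2 b) 7 = 1"
    "has A b 12 + has A b 13 = 1" "has A b 14 + has A b 11 = 1"
    "has A b 7 + has A b 8 = 1" "has A b 10 + has A b 9 = 1"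
    "has A b 11 + has A b 12 = 1" "has A b 13 + has A b 14 = 1"
    "1 \<le> has A b 11 + has A (nxt 1 b) 14 + (if pos b then has A b 7 else 0) +
        (if neg b then has A b 10 else 0)"
proof -
  show "15 \<le> k \<Longrightarrow> k < 21 \<Longrightarrow> has A c k = 0"
    by (simp add: A_def has_def solution_def vx_div_mod member_def)
  show "1 \<le> has A b 11 + has A (nxt 1 b) 14 + (if pos b then has A b 7 else 0) +
        (if neg b then has A b 10 else 0)"
    using prefix_step[OF assms(1,2)] assms(2) nxt_less[OF assms(2)]
    by (auto simp: A_def has_solution member_def satisfied_def)
qed (use assms(2) nxt_less[OF assms(2)] nxt_mod[OF assms(2)] in
    \<open>auto simp: A_def has_solution member_def\<close>)

lemma solution_alliance:
  assumes "satisfies \<alpha>"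
  shows "defensive_alliance V E (solution \<alpha>)"
proof (subst alliance_iff)
  show "solution \<alpha> \<subseteq> V" by (auto simp: solution_def)
  let ?A = "solution \<alpha>"
  have "\<forall>i<21. vx b i \<in> ?A \<longrightarrow> balanced ?A b i" if b: "b < B" for b
  proof -
    note s = solution_has[OF assms]
    have z: "has ?A c k = 0" if "k < 21" "15 \<le> k" for c k using s(2)[OF b that(2,1)] .
    have z': "\<forall>b. \<forall>k. k < 21 \<and> 15 \<le> k \<longrightarrow> has ?A b k = 0" using z by blast
    have n: "vx b k \<notin> ?A" if "k < 21" "15 \<le> k" for k using z[OF that] by (simp add: has_def)
    have p: "prv 1 b < B" "prv 2 b < B" "nxt 1 b < B" "nxt 2 b < B"
      using b nxt_less prv_less by auto
    show ?thesis
      unfolding all_kinds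
      using s(1)[OF b] s(1)[OF p(1)] s(1)[OF p(2)] s(1)[OF p(3)] s(1)[OF p(4)] s(3-)[OF b]
      by (simp add: balanced_spine[OF z'] balanced_literal n del: One_nat_def)
  qed
  then show "\<forall>b<B. \<forall>i<21. vx b i \<in> ?A \<longrightarrow> balanced ?A b i" by blast
qed

text \<open>A spine vertex in \<open>X\<close> meets its threshold only with all its neighbours in
  the solution, so one of them pulls in the whole cycle and then everything else. Some spine vertex
  is in \<open>X\<close>: a literal lacks its opposite and needs a wire or a clause cell, and a
  clause cell needs four neighbours but has at most three literals.\<close>

lemma solution_minimal:
  assumes sat: "satisfies \<alpha>" and X: "X \<subseteq> solution \<alpha>" "X \<noteq> {}" "defensive_alliance V E X"
  shows "X = solution \<alpha>"
proof -
  let ?A = "solution \<alpha>"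
  note s = solution_has[OF sat]
  have XV: "X \<subseteq> V" using X(1) by (auto simp: solution_def)
  have bal: "balanced X b i" if "has X b i = 1" "i < 21" for b i
  proof -
    have "vx b i \<in> X" using that(1) by (simp only: has_1)
    then show ?thesis using X(3) XV in_V[OF that(2)] that(2) unfolding alliance_iff[OF XV] by blast
  qed
  have le: "has X b k \<le> has ?A b k" for b k using X(1) by (auto simp: has_def)
  have z: "has X c k = 0" if "k < 21" "15 \<le> k" for c k
    using le[of c k] s(2)[OF B_pos(1) that(2,1)] by simp
  have z': "\<forall>b. \<forall>k. k < 21 \<and> 15 \<le> k \<longrightarrow> has X b k = 0" using z by blast
  note sp = balanced_spine[OF z']
  have lt: "(0::nat) < 21" "(1::nat) < 21" "(2::nat) < 21" "(3::nat) < 21" "(4::nat) < 21"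
    "(5::nat) < 21" "(6::nat) < 21" by simp_all
  have s0: "has X b 1 = 1 \<and> has X b 6 = 1 \<and> has X b 8 = has ?A b 8 \<and> has X b 9 = has ?A b 9"
    if "b < B" "has X b 0 = 1" for b
    using bal[OF that(2) lt(1)] le[of b 8] le[of b 9] s(3)[OF that(1)] has_le[of X b 1] has_le[of X b 6]
      has_le[of X "prv 1 b" 5] unfolding sp by linarith
  have s1: "has X b 0 = 1 \<and> has X b 2 = 1 \<and> has X b 10 = has ?A b 10 \<and> has X (nxt 2 b) 7 = has ?A (nxt 2 b) 7"
    if "b < B" "has X b 1 = 1" for b
    using bal[OF that(2) lt(2)] le[of b 10] le[of "nxt 2 b" 7] s(4)[OF that(1)] has_le[of X b 0] has_le[of X b 2]
    unfolding sp by linarith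
  have s2: "has X b 1 = 1 \<and> has X b 3 = 1 \<and> has X b 12 = has ?A b 12 \<and> has X b 13 = has ?A b 13"
    if "b < B" "has X b 2 = 1" for b
    using bal[OF that(2) lt(3)] le[of b 12] le[of b 13] s(5)[OF that(1)] has_le[of X b 1] has_le[of X b 3]
      has_le[of X b 6] unfolding sp by linarith
  have s3: "has X b 2 = 1 \<and> has X b 4 = 1 \<and> has X b 14 = has ?A b 14 \<and> has X b 11 = has ?A b 11"
    if "b < B" "has X b 3 = 1" for b
    using bal[OF that(2) lt(4)] le[of b 14] le[of b 11] s(6)[OF that(1)] has_le[of X b 2] has_le[of X b 4]
    unfolding sp by linarith
  have s4: "has X b 3 = 1 \<and> has X b 5 = 1" if "has X b 4 = 1" for b
    using bal[OF that lt(5)] has_le[of X b 3] has_le[of X b 5] has_le[of X b 6] unfolding sp by linarith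
  have s5: "has X b 4 = 1 \<and> has X (nxt 1 b) 0 = 1" if "has X b 5 = 1" for b
    using bal[OF that lt(6)] has_le[of X b 4] has_le[of X "nxt 1 b" 0] unfolding sp by linarith
  have chain: "has X b 1 = 1 \<and> has X b 2 = 1 \<and> has X b 3 = 1 \<and> has X b 4 = 1 \<and> has X b 5 = 1 \<and>
      has X (nxt 1 b) 0 = 1" if "b < B" "has X b 0 = 1" for b
  proof -
    have 1: "has X b 1 = 1" using s0[OF that] by blast
    have 2: "has X b 2 = 1" using s1[OF that(1) 1] by blast
    have 3: "has X b 3 = 1" using s2[OF that(1) 2] by blast
    have 4: "has X b 4 = 1" using s3[OF that(1) 3] by blast
    have 5: "has X b 5 = 1" using s4[OF 4] by blast
    show ?thesis using 1 2 3 4 5 s5[OF 5] by blast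
  qed
  have start: "has X b 0 = 1" if "b < B" "k < 6" "has X b k = 1" for b k
  proof -
    from that(2) consider "k = 0" | "k = 1" | "k = 2" | "k = 3" | "k = 4" | "k = 5" by linarith
    moreover have "has X b 1 = 1 \<Longrightarrow> has X b 0 = 1" "has X b 2 = 1 \<Longrightarrow> has X b 1 = 1"
      "has X b 3 = 1 \<Longrightarrow> has X b 2 = 1" "has X b 4 = 1 \<Longrightarrow> has X b 3 = 1" "has X b 5 = 1 \<Longrightarrow> has X b 4 = 1"
      using s1[OF that(1)] s2[OF that(1)] s3[OF that(1)] s4 s5 by blast+
    ultimately show ?thesis using that(3) by cases blast+
  qed
  have start6: "has X b 0 = 1" if "b < B" "has X b 6 = 1" for b
  proof -
    have "(if pos b then has X b 7 else 0) + (if neg b then has X b 10 else 0) \<le> 1"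
      using excl[of b] has_le[of X b 7] has_le[of X b 10] by auto
    then have "has X b 0 \<noteq> 0 \<or> has X b 2 \<noteq> 0 \<or> has X b 4 \<noteq> 0"
      using bal[OF that(2) lt(7)] has_le[of X b 11] has_le[of X "nxt 1 b" 14] unfolding sp by linarith
    then show ?thesis
      using start[OF that(1), of 0] start[OF that(1), of 2] start[OF that(1), of 4] by (auto simp: has_1)
  qed
  have lit: "\<exists>c<B. has X c 0 = 1" if b: "b < B" and k: "7 \<le> k" "k < 15" "has X b k = 1" for b k
  proof -
    have c: "prv 1 b < B" "prv 2 b < B" using prv_less[OF b] by auto
    have A: "has ?A b k = 1" using le[of b k] has_le[of ?A b k] k(3) by linarith
    have bal: "balanced X b k" using bal[OF k(3)] k(2) by simp
    from k consider "k = 7" | "k = 8" | "k = 9" | "k = 10" | "k = 11" | "k = 12" | "k = 13" | "k = 14"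
      by linarith
    then have "1 \<le> has X (prv 2 b) 1 + has X b 0 + has X b 1 + has X b 2 + has X b 3 + has X b 6 +
        has X (prv 1 b) 6"
    proof cases
      case 1
      have "has X b 8 = 0" using A[unfolded 1] s(7)[OF b] le[of b 8] by linarith
      then show ?thesis using bal 1 unfolding 1 balanced_literal by (auto split: if_splits)
    next
      case 2
      have "has X b 7 = 0" using A[unfolded 2] s(7)[OF b] le[of b 7] by linarith
      then show ?thesis using bal 2 unfolding 2 balanced_literal by (auto split: if_splits)
    next
      case 3
      have "has X b 10 = 0" using A[unfolded 3] s(8)[OF b] le[of b 10] by linarith
      then show ?thesis using bal 3 unfolding 3 balanced_literal by (auto split: if_splits)
    next
      case 4
      have "has X b 9 = 0" using A[unfolded 4] s(8)[OF b] le[of b 9] by linarith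
      then show ?thesis using bal 4 unfolding 4 balanced_literal by (auto split: if_splits)
    next
      case 5
      have "has X b 12 = 0" using A[unfolded 5] s(9)[OF b] le[of b 12] by linarith
      then show ?thesis using bal 5 unfolding 5 balanced_literal by (auto split: if_splits)
    next
      case 6
      have "has X b 11 = 0" using A[unfolded 6] s(9)[OF b] le[of b 11] by linarith
      then show ?thesis using bal 6 unfolding 6 balanced_literal by (auto split: if_splits)
    next
      case 7
      have "has X b 14 = 0" using A[unfolded 7] s(10)[OF b] le[of b 14] by linarith
      then show ?thesis using bal 7 unfolding 7 balanced_literal by (auto split: if_splits)
    next
      case 8
      have "has X b 13 = 0" using A[unfolded 8] s(10)[OF b] le[of b 13] by linarith
      then show ?thesis using bal 8 unfolding 8 balanced_literal by (auto split: if_splits)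
    qed
    then have "has X (prv 2 b) 1 \<noteq> 0 \<or> has X b 0 \<noteq> 0 \<or> has X b 1 \<noteq> 0 \<or> has X b 2 \<noteq> 0 \<or>
        has X b 3 \<noteq> 0 \<or> has X b 6 \<noteq> 0 \<or> has X (prv 1 b) 6 \<noteq> 0" by linarith
    then have "has X (prv 2 b) 1 = 1 \<or> has X b 0 = 1 \<or> has X b 1 = 1 \<or> has X b 2 = 1 \<or>
        has X b 3 = 1 \<or> has X b 6 = 1 \<or> has X (prv 1 b) 6 = 1" by (simp only: has_1)
    then show ?thesis
      using start[OF c(2), of 1] start[OF b, of 0] start[OF b, of 1] start[OF b, of 2] start[OF b, of 3]
        start6[OF b] start6[OF c(1)] b c by auto
  qed
  obtain x where "x \<in> X" using X(2) by blast
  then obtain b k where bk: "has X b k = 1" "k < 21" by (cases x rule: vx_cases) (auto simp: has_1)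
  then have b: "b < B" using XV in_V by (auto simp: has_1)
  have "k < 15" using z[of k b] bk by (cases "k < 15") auto
  then have "\<exists>c<B. has X c 0 = 1"
    using start[OF b _ bk(1)] start6[OF b] lit[OF b _ _ bk(1)] b bk(1)
    by (cases "k < 6"; cases "k = 6") auto
  then obtain c where c: "c < B" "has X c 0 = 1" by blast
  have all: "has X b 0 = 1" if "b < B" for b
  proof (rule cyclic_induct[of "\<lambda>b. has X b 0 = 1", OF c(2,1) _ that])
    fix b assume "b < B" "has X b 0 = 1"
    then show "has X (nxt 1 b) 0 = 1" using chain by blast
  qed
  have "has X b k = has ?A b k" if b: "b < B" and k: "k < 21" for b k
  proof -
    \<comment> \<open>Literal 7 hangs on wire 1 of the block for the same variable in the previous
      clause, so it is recovered from there.\<close>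
    have p: "prv 2 b < B" "nxt 2 (prv 2 b) = b" using prv_less nxt_prv b by auto
    have "has X (prv 2 b) 1 = 1" using chain[OF p(1) all[OF p(1)]] by blast
    then have c7: "has X b 7 = has ?A b 7" using s1[OF p(1)] p(2) by simp
    have sp: "has X b 0 = 1" "has X b 1 = 1" "has X b 2 = 1" "has X b 3 = 1" "has X b 4 = 1" "has X b 5 = 1"
      using all[OF b] chain[OF b all[OF b]] by blast+
    have "\<forall>k<21. has X b k = has ?A b k"
      unfolding all_kinds
      using sp s(1)[OF b] s0[OF b sp(1)] s1[OF b sp(2)] s2[OF b sp(3)] s3[OF b sp(4)] c7
        z[of _ b] s(2)[OF b, of _ b] by simp
    then show ?thesis using k by blast
  qed
  note eq = this
  have "?A \<subseteq> X"
  proof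
    fix x assume x: "x \<in> ?A"
    obtain b k where bk: "x = vx b k" "k < 21" by (rule vx_cases)
    then have "b < B" using x in_V by (auto simp: solution_def)
    from eq[OF this bk(2)] x show "x \<in> X" unfolding bk(1) by (metis has_1(1))
  qed
  with X(1) show ?thesis by blast
qed

lemma satisfies_imp_ext:
  assumes "satisfies \<alpha>"
  shows "ext_gmda V E U N"
  unfolding ext_gmda_def globally_minimal_defensive_alliance_def
proof (intro exI[of _ "solution \<alpha>"] conjI allI impI)
  show "solution \<alpha> \<subseteq> V - N"
  proof
    fix x assume x: "x \<in> solution \<alpha>"
    obtain b k where bk: "x = vx b k" "k < 21" by (rule vx_cases)
    have "b < B" "member \<alpha> b k" using x bk by (auto simp: solution_def in_V vx_div_mod)
    then show "x \<in> V - N"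
      using bk x prefix_end[OF assms, of b] by (auto simp: N_def solution_def vx_div_mod member_def prefix_def)
  qed
  show "U \<subseteq> solution \<alpha>" by (auto simp: U_def solution_def member_def)
  have "vx 0 0 \<in> solution \<alpha>" using B_pos(1) by (simp add: solution_def in_V member_def vx_div_mod)
  then show "solution \<alpha> \<noteq> {}" by blast
  show "defensive_alliance V E (solution \<alpha>)" by (rule solution_alliance[OF assms])
  fix X assume "X \<subset> solution \<alpha>"
  then show "\<not> (X \<noteq> {} \<and> defensive_alliance V E X)" using solution_minimal[OF assms, of X] by blast
qed

section \<open>From globally minimal alliances to satisfying assignments\<close>

lemma ext_imp_satisfies:
  assumes "ext_gmda V E U N"
  shows "\<exists>\<alpha>. satisfies \<alpha>"
proof -
  obtain A where A: "A \<subseteq> V - N" "U \<subseteq> A" and gm: "globally_minimal_defensive_alliance V E A"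
    using assms unfolding ext_gmda_def by blast
  note gm = gm[unfolded globally_minimal_defensive_alliance_def]
  have AV: "A \<subseteq> V" using A(1) by blast
  have z: "has A b k = 0" if "k < 21" "15 \<le> k" for b k
    using A(1) that by (auto simp: has_def N_def vx_div_mod dest!: subsetD)
  have u: "has A b k = 1" if "b < B" "k < 7" for b k
    using A(2) that by (auto simp: has_def U_def vx_div_mod in_V)
  have bal: "balanced A b i" if "b < B" "i < 7" for b i
    using gm[THEN conjunct2, THEN conjunct1] u[OF that] that unfolding alliance_iff[OF AV] by (auto simp: has_1)
  have z': "\<forall>b. \<forall>k. k < 21 \<and> 15 \<le> k \<longrightarrow> has A b k = 0" using z by blast
  note sp = balanced_spine[OF z']
  have pair: "has A b i + has A b j \<le> 1" if b: "b < B" and ij: "(i, j) \<in> {(7, 8), (9, 10), (11, 12), (13, 14)}" for b i j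
  proof (rule ccontr)
    assume "\<not> has A b i + has A b j \<le> 1"
    then have in_A: "vx b i \<in> A" "vx b j \<in> A"
      by (auto simp: has_def of_bool_def split: if_splits)
    let ?X = "{vx b i, vx b j}"
    have XV: "?X \<subseteq> V" using in_A AV by blast
    have h: "has ?X b i = 1" "has ?X b j = 1" by (auto simp: has_def)
    have "i < 21" "j < 21" "balanced ?X b i" "balanced ?X b j"
      using ij h by (auto simp: balanced_literal)
    then have "defensive_alliance V E ?X" unfolding alliance_iff[OF XV] by (auto simp: vx_eq)
    \<comment> \<open>This forced vertex makes the pair a proper subset of \<open>A\<close>, against
      minimality.\<close>
    moreover have "vx b 0 \<in> A - ?X" using u[OF b, of 0] ij by (auto simp: has_1 vx_eq)
    ultimately show False using gm in_A by (metis Diff_iff empty_subsetI insert_not_empty insert_subset psubsetI)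
  qed
  have wires: "1 \<le> has A b 8 + has A b 9" "1 \<le> has A b 10 + has A (nxt 2 b) 7"
    "1 \<le> has A b 12 + has A b 13" "1 \<le> has A b 14 + has A b 11" if b: "b < B" for b
    using bal[OF b, of 0] bal[OF b, of 1] bal[OF b, of 2] bal[OF b, of 3] has_le[of A "prv 1 b" 5]
    unfolding sp using u[OF b] by simp_all
  have excl': "has A b 7 + has A b 8 \<le> 1" "has A b 9 + has A b 10 \<le> 1" "has A b 11 + has A b 12 \<le> 1"
    "has A b 13 + has A b 14 \<le> 1" if "b < B" for b
    using pair[OF that] by auto
  \<comment> \<open>The value is read in the first clause, where block numbers and variable numbers
    coincide.\<close>
  define \<alpha> where "\<alpha> v \<longleftrightarrow> has A v 7 = 1" for v
  \<comment> \<open>Presence of 7 excludes 8, so wire 0 needs 9, which excludes 10, so wire 1 needs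
    the 7 of the next clause.\<close>
  have step: "has A (nxt 2 b) 7 = 1" if "b < B" "has A b 7 = 1" for b
    using wires[OF that(1)] excl'[OF that(1)] that(2) has_le[of A "nxt 2 b" 7] by linarith
  have col: "has A b 7 = 1 \<longleftrightarrow> \<alpha> (b mod w)" if "b < B" for b
  proof -
    have "b mod w < w" using w by simp
    then have "b mod w < B" using B_pos(2) by linarith
    \<comment> \<open>The implications only lead forward; the converse comes from going on around
      the closed cycle, hence the two inductions.\<close>
    then show ?thesis unfolding \<alpha>_def
      using column_induct[of "\<lambda>b. has A b 7 = 1" b, OF _ that step, of "b mod w"]
        column_induct[of "\<lambda>b. has A b 7 = 1" "b mod w", OF _ _ step that] by auto
  qed
  have lit: "satisfied \<alpha> b" if "b < B"
    "1 \<le> (if pos b then has A b 7 else 0) + (if neg b then has A b 10 else 0)" for b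
  proof -
    have "has A b 7 = 0" if "has A b 10 = 1"
      using wires[OF \<open>b < B\<close>] excl'[OF \<open>b < B\<close>] that by linarith
    moreover have "has A b 7 = 1 \<or> has A b 10 = 1 \<and> neg b" "has A b 7 = 1 \<Longrightarrow> pos b \<or> has A b 10 = 1 \<and> neg b"
      using that(2) excl[of b] has_le[of A b 7] has_le[of A b 10] by (auto split: if_splits)
    ultimately show ?thesis using col[OF that(1)] by (auto simp: satisfied_def)
  qed
  have "\<exists>v<w. satisfied \<alpha> (c * w + v)" if c: "c < m" for c
  proof (rule ccontr)
    assume no: "\<not> (\<exists>v<w. satisfied \<alpha> (c * w + v))"
    \<comment> \<open>Without a satisfied literal the prefix stays unsatisfied from the first
      variable, where 11 is excluded, to the last one, where the exclusion of 14 requires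
      11.\<close>
    have zero: "has A (c * w + v) 11 = 0" if "v < w" for v
      using that
    proof (induction v)
      case 0
      have "vx (c * w) 11 \<in> N \<or> vx (c * w) 11 \<notin> V"
        by (simp add: N_def vx_div_mod)
      then show ?case using A(1) by (auto simp: has_def)
    next
      case (Suc v)
      let ?b = "c * w + v"
      have b: "?b < B" "?b + 1 < B" using block_less[OF c] Suc.prems by force+
      have n: "nxt 1 ?b = ?b + 1" using b by (simp add: nxt_def)
      have "\<not> satisfied \<alpha> ?b" using no Suc.prems by auto
      then have "(if pos ?b then has A ?b 7 else 0) + (if neg ?b then has A ?b 10 else 0) = 0"
        using lit[OF b(1)] by linarith
      then have "1 \<le> has A (?b + 1) 14"
        using bal[OF b(1), of 6] u[OF b(1), of 0] u[OF b(1), of 2] u[OF b(1), of 4] Suc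
        unfolding sp n by simp
      then have "has A (?b + 1) 11 = 0"
        using wires[OF b(2)] excl'[OF b(2)] by linarith
      then show ?case by simp
    qed
    let ?b = "c * w + (w - 1)"
    have wl: "w - 1 < w" using w by simp
    have "vx ?b 14 \<in> N \<or> vx ?b 14 \<notin> V" using block_mod[OF wl] by (simp add: N_def vx_div_mod)
    then have "has A ?b 14 = 0" using A(1) by (auto simp: has_def)
    then show False using zero[OF wl] wires(4)[OF block_less[OF c wl]] by simp
  qed
  then show ?thesis unfolding satisfies_def by blast
qed

end

section \<open>Computing the gadget graph\<close>

lemma decidable_apply:
  "decidable (\<lambda>w e. P (w 0) (e 0)) \<Longrightarrow> definable u \<Longrightarrow> decidable (\<lambda>w e. P (w 0) (u w e))"
  by (rule decidable_Let[where P = "\<lambda>w e k. P (w 0) k"])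

locale gadget_family =
  fixes m w :: "bool list \<Rightarrow> nat" and pos neg :: "bool list \<Rightarrow> nat \<Rightarrow> bool"
  assumes graph: "\<And>x. gadget_graph (m x) (w x) (pos x) (neg x)"
    and m_def: "definable (\<lambda>i e. m (i 0))" and w_def: "definable (\<lambda>i e. w (i 0))"
    and pos_dec: "decidable (\<lambda>i e. pos (i 0) (e 0))" and neg_dec: "decidable (\<lambda>i e. neg (i 0) (e 0))"
begin

abbreviation "size_of x \<equiv> 21 * (m x * w x)"
abbreviation "edges_of x \<equiv> gadget_graph.E (m x) (w x) (pos x) (neg x)"
abbreviation "U_of x \<equiv> gadget_graph.U (m x) (w x)"
abbreviation "N_of x \<equiv> gadget_graph.N (m x) (w x)"

definition reduce :: "bool list \<Rightarrow> bool list" where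
  "reduce x = encode (size_of x) (edges_of x) (U_of x) (N_of x)"

lemma definable_nxt:
  assumes "definable u"
  shows "definable (\<lambda>i e. gadget_graph.nxt (m (i 0)) (w (i 0)) s (u i e))"
  unfolding gadget_graph.nxt_def[OF graph] gadget_graph.B_def[OF graph]
  by (intro definable_intros definable_mod assms m_def w_def)

lemma decidable_guard:
  assumes "definable u"
  shows "decidable (\<lambda>i e. gadget_graph.guard (pos (i 0)) (neg (i 0)) g (u i e))"
  unfolding gadget_graph.guard_def[OF graph]
  by (intro definable_intros decidable_apply[OF pos_dec assms] decidable_apply[OF neg_dec assms])

lemma decidable_link:
  assumes "definable u" "definable v"
  shows "decidable (\<lambda>i e. gadget_graph.link (m (i 0)) (w (i 0)) (pos (i 0)) (neg (i 0)) (u i e) (v i e))"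
  unfolding gadget_graph.link_def[OF graph] case_prod_beta
  by (intro decidable_Bex_list definable_intros definable_mod definable_div definable_nxt decidable_guard assms)

lemma decidable_reduce:
  "decidable (\<lambda>i e. encode_bit (size_of (i 0)) (edges_of (i 0)) (U_of (i 0)) (N_of (i 0)) (e 0))"
  unfolding encode_bit_def gadget_graph.E_iff[OF graph] gadget_graph.B_def[OF graph]
    gadget_graph.U_def[OF graph] gadget_graph.N_def[OF graph] gadget_graph.V_def[OF graph]
    mem_Collect_eq lessThan_iff
  by (intro definable_intros definable_div definable_mod decidable_link m_def w_def)

lemma reduce_computable: "poly_time_computable reduce"
proof -
  let ?n = "\<lambda>i :: nat \<Rightarrow> bool list. size_of (i 0)"
  have "definable (\<lambda>i e. ?n i + 1 + ?n i * ?n i + ?n i + ?n i)"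
    by (intro definable_intros m_def w_def)
  from definable_computable[OF this decidable_reduce]
  show ?thesis unfolding reduce_def encode_map by (simp add: inputs_def)
qed

text \<open>Membership only provides some instance with the same code, and \<open>encode_inj\<close>
  identifies it with the gadget graph. The assumption on \<open>C\<close> holds for both classes of
  graphs under consideration.\<close>

lemma reduce_correct:
  assumes C: "\<And>V E. bipartite V E \<Longrightarrow> max_degree V E \<le> 9 \<Longrightarrow> C V E"
  shows "reduce x \<in> ext_gmda_language C \<longleftrightarrow> (\<exists>\<alpha>. gadget_graph.satisfies (m x) (w x) (pos x) (neg x) \<alpha>)"
proof -
  interpret gadget_graph "m x" "w x" "pos x" "neg x" by (rule graph)
  have V: "V = {..<size_of x}" by (simp add: V_def B_def)
  have ok: "instance_ok (size_of x) E U N"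
    using simple_graph_E unfolding instance_ok_def V by (auto simp: U_def N_def V)
  have "reduce x \<in> ext_gmda_language C \<longleftrightarrow> ext_gmda {..<size_of x} E U N"
  proof
    assume "reduce x \<in> ext_gmda_language C"
    then obtain n E' U' N' where e: "encode (size_of x) E U N = encode n E' U' N'"
      and ok': "instance_ok n E' U' N'" and "ext_gmda {..<n} E' U' N'"
      unfolding ext_gmda_language_def reduce_def by blast
    then show "ext_gmda {..<size_of x} E U N" using encode_inj[OF ok ok' e] by simp
  next
    assume "ext_gmda {..<size_of x} E U N"
    moreover have "C {..<size_of x} E" using C bipartite_E max_degree_E unfolding V by blast
    ultimately show "reduce x \<in> ext_gmda_language C"
      unfolding ext_gmda_language_def reduce_def using ok by blast
  qed
  also have "\<dots> \<longleftrightarrow> (\<exists>\<alpha>. satisfies \<alpha>)"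
    unfolding V[symmetric] using satisfies_imp_ext ext_imp_satisfies by blast
  finally show ?thesis .
qed

end

section \<open>A formula for the runs of a machine\<close>

definition digit :: "nat \<Rightarrow> nat \<Rightarrow> nat \<Rightarrow> nat" where
  "digit b i n = n div b ^ i mod b"

lemma digit_snoc:
  assumes "d < b"
  shows "digit b 0 (n * b + d) = d" "digit b (Suc i) (n * b + d) = digit b i n"
  using assms by (simp_all add: digit_def div_mult2_eq)

lemma digit_less: "0 < b \<Longrightarrow> digit b i n < b"
  by (simp add: digit_def)

lemma snoc_less: "n < b ^ i \<Longrightarrow> d < b \<Longrightarrow> n * b + d < b ^ Suc i" for n b i d :: nat
  using matrix_index[of n "b ^ i" d b] by (simp add: mult.commute)

lemma definable_digit: "definable f \<Longrightarrow> definable g \<Longrightarrow> definable (\<lambda>w e. digit (f w e) i (g w e))"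
  unfolding digit_def by (intro definable_mod definable_div definable_power)

lemma definable_table2:
  assumes "definable f" "definable g"
  shows "definable (\<lambda>w e. if f w e < n \<and> g w e < k then F (f w e) (g w e) else 0)"
proof -
  \<comment> \<open>Pairs are numbered row by row; a second component out of range is sent to
    \<open>n * k\<close>, just outside the table.\<close>
  let ?h = "\<lambda>w e. (if g w e < k then f w e * k + g w e else n * k)"
  have h: "definable ?h" by (intro definable_intros assms)
  have "definable (\<lambda>w e. if ?h w e < n * k then F (?h w e div k) (?h w e mod k) else 0)"
    by (rule definable_table[OF h, where F = "\<lambda>i. F (i div k) (i mod k)"])
  moreover have "(let h = (if j < k then i * k + j else n * k) in if h < n * k then F (h div k) (h mod k) else 0)
      = (if i < n \<and> j < k then F i j else 0)" for i j
  proof (cases "j < k")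
    case True
    then have "i * k + j < n * k \<longleftrightarrow> i < n"
      using matrix_index[of i n j k] by (auto dest: add_lessD1)
    then show ?thesis using True by simp
  qed simp
  ultimately show ?thesis by (simp add: Let_def)
qed

locale np_machine =
  fixes M :: tm and R :: "bool list \<Rightarrow> bool list \<Rightarrow> bool" and p q :: "nat poly"
  assumes wf: "wf_tm M"
    and run: "\<And>x y. fst (run M x y (poly q (length x + length y))) = (if R x y then accepting else rejecting)"
begin

section \<open>Variables and clauses describing a run\<close>

definition "K = tapes M"
definition "D = symbols M + states M"
definition "scans = List.n_lists (K + 1) [0..<D]"
definition "Z = length scans"
definition certlen :: "bool list \<Rightarrow> nat" where "certlen x = poly p (length x)"
definition time :: "bool list \<Rightarrow> nat" where "time x = poly q (length x + certlen x)"
text \<open>Cells that are at most \<open>time x\<close> away from the head have \<open>r\<close> at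
  least 1, so the shift to \<open>r + 1 - mv z j\<close> does not truncate.\<close>

definition center :: "bool list \<Rightarrow> nat" where "center x = time x + 1"
definition base :: "bool list \<Rightarrow> nat" where "base x = 2 * time x + certlen x + (Z + D + K + 10)"

text \<open>The scan \<open>s\<close> lists the scanned symbols of all tapes followed by the state, which is treated as
  the content of an additional tape.\<close>

definition halting :: "nat list \<Rightarrow> bool" where
  "halting s \<longleftrightarrow> s ! K = accepting \<or> s ! K = rejecting"

text \<open>A scan is any list over the joint alphabet and need not stem from a configuration;
  \<open>mod D\<close> keeps the result in range where \<open>delta\<close> is
  unconstrained.\<close>

definition next_symbol :: "nat list \<Rightarrow> nat \<Rightarrow> nat" where
  "next_symbol s j = (if halting s then s ! j else
     (case delta M (s ! K) (take K s) of (st, acts) \<Rightarrow> (if j = K then st else fst (acts ! j)) mod D))"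

definition next_offset :: "nat list \<Rightarrow> nat \<Rightarrow> int" where
  "next_offset s j = (if halting s \<or> j = K then 0 else offset (snd (snd (delta M (s ! K) (take K s)) ! j)))"

definition sym :: "nat \<Rightarrow> nat \<Rightarrow> nat" where
  "sym z j = (if z < Z \<and> j < K + 1 then scans ! z ! j else 0)"

definition nxs :: "nat \<Rightarrow> nat \<Rightarrow> nat" where
  "nxs z j = (if z < Z \<and> j < K + 1 then next_symbol (scans ! z) j else 0)"

text \<open>The offset plus one, a natural number. Seen from the moving head, cell \<open>r\<close>
  is found at \<open>r + 1 - mv z j\<close> afterwards.\<close>

definition mv :: "nat \<Rightarrow> nat \<Rightarrow> nat" where
  "mv z j = (if z < Z \<and> j < K + 1 then nat (next_offset (scans ! z) j + 1) else 0)"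

text \<open>Only the certificate cells leave a choice, among blank, False and True.\<close>

definition allowed :: "bool list \<Rightarrow> nat \<Rightarrow> nat \<Rightarrow> nat \<Rightarrow> bool" where
  "allowed x j r a \<longleftrightarrow> (if j = 1 \<and> center x \<le> r \<and> r < center x + certlen x then a \<le> 2
     else a = (if j = 0 \<and> center x \<le> r then word_tape x (int (r - center x)) else 0))"

text \<open>The variable \<open>(t, j, r, a)\<close> says that at time \<open>t\<close> the cell of tape \<open>j\<close> at distance
  \<open>r - center x\<close> from the head carries the symbol \<open>a\<close>. A clause is given by \<open>(k, t, z, j, r, a)\<close>, where
  \<open>k\<close> is its kind: 0 and 1 are the transition under the scan \<open>z\<close> for the cell under the head and for
  the other cells, 2 and 3 the initial configuration, and 4 acceptance. All other clauses are
  replaced by the unit clause of a variable that is true in every run.\<close>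

definition premise :: "bool list \<Rightarrow> nat \<Rightarrow> nat \<Rightarrow> nat \<Rightarrow> nat \<Rightarrow> nat \<Rightarrow> nat \<Rightarrow> bool" where
  "premise x t z vt vj vr va \<longleftrightarrow> vt = t \<and> vj < K + 1 \<and> vr = center x \<and> va = sym z vj"

definition poslit ::
  "bool list \<Rightarrow> nat \<Rightarrow> nat \<Rightarrow> nat \<Rightarrow> nat \<Rightarrow> nat \<Rightarrow> nat \<Rightarrow> nat \<Rightarrow> nat \<Rightarrow> nat \<Rightarrow> nat \<Rightarrow> bool" where
  "poslit x k t z j r a vt vj vr va \<longleftrightarrow>
     (if k = 0 \<and> t < time x \<and> z < Z \<and> j < K + 1 then
        vt = t + 1 \<and> vj = j \<and> vr = center x + 1 - mv z j \<and> va = nxs z j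
      else if k = 1 \<and> t < time x \<and> z < Z \<and> j < K \<and> 1 \<le> r \<and> \<not> r = center x \<and> r < 2 * time x + 3 \<and> a < D then
        vt = t + 1 \<and> vj = j \<and> vr = r + 1 - mv z j \<and> va = a
      else if k = 2 \<and> j < K + 1 \<and> r < 2 * time x + 3 + certlen x then
        vt = 0 \<and> vj = j \<and> vr = r \<and> allowed x j r va
      else if k = 3 \<and> center x \<le> r \<and> r + 1 < center x + certlen x then
        vt = 0 \<and> vj = 1 \<and> vr = r + 1 \<and> va = 0
      else if k = 4 \<and> \<not> a = 1 \<and> a < D then False
      else vt = 0 \<and> vj = 0 \<and> vr = 0 \<and> va = 0)"

text \<open>Kind 2 is purely positive and offers three symbols on certificate cells; these are the
  clauses that are not Horn. Kind 3 propagates blanks, so that the certificate is a contiguous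
  word.\<close>

definition neglit ::
  "bool list \<Rightarrow> nat \<Rightarrow> nat \<Rightarrow> nat \<Rightarrow> nat \<Rightarrow> nat \<Rightarrow> nat \<Rightarrow> nat \<Rightarrow> nat \<Rightarrow> nat \<Rightarrow> nat \<Rightarrow> bool" where
  "neglit x k t z j r a vt vj vr va \<longleftrightarrow>
     (if k = 0 \<and> t < time x \<and> z < Z \<and> j < K + 1 then premise x t z vt vj vr va
      else if k = 1 \<and> t < time x \<and> z < Z \<and> j < K \<and> 1 \<le> r \<and> \<not> r = center x \<and> r < 2 * time x + 3 \<and> a < D then
        premise x t z vt vj vr va \<or> vt = t \<and> vj = j \<and> vr = r \<and> va = a
      else if k = 2 \<and> j < K + 1 \<and> r < 2 * time x + 3 + certlen x then False
      else if k = 3 \<and> center x \<le> r \<and> r + 1 < center x + certlen x then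
        vt = 0 \<and> vj = 1 \<and> vr = r \<and> va = 0
      else if k = 4 \<and> \<not> a = 1 \<and> a < D then vt = time x \<and> vj = K \<and> vr = center x \<and> va = a
      else False)"

definition "nclauses x = base x ^ 6"
text \<open>Four digits in base \<open>base x\<close> name a variable and six digits name a clause;
  the additional variable is the one that occurs in no clause.\<close>

definition "nvars x = base x ^ 4 + 1"

definition at_digits ::
  "(nat \<Rightarrow> nat \<Rightarrow> nat \<Rightarrow> nat \<Rightarrow> nat \<Rightarrow> nat \<Rightarrow> nat \<Rightarrow> nat \<Rightarrow> nat \<Rightarrow> nat \<Rightarrow> bool) \<Rightarrow> bool list \<Rightarrow> nat \<Rightarrow> bool" where
  "at_digits lit x b \<longleftrightarrow> (let c = b div nvars x; v = b mod nvars x; d = digit (base x) in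
     v < base x ^ 4 \<and> lit (d 5 c) (d 4 c) (d 3 c) (d 2 c) (d 1 c) (d 0 c) (d 3 v) (d 2 v) (d 1 v) (d 0 v))"

definition "pos x = at_digits (poslit x) x"
definition "neg x = at_digits (neglit x) x"

lemma not_both: "\<not> (poslit x k t z j r a vt vj vr va \<and> neglit x k t z j r a vt vj vr va)"
  unfolding poslit_def neglit_def premise_def by (simp split: if_split)

lemma graph: "gadget_graph (nclauses x) (nvars x) (pos x) (neg x)"
proof
  have "1 < base x" by (simp add: base_def)
  then show "0 < nclauses x" "1 < nvars x" by (simp_all add: nclauses_def nvars_def)
  show "\<not> (pos x b \<and> neg x b)" for b
    unfolding pos_def neg_def at_digits_def Let_def using not_both by blast
  show "\<not> pos x b \<and> \<not> neg x b" if "b mod nvars x = nvars x - 1" for b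
    unfolding pos_def neg_def at_digits_def Let_def that by (simp add: nvars_def)
qed

section \<open>Definability of the clauses\<close>

lemma definable_certlen: "definable (\<lambda>i e. certlen (i 0))"
  unfolding certlen_def by (intro definable_poly definable_length) simp

lemma definable_time: "definable (\<lambda>i e. time (i 0))"
  unfolding time_def by (intro definable_poly definable_add definable_length definable_certlen) simp

lemma definable_center: "definable (\<lambda>i e. center (i 0))"
  unfolding center_def by (intro definable_intros definable_time)

lemma definable_base: "definable (\<lambda>i e. base (i 0))"
  unfolding base_def by (intro definable_intros definable_time definable_certlen)

lemma definable_nclauses: "definable (\<lambda>i e. nclauses (i 0))"
  unfolding nclauses_def by (intro definable_power definable_base)

lemma definable_nvars: "definable (\<lambda>i e. nvars (i 0))"
  unfolding nvars_def by (intro definable_intros definable_power definable_base)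

lemma decidable_allowed:
  "definable j \<Longrightarrow> definable r \<Longrightarrow> definable a \<Longrightarrow> decidable (\<lambda>i e. allowed (i 0) (j i e) (r i e) (a i e))"
  unfolding allowed_def
  by (intro definable_intros definable_symbol definable_center definable_certlen) simp_all

lemma decidable_lits:
  assumes "definable k" "definable t" "definable z" "definable j" "definable r" "definable a"
    "definable vt" "definable vj" "definable vr" "definable va"
  shows "decidable (\<lambda>i e. poslit (i 0) (k i e) (t i e) (z i e) (j i e) (r i e) (a i e)
      (vt i e) (vj i e) (vr i e) (va i e))"
    and "decidable (\<lambda>i e. neglit (i 0) (k i e) (t i e) (z i e) (j i e) (r i e) (a i e)
      (vt i e) (vj i e) (vr i e) (va i e))"
  unfolding poslit_def neglit_def premise_def sym_def nxs_def mv_def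
  by (intro definable_intros decidable_allowed definable_time definable_certlen definable_center
      definable_table2 assms)+

lemma decidable_pos_neg: "decidable (\<lambda>i e. pos (i 0) (e 0))" "decidable (\<lambda>i e. neg (i 0) (e 0))"
  unfolding pos_def neg_def at_digits_def Let_def
  by (intro decidable_conj decidable_less decidable_lits definable_digit definable_div definable_mod
      definable_vars definable_power definable_base definable_nvars)+

sublocale gadget_family nclauses nvars pos neg
  by unfold_locales (rule gadget_graph.m[OF graph] gadget_graph.w[OF graph] gadget_graph.excl[OF graph]
      gadget_graph.dummy[OF graph] definable_nclauses definable_nvars decidable_pos_neg graph | assumption)+

section \<open>Tape contents relative to the heads\<close>

definition content :: "bool list \<Rightarrow> bool list \<Rightarrow> nat \<Rightarrow> nat \<Rightarrow> nat \<Rightarrow> nat" where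
  "content x y t j r = (case run M x y t of (st, ts) \<Rightarrow>
     if j = K then st else fst (ts ! j) (snd (ts ! j) + int r - int (center x)))"

definition scan_at :: "bool list \<Rightarrow> bool list \<Rightarrow> nat \<Rightarrow> nat list" where
  "scan_at x y t = map (\<lambda>j. content x y t j (center x)) [0..<K + 1]"

lemma K_ge: "2 \<le> K" and symbols_ge: "3 \<le> symbols M" and states_ge: "3 \<le> states M"
  using wf by (auto simp: wf_tm_def K_def)

lemma delta_valid:
  assumes "st < states M" "length as = K" "\<forall>a \<in> set as. a < symbols M" "delta M st as = (st', acts)"
  shows "st' < states M" "length acts = K" "\<And>j. j < K \<Longrightarrow> fst (acts ! j) < symbols M"
proof -
  have "st' < states M \<and> length acts = K \<and> (\<forall>(b, d) \<in> set acts. b < symbols M)"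
    using wf assms unfolding wf_tm_def K_def by fastforce
  then show "st' < states M" "length acts = K" "\<And>j. j < K \<Longrightarrow> fst (acts ! j) < symbols M"
    by (auto simp: case_prod_beta)
qed

lemma run_Suc: "run M x y (Suc t) = step M (run M x y t)"
  by (simp add: run_def)

lemma run_valid:
  assumes "run M x y t = (st, ts)"
  shows "st < states M \<and> length ts = K \<and> (\<forall>j<K. \<forall>i. fst (ts ! j) i < symbols M)"
  using assms
proof (induction t arbitrary: st ts)
  case 0
  have w: "word_tape v i < symbols M" for v i
    using symbols_ge by (auto simp: word_tape_def)
  have "ts ! j = (word_tape x, 0) \<or> ts ! j = (word_tape y, 0) \<or> ts ! j = (word_tape [], 0)" if "j < K" for j
    using 0 that K_ge by (auto simp: run_def init_def K_def nth_Cons split: nat.splits)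
  then have "\<forall>j<K. \<forall>i. fst (ts ! j) i < symbols M" using w by (metis fst_conv)
  then show ?case using 0 K_ge states_ge by (auto simp: run_def init_def K_def)
next
  case (Suc t)
  obtain st0 ts0 where r: "run M x y t = (st0, ts0)" by fastforce
  note v = Suc.IH[OF r]
  show ?case
  proof (cases "st0 = accepting \<or> st0 = rejecting")
    case True
    then show ?thesis using Suc.prems v unfolding run_Suc r by (simp add: step_def)
  next
    case False
    let ?as = "map (\<lambda>(t, h). t h) ts0"
    obtain st' acts where d: "delta M st0 ?as = (st', acts)" by fastforce
    have as: "length ?as = K" "\<forall>a \<in> set ?as. a < symbols M"
      using v by (auto simp: in_set_conv_nth) (metis fst_conv)
    note dv = delta_valid[OF _ as d] v
    have e: "st = st'" "ts = map2 act ts0 acts"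
      using Suc.prems False d unfolding run_Suc r by (auto simp: step_def)
    have "fst (ts ! j) i < symbols M" if "j < K" for j i
      using dv(2,3) v that unfolding e by (simp add: act_def case_prod_beta)
    then show ?thesis using dv v unfolding e by simp
  qed
qed

lemma content_less: "j < K + 1 \<Longrightarrow> content x y t j r < D"
  using run_valid[of x y t] unfolding content_def D_def
  by (cases "run M x y t") (auto simp: less_Suc_eq trans_less_add1 trans_less_add2)

lemma scan_at_in: "scan_at x y t \<in> set scans"
  unfolding scans_def set_n_lists using content_less by (auto simp: scan_at_def simp del: upt_Suc)

lemma scan_at_nth: "j < K + 1 \<Longrightarrow> scan_at x y t ! j = content x y t j (center x)"
  by (simp add: scan_at_def del: upt_Suc)

text \<open>A head moving right makes the content appear to move left. Relating the positions over
  the integers keeps cells at the left boundary from being misplaced.\<close>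

lemma content_step:
  assumes j: "j < K + 1" and r: "int r' = int r - next_offset (scan_at x y t) j"
  shows "r = center x \<Longrightarrow> content x y (Suc t) j r' = next_symbol (scan_at x y t) j"
    and "r \<noteq> center x \<Longrightarrow> j < K \<Longrightarrow> content x y (Suc t) j r' = content x y t j r"
proof -
  obtain st ts where rt: "run M x y t = (st, ts)" by fastforce
  note v = run_valid[OF rt]
  let ?s = "scan_at x y t"
  have sK: "?s ! K = st" using scan_at_nth[of K] rt by (simp add: content_def)
  have h: "halting ?s \<longleftrightarrow> st = accepting \<or> st = rejecting" by (simp add: halting_def sK)
  have tk: "take K ?s = map (\<lambda>(t, h). t h) ts"
    by (rule nth_equalityI) (use v rt in \<open>auto simp: scan_at_def content_def case_prod_beta simp del: upt_Suc\<close>)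
  have "(r = center x \<longrightarrow> content x y (Suc t) j r' = next_symbol ?s j) \<and>
      (r \<noteq> center x \<longrightarrow> j < K \<longrightarrow> content x y (Suc t) j r' = content x y t j r)"
  proof (cases "halting ?s")
    case True
    then have "run M x y (Suc t) = run M x y t" unfolding run_Suc rt using h by (simp add: step_def)
    moreover have "r' = r" using r True by (simp add: next_offset_def)
    ultimately show ?thesis
      using True scan_at_nth[OF j, of x y t] by (simp add: content_def next_symbol_def)
  next
    case False
    obtain st' acts where d: "delta M st (take K ?s) = (st', acts)" by fastforce
    have as: "length (take K ?s) = K" "\<forall>a \<in> set (take K ?s). a < symbols M"
      unfolding tk using v by (auto simp: in_set_conv_nth) (metis fst_conv)
    note dv = delta_valid[OF v[THEN conjunct1] as d]
    have st: "run M x y (Suc t) = (st', map2 act ts acts)"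
      using False h d unfolding run_Suc rt by (simp add: step_def tk)
    show ?thesis
    proof (cases "j = K")
      case True
      then show ?thesis using False st d dv(1) by (simp add: content_def next_symbol_def sK D_def)
    next
      case jK: False
      then have jl: "j < K" using j by simp
      obtain tp hd where th: "ts ! j = (tp, hd)" by fastforce
      obtain b dr where bd: "acts ! j = (b, dr)" by fastforce
      have off: "next_offset ?s j = offset dr" using False jK d bd by (simp add: next_offset_def sK)
      have c: "content x y (Suc t) j r' = (tp(hd := b)) (hd + int r - int (center x))"
        using st jK jl v dv(2) th bd r off by (simp add: content_def act_def algebra_simps)
      have "b < D" using dv(3)[OF jl] bd by (simp add: D_def)
      then have "next_symbol ?s j = b" using False jK d bd by (simp add: next_symbol_def sK)
      moreover have "content x y t j r = tp (hd + int r - int (center x))"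
        using rt jK th by (simp add: content_def)
      ultimately show ?thesis unfolding c by auto
    qed
  qed
  then show "r = center x \<Longrightarrow> content x y (Suc t) j r' = next_symbol ?s j"
    and "r \<noteq> center x \<Longrightarrow> j < K \<Longrightarrow> content x y (Suc t) j r' = content x y t j r" by auto
qed

lemma content_init:
  "content x y 0 j r = (if j = 0 then word_tape x (int r - int (center x))
     else if j = 1 then word_tape y (int r - int (center x)) else 0)" if "j < K + 1"
proof -
  have "(replicate (K - 2) (word_tape [], 0) ! (j - 2)) = (word_tape [], 0)" if "j < K" "2 \<le> j"
    using that K_ge by simp
  then show ?thesis using that K_ge
    by (auto simp: content_def run_def init_def K_def[symmetric] nth_Cons' word_tape_def numeral_2_eq_2)
qed

lemma next_offset_range: "next_offset s j \<in> {-1, 0, 1}"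
proof -
  have "offset d \<in> {-1, 0, 1}" for d by (cases d) auto
  then show ?thesis by (auto simp: next_offset_def)
qed

lemma mv_offset:
  assumes "z < Z" "j < K + 1" "1 \<le> r"
  shows "int (r + 1 - mv z j) = int r - next_offset (scans ! z) j" "mv z j \<le> 2"
  using assms next_offset_range[of "scans ! z" j] by (auto simp: mv_def)

section \<open>Numbering of variables and clauses\<close>

definition code :: "bool list \<Rightarrow> nat \<Rightarrow> nat \<Rightarrow> nat \<Rightarrow> nat \<Rightarrow> nat" where
  "code x t j r a = ((t * base x + j) * base x + r) * base x + a"

lemma digits_code:
  assumes "t < base x" "j < base x" "r < base x" "a < base x"
  shows "digit (base x) 3 (code x t j r a) = t" "digit (base x) 2 (code x t j r a) = j"
    "digit (base x) 1 (code x t j r a) = r" "digit (base x) 0 (code x t j r a) = a"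
    "code x t j r a < base x ^ 4"
proof -
  have "digit (base x) 0 t = t" using assms(1) by (simp add: digit_def)
  then show "digit (base x) 3 (code x t j r a) = t" "digit (base x) 2 (code x t j r a) = j"
    "digit (base x) 1 (code x t j r a) = r" "digit (base x) 0 (code x t j r a) = a"
    using assms by (simp_all add: code_def digit_snoc numeral_3_eq_3 numeral_2_eq_2)
  have "t < base x ^ 1" using assms by simp
  from snoc_less[OF snoc_less[OF snoc_less[OF this assms(2)] assms(3)] assms(4)]
  show "code x t j r a < base x ^ 4" by (simp add: code_def eval_nat_numeral)
qed

lemma code_digits:
  assumes "v < base x ^ 4"
  shows "code x (digit (base x) 3 v) (digit (base x) 2 v) (digit (base x) 1 v) (digit (base x) 0 v) = v"
proof -
  let ?b = "base x"
  have "v div ?b div ?b div ?b < ?b"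
    using assms by (simp add: div_mult2_eq[symmetric] less_mult_imp_div_less eval_nat_numeral mult.assoc)
  then have "digit ?b 3 v = v div ?b div ?b div ?b"
    by (simp add: digit_def eval_nat_numeral div_mult2_eq)
  moreover have "digit ?b 2 v = v div ?b div ?b mod ?b" "digit ?b 1 v = v div ?b mod ?b" "digit ?b 0 v = v mod ?b"
    by (simp_all add: digit_def eval_nat_numeral div_mult2_eq)
  ultimately show ?thesis unfolding code_def by (simp only: div_mult_mod_eq)
qed

abbreviation "sat x \<equiv> gadget_graph.satisfies (nclauses x) (nvars x) (pos x) (neg x)"

text \<open>Digits and codes are inverse to each other, so quantifying over clause and variable
  numbers is the same as quantifying over their parameters.\<close>

lemma sat_iff:
  "sat x \<alpha> \<longleftrightarrow> (\<forall>k t z j r a. k < base x \<and> t < base x \<and> z < base x \<and> j < base x \<and> r < base x \<and> a < base x \<longrightarrow>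
     (\<exists>vt vj vr va. vt < base x \<and> vj < base x \<and> vr < base x \<and> va < base x \<and>
       (poslit x k t z j r a vt vj vr va \<and> \<alpha> (code x vt vj vr va) \<or>
        neglit x k t z j r a vt vj vr va \<and> \<not> \<alpha> (code x vt vj vr va))))" (is "_ \<longleftrightarrow> ?R")
proof -
  let ?b = "base x"
  have b0: "0 < ?b" by (simp add: base_def)
  define lits where "lits c v \<longleftrightarrow>
     poslit x (digit ?b 5 c) (digit ?b 4 c) (digit ?b 3 c) (digit ?b 2 c) (digit ?b 1 c) (digit ?b 0 c)
       (digit ?b 3 v) (digit ?b 2 v) (digit ?b 1 v) (digit ?b 0 v) \<and> \<alpha> v \<or>
     neglit x (digit ?b 5 c) (digit ?b 4 c) (digit ?b 3 c) (digit ?b 2 c) (digit ?b 1 c) (digit ?b 0 c)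
       (digit ?b 3 v) (digit ?b 2 v) (digit ?b 1 v) (digit ?b 0 v) \<and> \<not> \<alpha> v" for c v
  have "gadget_graph.satisfied (nvars x) (pos x) (neg x) \<alpha> (c * nvars x + v) \<longleftrightarrow> v < ?b ^ 4 \<and> lits c v"
    if "v < nvars x" for c v
    using that unfolding gadget_graph.satisfied_def[OF graph]
    unfolding pos_def neg_def at_digits_def Let_def lits_def
    by auto
  note satisfied = this
  have lt: "v < nvars x" if "v < ?b ^ 4" for v using that by (simp add: nvars_def)
  have 1: "sat x \<alpha> \<longleftrightarrow> (\<forall>c < ?b ^ 6. \<exists>v < ?b ^ 4. lits c v)"
    unfolding gadget_graph.satisfies_def[OF graph] unfolding nclauses_def using satisfied lt by blast
  show ?thesis
  proof
    assume L: "sat x \<alpha>"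
    show ?R
    proof (intro allI impI)
      fix k t z j r a
      assume a: "k < ?b \<and> t < ?b \<and> z < ?b \<and> j < ?b \<and> r < ?b \<and> a < ?b"
      let ?c = "((((k * ?b + t) * ?b + z) * ?b + j) * ?b + r) * ?b + a"
      have "digit ?b 0 k = k" using a by (simp add: digit_def)
      then have d: "digit ?b 5 ?c = k" "digit ?b 4 ?c = t" "digit ?b 3 ?c = z" "digit ?b 2 ?c = j"
        "digit ?b 1 ?c = r" "digit ?b 0 ?c = a"
        using a by (simp_all add: digit_snoc eval_nat_numeral del: power_Suc)
      have "k < ?b ^ 1" using a by simp
      then have "?c < ?b ^ Suc (Suc (Suc (Suc (Suc 1))))" using a by (intro snoc_less) auto
      then have "?c < ?b ^ 6" by (simp add: eval_nat_numeral)
      then obtain v where v: "v < ?b ^ 4" "lits ?c v" using L unfolding 1 by blast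
      have "digit ?b i v < ?b" for i using digit_less[OF b0] .
      then show "\<exists>vt vj vr va. vt < ?b \<and> vj < ?b \<and> vr < ?b \<and> va < ?b \<and>
        (poslit x k t z j r a vt vj vr va \<and> \<alpha> (code x vt vj vr va) \<or>
         neglit x k t z j r a vt vj vr va \<and> \<not> \<alpha> (code x vt vj vr va))"
        using v(2) code_digits[OF v(1)] unfolding lits_def d by metis
    qed
  next
    assume R: ?R
    have "\<exists>v < ?b ^ 4. lits c v" for c
    proof -
      have "digit ?b i c < ?b" for i using digit_less[OF b0] .
      then obtain vt vj vr va where v: "vt < ?b" "vj < ?b" "vr < ?b" "va < ?b"
        "poslit x (digit ?b 5 c) (digit ?b 4 c) (digit ?b 3 c) (digit ?b 2 c) (digit ?b 1 c) (digit ?b 0 c)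
           vt vj vr va \<and> \<alpha> (code x vt vj vr va) \<or>
         neglit x (digit ?b 5 c) (digit ?b 4 c) (digit ?b 3 c) (digit ?b 2 c) (digit ?b 1 c) (digit ?b 0 c)
           vt vj vr va \<and> \<not> \<alpha> (code x vt vj vr va)"
        using R by metis
      then show ?thesis
        using digits_code[OF v(1-4)] unfolding lits_def by (intro exI[of _ "code x vt vj vr va"]) simp
    qed
    then show "sat x \<alpha>" unfolding 1 by blast
  qed
qed

section \<open>Accepting runs and models of the formula\<close>

lemma run_halted:
  assumes "fst (run M x y n) = accepting \<or> fst (run M x y n) = rejecting" "n \<le> n'"
  shows "run M x y n' = run M x y n"
  using assms(2)
proof (induction n' rule: dec_induct)
  case (step n')
  then show ?case using assms(1) unfolding run_Suc by (cases "run M x y n") (simp add: step_def)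
qed simp

text \<open>Halting configurations are fixed points, so all admissible certificates can be judged at
  one common time that depends on \<open>x\<close> only.\<close>

lemma run_time:
  assumes "length y \<le> certlen x"
  shows "fst (run M x y (time x)) = accepting \<longleftrightarrow> R x y"
proof -
  have "poly q (length x + length y) \<le> time x"
    unfolding time_def using assms by (intro poly_nat_mono) simp
  from run_halted[OF _ this, of x y] run[of x y] show ?thesis by (auto split: if_splits)
qed

lemma D_pos: "3 < D" using symbols_ge states_ge by (simp add: D_def)

lemma scans_nth: "z < Z \<Longrightarrow> length (scans ! z) = K + 1 \<and> (\<forall>j < K + 1. scans ! z ! j < D)"
proof -
  assume "z < Z"
  then have "scans ! z \<in> set scans" by (simp add: Z_def)
  then have "length (scans ! z) = K + 1" "set (scans ! z) \<subseteq> {..<D}"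
    unfolding scans_def set_n_lists by auto
  then show ?thesis by (metis lessThan_iff nth_mem subsetD)
qed

lemma sym_less: "sym z j < D" and nxs_less: "nxs z j < D"
  using D_pos scans_nth[of z] by (auto simp: sym_def nxs_def next_symbol_def split: prod.splits)

lemma base_bounds:
  "D \<le> base x" "Z \<le> base x" "K + 1 < base x" "2 * time x + 3 + certlen x < base x"
  "center x + certlen x < base x" "center x + 3 < base x" "5 < base x" "time x + 1 < base x" "2 * time x + 5 < base x"
  by (auto simp: base_def center_def)

lemma scan_matches:
  assumes "z < Z" "\<And>j. j < K + 1 \<Longrightarrow> content x y t j (center x) = sym z j"
  shows "scan_at x y t = scans ! z"
  by (rule nth_equalityI)
    (use assms scans_nth[OF assms(1)] in \<open>auto simp: scan_at_def sym_def simp del: upt_Suc\<close>)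

text \<open>The assignment records the actual contents. A transition clause for a scan that does not
  occur is satisfied by a mismatching literal of its premise, one for the actual scan by the
  correctness of the step.\<close>

lemma accepting_run_satisfies:
  assumes "R x y" "length y \<le> certlen x"
  shows "\<exists>\<alpha>. sat x \<alpha>"
proof -
  define \<alpha> where "\<alpha> v \<longleftrightarrow> digit (base x) 2 v < K + 1 \<and>
    content x y (digit (base x) 3 v) (digit (base x) 2 v) (digit (base x) 1 v) = digit (base x) 0 v" for v
  note bd = base_bounds[of x]
  have \<alpha>: "\<alpha> (code x t j r a) \<longleftrightarrow> j < K + 1 \<and> content x y t j r = a"
    if "t < base x" "j < base x" "r < base x" "a < base x" for t j r a
    unfolding \<alpha>_def using digits_code[OF that] by simp
  have symb: "sym z j < base x" "nxs z j < base x" for z j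
    using sym_less[of z j] nxs_less[of z j] bd(1) by linarith+
  have "sat x \<alpha>" unfolding sat_iff
  proof (intro allI impI)
    fix k t z j r a
    assume range: "k < base x \<and> t < base x \<and> z < base x \<and> j < base x \<and> r < base x \<and> a < base x"
    let ?P = "poslit x k t z j r a" and ?N = "neglit x k t z j r a"
    let ?goal = "\<exists>vt vj vr va. vt < base x \<and> vj < base x \<and> vr < base x \<and> va < base x \<and>
       (?P vt vj vr va \<and> \<alpha> (code x vt vj vr va) \<or> ?N vt vj vr va \<and> \<not> \<alpha> (code x vt vj vr va))"
    have pos: ?goal if "?P vt vj vr va" "vt < base x" "vj < K + 1" "vr < base x" "va < base x"
      "content x y vt vj vr = va" for vt vj vr va
      using that \<alpha>[of vt vj vr va] bd(3) by (intro exI[of _ vt] exI[of _ vj] exI[of _ vr] exI[of _ va]) simp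
    have neg: ?goal if "?N vt vj vr va" "vt < base x" "vj < K + 1" "vr < base x" "va < base x"
      "content x y vt vj vr \<noteq> va" for vt vj vr va
      using that \<alpha>[of vt vj vr va] bd(3) by (intro exI[of _ vt] exI[of _ vj] exI[of _ vr] exI[of _ va]) simp
    have mismatch: ?goal if N: "\<And>vt vj vr va. premise x t z vt vj vr va \<Longrightarrow> ?N vt vj vr va"
      and z: "z < Z" and ne: "scan_at x y t \<noteq> scans ! z"
    proof -
      obtain j' where j': "j' < K + 1" "content x y t j' (center x) \<noteq> sym z j'"
        using scan_matches[OF z] ne by blast
      have "?N t j' (center x) (sym z j')" by (rule N) (use j' in \<open>simp add: premise_def\<close>)
      then show ?goal using symb bd(6) range j' by (intro neg[of t j' "center x" "sym z j'"]) auto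
    qed
    consider (A) "k = 0" "t < time x" "z < Z" "j < K + 1"
      | (B) "k = 1" "t < time x" "z < Z" "j < K" "1 \<le> r" "r \<noteq> center x" "r < 2 * time x + 3" "a < D"
      | (I) "k = 2" "j < K + 1" "r < 2 * time x + 3 + certlen x"
      | (Mn) "k = 3" "center x \<le> r" "r + 1 < center x + certlen x"
      | (F) "k = 4" "a \<noteq> 1" "a < D"
      | (O) "\<not> (k = 0 \<and> t < time x \<and> z < Z \<and> j < K + 1)"
          "\<not> (k = 1 \<and> t < time x \<and> z < Z \<and> j < K \<and> 1 \<le> r \<and> r \<noteq> center x \<and> r < 2 * time x + 3 \<and> a < D)"
          "\<not> (k = 2 \<and> j < K + 1 \<and> r < 2 * time x + 3 + certlen x)"
          "\<not> (k = 3 \<and> center x \<le> r \<and> r + 1 < center x + certlen x)" "\<not> (k = 4 \<and> a \<noteq> 1 \<and> a < D)"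
      by blast
    then show ?goal
    proof cases
      case A
      show ?goal
      proof (cases "scan_at x y t = scans ! z")
        case True
        have c1: "1 \<le> center x" by (simp add: center_def)
        have "content x y (t + 1) j (center x + 1 - mv z j) = nxs z j"
          using content_step(1)[OF A(4), of "center x + 1 - mv z j" "center x" x y t] True
            mv_offset(1)[OF A(3,4) c1] A(3,4) by (simp add: nxs_def)
        then show ?goal
          using A symb bd by (intro pos[of "t + 1" j "center x + 1 - mv z j" "nxs z j"]) (auto simp: poslit_def)
      next
        case False
        then show ?goal using A range by (intro mismatch) (auto simp: neglit_def)
      qed
    next
      case B
      show ?goal
      proof (cases "scan_at x y t = scans ! z")
        case False
        then show ?goal using B range by (intro mismatch) (auto simp: neglit_def)
      next
        case match: True
        show ?goal
        proof (cases "content x y t j r = a")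
          case True
          have j: "j < K + 1" using B by simp
          show ?goal
            by (rule pos[of "t + 1" j "r + 1 - mv z j" a])
              (use B content_step(2)[OF j, of "r + 1 - mv z j" r x y t] True match
                mv_offset[OF B(3) j B(5)] bd in \<open>auto simp: poslit_def\<close>)
        next
          case False
          then show ?goal using B bd by (intro neg[of t j r a]) (auto simp: neglit_def)
        qed
      qed
    next
      case I
      have "allowed x j r (content x y 0 j r)"
        using I(2) assms(2) by (auto simp: allowed_def content_init word_tape_def)
      then show ?goal
        using I bd content_less[OF I(2), of x y 0 r] by (intro pos[of 0 j r "content x y 0 j r"]) (auto simp: poslit_def)
    next
      case Mn
      have j: "1 < K + 1" using K_ge by simp
      have c: "content x y 0 1 s = word_tape y (int s - int (center x))" for s
        using content_init[OF j] by simp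
      show ?goal
      proof (cases "content x y 0 1 r = 0")
        case True
        then have "content x y 0 1 (r + 1) = 0" using Mn unfolding c by (auto simp: word_tape_def split: if_splits)
        then show ?goal using Mn bd j by (intro pos[of 0 1 "r + 1" 0]) (auto simp: poslit_def)
      next
        case False
        then show ?goal using Mn bd j by (intro neg[of 0 1 r 0]) (auto simp: neglit_def)
      qed
    next
      case F
      have "content x y (time x) K (center x) = 1"
        using run_time[OF assms(2)] assms(1) by (auto simp: content_def split: prod.splits)
      then show ?goal using F bd by (intro neg[of "time x" K "center x" a]) (auto simp: neglit_def)
    next
      case O
      \<comment> \<open>Position 0 lies left of the input because \<open>center x\<close> is
        positive, so the substitute unit clause is true.\<close>
      have "content x y 0 0 0 = 0" by (auto simp: content_init word_tape_def center_def)
      moreover have "?P 0 0 0 0" unfolding poslit_def using O by presburger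
      ultimately show ?goal using bd by (intro pos[of 0 0 0 0]) auto
    qed
  qed
  then show ?thesis by blast
qed

text \<open>A model may assign several symbols to one cell, so the run cannot be read off. Only a
  certificate is extracted; the clauses then force the contents of its run to be true, and among the
  final states only the accepting one is permitted.\<close>

lemma satisfies_accepting_run:
  assumes "sat x \<alpha>"
  shows "\<exists>y. length y \<le> certlen x \<and> R x y"
proof -
  define F where "F t j r a \<longleftrightarrow> \<alpha> (code x t j r a)" for t j r a
  note bd = base_bounds[of x]
  have cl: "\<exists>vt vj vr va. poslit x k t z j r a vt vj vr va \<and> F vt vj vr va \<or>
      neglit x k t z j r a vt vj vr va \<and> \<not> F vt vj vr va"
    if "k < base x" "t < base x" "z < base x" "j < base x" "r < base x" "a < base x" for k t z j r a
  proof -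
    have "k < base x \<and> t < base x \<and> z < base x \<and> j < base x \<and> r < base x \<and> a < base x" using that by blast
    from assms[unfolded sat_iff, rule_format, OF this] show ?thesis unfolding F_def by blast
  qed
  have cA: "F (t + 1) j (center x + 1 - mv z j) (nxs z j)"
    if "t < time x" "z < Z" "j < K + 1" "\<And>j. j < K + 1 \<Longrightarrow> F t j (center x) (sym z j)" for t z j
    using cl[of 0 t z j 0 0] that bd by (auto simp: poslit_def neglit_def premise_def)
  have cB: "F (t + 1) j (r + 1 - mv z j) a"
    if "t < time x" "z < Z" "j < K" "1 \<le> r" "r \<noteq> center x" "r < 2 * time x + 3" "a < D"
      "\<And>j. j < K + 1 \<Longrightarrow> F t j (center x) (sym z j)" "F t j r a" for t z j r a
    using cl[of 1 t z j r a] that bd by (auto simp: poslit_def neglit_def premise_def)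
  have cI: "\<exists>a. allowed x j r a \<and> F 0 j r a" if "j < K + 1" "r < 2 * time x + 3 + certlen x" for j r
    using cl[of 2 0 0 j r 0] that bd by (auto simp: poslit_def neglit_def)
  have cM: "F 0 1 (r + 1) 0" if "center x \<le> r" "r + 1 < center x + certlen x" "F 0 1 r 0" for r
    using cl[of 3 0 0 0 r 0] that bd by (auto simp: poslit_def neglit_def)
  have cF: "\<not> F (time x) K (center x) a" if "a \<noteq> 1" "a < D" for a
    using cl[of 4 0 0 0 0 a] that bd by (auto simp: poslit_def neglit_def)
  \<comment> \<open>The certificate ends at the first cell that the model declares blank, even if it
    declares other symbols there as well.\<close>
  define n where "n = (LEAST i. i = certlen x \<or> F 0 1 (center x + i) 0)"
  define y where "y = map (\<lambda>i. F 0 1 (center x + i) 2) [0..<n]"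
  have n: "n = certlen x \<or> F 0 1 (center x + n) 0" "n \<le> certlen x"
    unfolding n_def by (rule LeastI[of _ "certlen x"], simp) (rule Least_le, simp)
  have before: "\<not> F 0 1 (center x + i) 0" if "i < n" for i
    using not_less_Least[of i "\<lambda>i. i = certlen x \<or> F 0 1 (center x + i) 0"] that unfolding n_def by blast
  have after: "F 0 1 (center x + i) 0" if "n \<le> i" "i < certlen x" for i
    using that
  proof (induction i rule: dec_induct)
    case base
    then show ?case using n by auto
  next
    case (step i)
    then show ?case using cM[of "center x + i"] by simp
  qed
  have ylen: "length y = n" by (simp add: y_def)
  have j1: "1 < K + 1" using K_ge by simp
  have init: "F 0 j r (content x y 0 j r)" if jr: "j < K + 1" "r < 2 * time x + 3 + certlen x" for j r
  proof -
    obtain a where a: "allowed x j r a" "F 0 j r a" using cI[OF jr] by blast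
    show ?thesis
    proof (cases "j = 1 \<and> center x \<le> r \<and> r < center x + certlen x")
      case True
      define i where "i = r - center x"
      have r: "r = center x + i" and i: "i < certlen x" using True by (auto simp: i_def)
      have c: "content x y 0 j r = word_tape y (int i)"
        using True content_init[OF jr(1), of x y r] r by simp
      show ?thesis
      proof (cases "i < n")
        case True
        have "a \<noteq> 0" using before[OF True] a(2) \<open>j = 1 \<and> _\<close> r by (cases "a = 0") auto
        then have "a = 1 \<or> a = 2" using a(1) \<open>j = 1 \<and> _\<close> by (auto simp: allowed_def)
        \<comment> \<open>If the model makes both symbols 1 and 2 true, \<open>y\<close> has the bit
          True, and the variable for 2 is the required one.\<close>
        then show ?thesis unfolding c using True a(2) \<open>j = 1 \<and> _\<close> r ylen by (auto simp: word_tape_def y_def)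
      next
        case False
        then show ?thesis unfolding c using after[of i] i \<open>j = 1 \<and> _\<close> r ylen by (simp add: word_tape_def)
      qed
    next
      case False
      have "content x y 0 j r = a"
        using a(1) False jr n(2) ylen
        by (auto simp: content_init allowed_def word_tape_def split: if_splits)
      then show ?thesis using a(2) by simp
    qed
  qed
  \<comment> \<open>Heads move by at most one cell, so the window in which all contents are known
    shrinks by one cell on each side per step; it is large enough to contain the head until
    \<open>time x\<close>.\<close>
  have follow: "(\<forall>j<K. \<forall>r. center x \<le> r + (time x - t) \<and> r \<le> center x + (time x - t) \<longrightarrow> F t j r (content x y t j r)) \<and>
      F t K (center x) (content x y t K (center x))" if "t \<le> time x" for t
    using that
  proof (induction t)
    case 0
    then show ?case using init by (auto simp: center_def)
  next
    case (Suc t)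
    let ?s = "scan_at x y t"
    have IH: "F t j r (content x y t j r)"
      if "j < K" "center x \<le> r + (time x - t)" "r \<le> center x + (time x - t)" for j r
      using Suc that by auto
    have IHK: "F t K (center x) (content x y t K (center x))" using Suc by auto
    obtain z where z: "z < Z" "scans ! z = ?s" using scan_at_in unfolding Z_def by (metis in_set_conv_nth)
    have sym: "sym z j = content x y t j (center x)" if "j < K + 1" for j
      using that z scan_at_nth[OF that] by (simp add: sym_def)
    have prem: "F t j (center x) (sym z j)" if "j < K + 1" for j
      unfolding sym[OF that] using IH[of j "center x"] IHK that by (cases "j = K") auto
    have t: "t < time x" using Suc.prems by simp
    have c1: "1 \<le> center x" by (simp add: center_def)
    have under: "F (Suc t) j r' (content x y (Suc t) j r')"
      if j: "j < K + 1" and r: "int r' = int (center x) - next_offset ?s j" for j r'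
    proof -
      have "r' = center x + 1 - mv z j" using mv_offset(1)[OF z(1) j c1] r z(2) by simp
      moreover have "content x y (Suc t) j r' = nxs z j"
        using content_step(1)[OF j r] z j by (simp add: nxs_def)
      ultimately show ?thesis using cA[OF t z(1) j prem] by simp
    qed
    have "F (Suc t) j r' (content x y (Suc t) j r')"
      if j: "j < K" and r': "center x \<le> r' + (time x - Suc t)" "r' \<le> center x + (time x - Suc t)" for j r'
    proof -
      have j': "j < K + 1" using j by simp
      \<comment> \<open>The position of the same cell before the move; it is a natural number since
        \<open>r'\<close> is at least 1.\<close>
      define r where "r = nat (int r' + next_offset ?s j)"
      have "1 \<le> r'" using r' by (simp add: center_def)
      then have r: "int r' = int r - next_offset ?s j"
        using next_offset_range[of ?s j] by (auto simp: r_def)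
      have rr: "center x \<le> r + (time x - t)" "r \<le> center x + (time x - t)"
        using r r' t next_offset_range[of ?s j] by auto
      show ?thesis
      proof (cases "r = center x")
        case True
        then show ?thesis using under[OF j'] r by simp
      next
        case False
        have r1: "1 \<le> r" "r < 2 * time x + 3" using rr t by (auto simp: center_def)
        have "r' = r + 1 - mv z j" using mv_offset(1)[OF z(1) j' r1(1)] r z(2) by simp
        moreover have "content x y (Suc t) j r' = content x y t j r"
          using content_step(2)[OF j' r False j] .
        ultimately show ?thesis
          using cB[OF t z(1) j r1(1) False r1(2) content_less[OF j'] prem IH[OF j rr]] by simp
      qed
    qed
    moreover have "F (Suc t) K (center x) (content x y (Suc t) K (center x))"
      by (rule under) (auto simp: next_offset_def)
    ultimately show ?case by blast
  qed
  have "content x y (time x) K (center x) = 1"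
    using follow[of "time x"] cF content_less[of K x y "time x" "center x"] by auto
  then have "fst (run M x y (time x)) = accepting" by (auto simp: content_def split: prod.splits)
  then show ?thesis using run_time[of y x] n(2) ylen by auto
qed

lemma sat_iff_certificate: "(\<exists>\<alpha>. sat x \<alpha>) \<longleftrightarrow> (\<exists>y. length y \<le> poly p (length x) \<and> R x y)"
  using accepting_run_satisfies[of x] satisfies_accepting_run[of x] unfolding certlen_def by blast

end

section \<open>Hardness and completeness\<close>

lemma NP_reducible_to_ext_gmda:
  assumes "A \<in> NP" "\<And>V E. bipartite V E \<Longrightarrow> max_degree V E \<le> 9 \<Longrightarrow> C V E"
  shows "poly_reducible A (ext_gmda_language C)"
proof -
  obtain R p where R: "poly_time_decidable R" and A: "\<And>x. x \<in> A \<longleftrightarrow> (\<exists>y. length y \<le> poly p (length x) \<and> R x y)"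
    using assms(1) unfolding NP_def by blast
  obtain M q where M: "wf_tm M"
    "\<And>x y. fst (run M x y (poly q (length x + length y))) = (if R x y then accepting else rejecting)"
    using R unfolding poly_time_decidable_def by blast
  interpret np_machine M R p q by unfold_locales (rule M)+
  have "reduce x \<in> ext_gmda_language C \<longleftrightarrow> (\<exists>\<alpha>. sat x \<alpha>)" for x
    by (rule reduce_correct) (rule assms(2))
  then have "x \<in> A \<longleftrightarrow> reduce x \<in> ext_gmda_language C" for x
    unfolding A sat_iff_certificate by blast
  then show ?thesis unfolding poly_reducible_def using reduce_computable by blast
qed

theorem theorem2:
  "NP_complete (ext_gmda_language (\<lambda>V E. True)) \<and>
   NP_complete (ext_gmda_language (\<lambda>V E. bipartite V E \<and> max_degree V E \<le> 9))"
  unfolding NP_complete_def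
  using ext_gmda_in_NP[of "\<lambda>V E. True" False] ext_gmda_in_NP[of "\<lambda>V E. bipartite V E \<and> max_degree V E \<le> 9" True]
    NP_reducible_to_ext_gmda by simp

end
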